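(* Let $n\geq 2$ and let $K\subset\mathbb{R}^n$ be an $n$-dimensional convex body. Then the following are equivalent. (i) $K$ is an $n$-dimensional simplex. (ii) For all convex bodies $A,B\subset\mathbb{R}^n$, $$V_n(K)\,V_n(A,B,K[n-2])\leq V_n(K[n-1],A)\,V_n(K[n-1],B).$$ (iii) For every nonzero $x\in\operatorname{int}(K+(-K))$, the inequality $$V_n(K)\,V_n(A,B,K[n-2])\leq V_n(K[n-1],A)\,V_n(K[n-1],B)$$ holds with $A=[0,x]$ and $B=K\cap(K-x)$. (iv) For every direction $u\in\mathbb{S}^{n-1}$, $$\ell_K(u)=\frac{V_n(K)}{V_n(K[n-1],[0,u])}.$$ (v) For every full dimensional convex body $M\subset\mathbb{R}^n$, $$r(K,M)=\frac{V_n(K)}{V_n(K[n-1],M)}.$$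
   Context: A convex body in $\mathbb{R}^n$ is a nonempty compact convex subset of $\mathbb{R}^n$; it is called $n$-dimensional (or full dimensional) if it has nonempty interior. $\mathbb{S}^{n-1}$ is the Euclidean unit sphere of $\mathbb{R}^n$. An $n$-dimensional simplex is the convex hull of $n+1$ affinely independent points of $\mathbb{R}^n$. For $x\in\mathbb{R}^n$, $[0,x]$ is the line segment from the origin to $x$; $K+L=\{x+y:x\in K,\,y\in L\}$ is the Minkowski sum, $-K=\{-y:y\in K\}$ and $K-x=\{y-x:y\in K\}$. $V_n(K_1,\ldots,K_n)$ denotes the mixed volume of convex bodies $K_1,\dots,K_n\subset\mathbb{R}^n$, i.e. the unique functional that is symmetric in its arguments and satisfies, for all convex bodies $K_1,\dots,K_m$ and all $\lambda_1,\dots,\lambda_m\geq 0$, $\operatorname{vol}_n(\lambda_1K_1+\cdots+\lambda_mK_m)=\sum_{i_1,\dots,i_n=1}^m\lambda_{i_1}\cdots\lambda_{i_n}V_n(K_{i_1},\dots,K_{i_n})$. The notation $K[k]$ inside a mixed volume means that $K$ is repeated $k$ times, and $V_n(K)=V_n(K[n])$ is the volume of $K$. For $u\in\mathbb{S}^{n-1}$, $\ell_K(u)$ is the length of the longest chord (line segment contained in $K$) parallel to $u$. For a full dimensional convex body $M$, the relative inradius of $K$ with respect to $M$ is $r(K,M)=\max\{t\geq 0: z+tM\subseteq K\text{ for some }z\in\mathbb{R}^n\}$. *)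

theory Defs
  imports "HOL-Analysis.Analysis" "HOL-Library.Multiset"
begin

definition convex_body :: "'a::euclidean_space set \<Rightarrow> bool" where
  "convex_body K \<longleftrightarrow> K \<noteq> {} \<and> compact K \<and> convex K"

definition full_dim_convex_body :: "'a::euclidean_space set \<Rightarrow> bool" where
  "full_dim_convex_body K \<longleftrightarrow> convex_body K \<and> interior K \<noteq> {}"

definition body_tuple :: "'a::euclidean_space set list \<Rightarrow> bool" where
  "body_tuple Ks \<longleftrightarrow> length Ks = DIM('a) \<and> (\<forall>K\<in>set Ks. convex_body K)"

(* The axioms characterizing mixed volumes: symmetry, and the expansion of the volume
   of a Minkowski combination.  Addition of sets is the Minkowski sum of
   HOL-Library.Set_Algebras.  A list is in {..<m} represents a multi-index (i_1, ..., i_n). *)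
definition is_mixed_volume :: "('a::euclidean_space set list \<Rightarrow> real) \<Rightarrow> bool" where
  "is_mixed_volume V \<longleftrightarrow>
     (\<forall>Ks Ls. body_tuple Ks \<and> mset Ls = mset Ks \<longrightarrow> V Ls = V Ks) \<and>
     (\<forall>(m::nat) (K :: nat \<Rightarrow> 'a set) (c :: nat \<Rightarrow> real).
        (\<forall>i<m. convex_body (K i) \<and> 0 \<le> c i) \<longrightarrow>
        measure lborel (\<Sum>i<m. (\<lambda>x. c i *\<^sub>R x) ` K i) =
          (\<Sum>is | length is = DIM('a) \<and> set is \<subseteq> {..<m}.
             prod_list (map c is) * V (map K is)))"

(* Lists that are not n-tuples of convex bodies are not constrained by the axioms; the value 0
   is prescribed there so that the functional is unique as a total function. *)
definition mixed_volume :: "'a::euclidean_space set list \<Rightarrow> real" where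
  "mixed_volume = (THE V. is_mixed_volume V \<and> (\<forall>Ks. \<not> body_tuple Ks \<longrightarrow> V Ks = 0))"

(* For convex bodies K and directions u, the supremum is attained. *)
definition longest_chord :: "'a::euclidean_space set \<Rightarrow> 'a \<Rightarrow> real" where
  "longest_chord K u =
     Sup {norm (b - a) | a b. closed_segment a b \<subseteq> K \<and> (\<exists>t. b - a = t *\<^sub>R u)}"

(* For a convex body K and a full dimensional convex body M, the supremum is attained. *)
definition relative_inradius :: "'a::euclidean_space set \<Rightarrow> 'a set \<Rightarrow> real" where
  "relative_inradius K M = Sup {t. 0 \<le> t \<and> (\<exists>z. (\<lambda>y. z + t *\<^sub>R y) ` M \<subseteq> K)}"

(* V_n(K) V_n(A, B, K[n-2]) <= V_n(K[n-1], A) V_n(K[n-1], B), where V_n(K) = V_n(K[n]) is the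
   volume of K. *)
definition mixed_volume_ineq :: "'a::euclidean_space set \<Rightarrow> 'a set \<Rightarrow> 'a set \<Rightarrow> bool" where
  "mixed_volume_ineq K A B \<longleftrightarrow>
     measure lborel K * mixed_volume ([A, B] @ replicate (DIM('a) - 2) K)
       \<le> mixed_volume (replicate (DIM('a) - 1) K @ [A]) * mixed_volume (replicate (DIM('a) - 1) K @ [B])"

end

(* Existence of mixed volumes (Gromov). Polytopes P_i = conv Y_i are images, up to null sets, of the
   gradients g_i of the functions ln (sum of exp <x,y> over y in Y_i), and the gradient of a positive
   combination parametrizes the Minkowski combination injectively. Hence its volume is the integral of the
   determinant of a positive combination of positive semidefinite matrices. Polarizing the determinant
   pointwise and integrating gives the expansion with the coefficients
   V(K_1,...,K_n) = 1/n! * sum over S of (-1)^(n-|S|) vol(sum of the K_j with j in S);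
   general bodies follow by approximation.

   Write V(K;A) for V(K[n-1],A).  (i) => (ii), (v): every body A lies in a homothet z + sK of the simplex K
   whose facets all meet A, and then V(K;A) = s vol(K).  Monotonicity of V(K + bB; .) turns this into
   V(A,B,K[n-2]) <= s V(K;B).

   (iii) => (iv): let L_s be the intersection of K and K - su, and pi(X) = n V(X;[0,u]) the volume of the
   shadow of X. As [0,su] + L_s lies in K, (iii) and Minkowski's inequality for shadows (from
   Brunn-Minkowski) give pi(L_s) <= pi(K) (1 - s tau)^(n-1) with tau = V(K;[0,u]) / vol(K).  As vol(L_s)
   decreases at the rate at most pi(L_s), vol(L_s) >= vol(K) (1 - s tau)^n as long as s is less than the
   longest chord, so the longest chord cannot be shorter than 1 / tau.

   (v) => (iv): thicken the segment [0,u] by a small ball.  (iv) => (i): the points p_q below are the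
   vertices of K, one for each contact point q of an inscribed ball of maximal radius. *)

theory Submission
  imports Defs
begin

section \<open>Polarization\<close>

text \<open>\<open>mixed_volume\<close> is a definite description, so nothing is known about it
  before existence and uniqueness are proved. Afterwards a mixed volume is handled only as a
  one-sided derivative of a volume: an inequality between two volumes with equality at t = 0 passes
  to the derivatives, which takes the place of arguments with surface area measures. One half of
  (iv) holds for every body: a longest chord S lies in K, so V(K;S) <= vol(K). Only the reverse
  inequality carries information. The comparison function vol(K) (1 - s tau)^n is the exact volume
  for a simplex, whose slice L_s is a homothet of K with ratio 1 - s tau. Equality in (iv) says
  V(K;S) = vol(K), the equality case of monotonicity. There every boundary point of K has a
  supporting hyperplane that also touches S, and this is the geometric information from which the
  vertices are recovered.\<close>

lemma sum_alternating_Pow: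
  assumes "finite A"
  shows "(\<Sum>T\<in>Pow A. (-1::real) ^ card T) = 0 ^ card A"
  using assms
proof induction
  case (insert a A)
  have "(\<Sum>T\<in>Pow (insert a A). (-1::real) ^ card T) =
      (\<Sum>T\<in>Pow A. (-1) ^ card T) + (\<Sum>T\<in>insert a ` Pow A. (-1) ^ card T)"
    unfolding Pow_insert using insert.hyps by (intro sum.union_disjoint) auto
  also have "(\<Sum>T\<in>insert a ` Pow A. (-1::real) ^ card T) = (\<Sum>T\<in>Pow A. (-1) ^ card (insert a T))"
    using insert.hyps(2) by (subst sum.reindex) (auto simp: inj_on_def)
  also have "\<dots> = (\<Sum>T\<in>Pow A. - ((-1) ^ card T))"
  proof (rule sum.cong[OF refl])
    fix T assume "T \<in> Pow A"
    hence "finite T" "a \<notin> T" using insert.hyps finite_subset by auto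
    thus "(-1::real) ^ card (insert a T) = - ((-1) ^ card T)" by simp
  qed
  finally show ?case using insert.hyps by (simp add: sum_negf)
qed simp

text \<open>Inclusion-exclusion: passing to T = N - S turns the sum into the expansion of (1 - 1)^|N
  - U|.\<close>

lemma sum_alternating_supersets:
  assumes "finite N" "U \<subseteq> N"
  shows "(\<Sum>S | S \<subseteq> N \<and> U \<subseteq> S. (-1::real) ^ (card N - card S)) = (if U = N then 1 else 0)"
proof -
  have fin: "finite (N - U)" using assms by auto
  have "(\<Sum>S | S \<subseteq> N \<and> U \<subseteq> S. (-1::real) ^ (card N - card S)) = (\<Sum>T\<in>Pow (N - U). (-1) ^ card T)"
  proof (rule sum.reindex_bij_witness[of _ "\<lambda>T. N - T" "\<lambda>S. N - S"])
    fix S assume "S \<in> {S. S \<subseteq> N \<and> U \<subseteq> S}"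
    hence "S \<subseteq> N" "finite S" using assms finite_subset by blast+
    thus "(-1::real) ^ card (N - S) = (-1) ^ (card N - card S)"
      by (simp add: card_Diff_subset)
  qed (use assms in auto)
  also have "\<dots> = 0 ^ card (N - U)"
    using fin by (rule sum_alternating_Pow)
  finally show ?thesis using assms fin by (auto simp: power_0_left card_eq_0_iff)
qed

lemma finite_words: "finite {is :: nat list. length is = n \<and> set is \<subseteq> {..<m}}"
  using finite_lists_length_eq[of "{..<m}" n] by (simp add: conj_commute)

text \<open>Polarization of a form of degree n. The argument with entries
  \<open>card {j\<in>S. w ! j = i}\<close> is the sum over j in S of the unit vectors with index
  \<open>w ! j\<close>. Expanding the form there gives one term for each map from the n places into
  S, and the alternating sum over S keeps the maps onto {..<n}, the permutations. As
  \<open>p\<close> may depend on the order of the letters, all permutations remain on the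
  right.\<close>

lemma polarization_words:
  fixes p :: "nat list \<Rightarrow> real" and n :: nat
  defines "F \<equiv> \<lambda>m c. \<Sum>is | length is = n \<and> set is \<subseteq> {..<m}. prod_list (map c is) * p is"
  assumes w: "length w = n" "set w \<subseteq> {..<m}"
  shows "(\<Sum>S\<in>Pow {..<n}. (-1) ^ (n - card S) * F m (\<lambda>i. real (card {j\<in>S. w ! j = i}))) =
    (\<Sum>\<sigma> | \<sigma> permutes {..<n}. p (map (\<lambda>j. w ! \<sigma> j) [0..<n]))"
proof -
  let ?L = "{is. length is = n \<and> set is \<subseteq> {..<m}}"
  let ?q = "\<lambda>\<phi>. p (map (\<lambda>j. w ! \<phi> j) [0..<n])"
  have F: "F m (\<lambda>i. real (card {j\<in>S. w ! j = i})) = (\<Sum>\<phi>\<in>{..<n} \<rightarrow>\<^sub>E S. ?q \<phi>)"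
    if S: "S \<subseteq> {..<n}" for S
  proof -
    have fS: "finite S" using S finite_subset by blast
    have "prod_list (map (\<lambda>i. real (card {j\<in>S. w ! j = i})) ks) =
        (\<Sum>\<phi>\<in>{..<n} \<rightarrow>\<^sub>E S. if ks = map (\<lambda>j. w ! \<phi> j) [0..<n] then 1 else 0)" if ks: "ks \<in> ?L" for ks
    proof -
      have "prod_list (map (\<lambda>i. real (card {j\<in>S. w ! j = i})) ks) =
          (\<Prod>r<n. real (card {j\<in>S. w ! j = ks ! r}))"
        using that by (simp add: prod.list_conv_set_nth atLeast0LessThan)
      also have "\<dots> = (\<Prod>r<n. \<Sum>j\<in>S. if w ! j = ks ! r then 1 else 0)"
        by (simp add: sum.If_cases fS Int_def)
      also have "\<dots> = (\<Sum>\<phi>\<in>{..<n} \<rightarrow>\<^sub>E S. \<Prod>r<n. if w ! \<phi> r = ks ! r then 1 else 0)"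
        by (rule prod_sum_PiE) (auto simp: fS)
      also have "\<dots> = (\<Sum>\<phi>\<in>{..<n} \<rightarrow>\<^sub>E S. if ks = map (\<lambda>j. w ! \<phi> j) [0..<n] then 1 else 0)"
      proof (rule sum.cong[OF refl])
        fix \<phi>
        show "(\<Prod>r<n. if w ! \<phi> r = ks ! r then 1 else (0::real)) =
            (if ks = map (\<lambda>j. w ! \<phi> j) [0..<n] then 1 else 0)"
        proof (cases "ks = map (\<lambda>j. w ! \<phi> j) [0..<n]")
          case False
          then obtain r where "r < n" "w ! \<phi> r \<noteq> ks ! r"
            using ks nth_equalityI[of ks "map (\<lambda>j. w ! \<phi> j) [0..<n]"] by fastforce
          thus ?thesis using False by auto
        qed auto
      qed
      finally show ?thesis .
    qed
    hence "F m (\<lambda>i. real (card {j\<in>S. w ! j = i})) =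
        (\<Sum>ks\<in>?L. \<Sum>\<phi>\<in>{..<n} \<rightarrow>\<^sub>E S. if ks = map (\<lambda>j. w ! \<phi> j) [0..<n] then p ks else 0)"
      unfolding F_def by (intro sum.cong refl) (auto simp: sum_distrib_right intro!: sum.cong)
    also have "\<dots> = (\<Sum>\<phi>\<in>{..<n} \<rightarrow>\<^sub>E S. \<Sum>ks\<in>?L. if ks = map (\<lambda>j. w ! \<phi> j) [0..<n] then p ks else 0)"
      by (rule sum.swap)
    also have "\<dots> = (\<Sum>\<phi>\<in>{..<n} \<rightarrow>\<^sub>E S. ?q \<phi>)"
    proof (rule sum.cong[OF refl])
      fix \<phi> assume "\<phi> \<in> {..<n} \<rightarrow>\<^sub>E S"
      hence "set (map (\<lambda>j. w ! \<phi> j) [0..<n]) \<subseteq> set w"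
        using S w(1) by (force simp: PiE_iff)
      hence "map (\<lambda>j. w ! \<phi> j) [0..<n] \<in> ?L" using w(2) by simp
      thus "(\<Sum>ks\<in>?L. if ks = map (\<lambda>j. w ! \<phi> j) [0..<n] then p ks else 0) = ?q \<phi>"
        by (simp add: finite_words)
    qed
    finally show ?thesis .
  qed
  let ?E = "{..<n} \<rightarrow>\<^sub>E {..<n}"
  have "(\<Sum>S\<in>Pow {..<n}. (-1) ^ (n - card S) * F m (\<lambda>i. real (card {j\<in>S. w ! j = i}))) =
      (\<Sum>S\<in>Pow {..<n}. \<Sum>\<phi>\<in>?E. if \<phi> ` {..<n} \<subseteq> S then (-1) ^ (n - card S) * ?q \<phi> else 0)"
  proof (rule sum.cong[OF refl])
    fix S assume "S \<in> Pow {..<n}"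
    hence S: "S \<subseteq> {..<n}" by simp
    have "{\<phi> \<in> ?E. \<phi> ` {..<n} \<subseteq> S} = {..<n} \<rightarrow>\<^sub>E S"
      using S by (auto simp: PiE_def Pi_def)
    thus "(-1) ^ (n - card S) * F m (\<lambda>i. real (card {j\<in>S. w ! j = i})) =
        (\<Sum>\<phi>\<in>?E. if \<phi> ` {..<n} \<subseteq> S then (-1) ^ (n - card S) * ?q \<phi> else 0)"
      by (simp add: F[OF S] sum_distrib_left sum.inter_filter[symmetric] finite_PiE)
  qed
  also have "\<dots> = (\<Sum>\<phi>\<in>?E. \<Sum>S\<in>Pow {..<n}. if \<phi> ` {..<n} \<subseteq> S then (-1) ^ (n - card S) * ?q \<phi> else 0)"
    by (rule sum.swap)
  also have "\<dots> = (\<Sum>\<phi>\<in>?E. if \<phi> ` {..<n} = {..<n} then ?q \<phi> else 0)"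
  proof (rule sum.cong[OF refl])
    fix \<phi> assume "\<phi> \<in> ?E"
    hence im: "\<phi> ` {..<n} \<subseteq> {..<n}" by auto
    have "(\<Sum>S\<in>Pow {..<n}. if \<phi> ` {..<n} \<subseteq> S then (-1) ^ (n - card S) * ?q \<phi> else 0) =
        (\<Sum>S | S \<subseteq> {..<n} \<and> \<phi> ` {..<n} \<subseteq> S. (-1) ^ (n - card S) * ?q \<phi>)"
      by (simp add: sum.inter_filter[symmetric] conj_commute Pow_def)
    also have "\<dots> = (\<Sum>S | S \<subseteq> {..<n} \<and> \<phi> ` {..<n} \<subseteq> S. (-1) ^ (card {..<n} - card S)) * ?q \<phi>"
      by (simp add: sum_distrib_right)
    finally show "(\<Sum>S\<in>Pow {..<n}. if \<phi> ` {..<n} \<subseteq> S then (-1) ^ (n - card S) * ?q \<phi> else 0) =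
        (if \<phi> ` {..<n} = {..<n} then ?q \<phi> else 0)"
      using sum_alternating_supersets[OF _ im] by simp
  qed
  also have "\<dots> = (\<Sum>\<phi> | \<phi> \<in> ?E \<and> \<phi> ` {..<n} = {..<n}. ?q \<phi>)"
    by (simp add: sum.inter_filter[symmetric] finite_PiE)
  also have "\<dots> = (\<Sum>\<sigma> | \<sigma> permutes {..<n}. ?q \<sigma>)"
  \<comment> \<open>A permutation in the sense of \<open>permutes\<close> is the identity outside
    {..<n}, an element of \<open>?E\<close> is undefined there; the two witnesses translate between
    these conventions.\<close>
  proof (rule sum.reindex_bij_witness[of _ "\<lambda>\<sigma>. restrict \<sigma> {..<n}" "\<lambda>\<phi> i. if i < n then \<phi> i else i"])
    fix \<phi> assume "\<phi> \<in> {\<phi> \<in> ?E. \<phi> ` {..<n} = {..<n}}"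
    hence \<phi>: "\<phi> \<in> ?E" "\<phi> ` {..<n} = {..<n}" by auto
    hence "bij_betw \<phi> {..<n} {..<n}"
      by (simp add: bij_betw_def eq_card_imp_inj_on)
    hence "bij_betw (\<lambda>i. if i < n then \<phi> i else i) {..<n} {..<n}"
      by (subst bij_betw_cong[where g = \<phi>]) auto
    thus "(\<lambda>i. if i < n then \<phi> i else i) \<in> {\<sigma>. \<sigma> permutes {..<n}}"
      by (auto intro!: bij_imp_permutes split: if_splits)
    show "restrict (\<lambda>i. if i < n then \<phi> i else i) {..<n} = \<phi>"
      using \<phi>(1) by (auto simp: fun_eq_iff restrict_def PiE_iff extensional_def)
    show "?q (\<lambda>i. if i < n then \<phi> i else i) = ?q \<phi>"
      by (auto intro!: arg_cong[of _ _ p])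
  next
    fix \<sigma> assume "\<sigma> \<in> {\<sigma>. \<sigma> permutes {..<n}}"
    hence \<sigma>: "\<sigma> permutes {..<n}" by simp
    show "(\<lambda>i. if i < n then restrict \<sigma> {..<n} i else i) = \<sigma>"
      using permutes_not_in[OF \<sigma>] by (auto simp: fun_eq_iff)
    show "restrict \<sigma> {..<n} \<in> {\<phi> \<in> ?E. \<phi> ` {..<n} = {..<n}}"
      using permutes_image[OF \<sigma>] by (auto simp: PiE_iff)
  qed
  finally show ?thesis .
qed

text \<open>Rearranging the letters by a fixed permutation maps the set of words onto itself and
  keeps the weight of each word, so each of the n! permutations contributes the original
  sum.\<close>

lemma symmetrized_words:
  fixes p :: "nat list \<Rightarrow> real"
  shows "(\<Sum>is | length is = n \<and> set is \<subseteq> {..<m}. prod_list (map c is) *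
      (\<Sum>\<sigma> | \<sigma> permutes {..<n}. p (map (\<lambda>j. is ! \<sigma> j) [0..<n]))) =
    fact n * (\<Sum>is | length is = n \<and> set is \<subseteq> {..<m}. prod_list (map c is) * p is)"
proof -
  let ?L = "{is. length is = n \<and> set is \<subseteq> {..<m}}"
  have *: "(\<Sum>is\<in>?L. prod_list (map c is) * p (map (\<lambda>j. is ! \<sigma> j) [0..<n])) =
      (\<Sum>is\<in>?L. prod_list (map c is) * p is)" if \<sigma>: "\<sigma> permutes {..<n}" for \<sigma>
  proof (rule sum.reindex_bij_witness[of _ "permute_list (inv \<sigma>)" "permute_list \<sigma>"])
    fix w assume "w \<in> ?L"
    hence w: "length w = n" "set w \<subseteq> {..<m}" by auto
    hence \<sigma>w: "\<sigma> permutes {..<length w}" "inv \<sigma> permutes {..<length w}"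
      using \<sigma> permutes_inv by auto
    show "permute_list (inv \<sigma>) (permute_list \<sigma> w) = w" "permute_list \<sigma> (permute_list (inv \<sigma>) w) = w"
      using \<sigma>w by (simp_all add: permute_list_compose[symmetric] permutes_inv_o[OF \<sigma>])
    show "permute_list \<sigma> w \<in> ?L" "permute_list (inv \<sigma>) w \<in> ?L"
      using w \<sigma>w by auto
    have "mset (map c (permute_list \<sigma> w)) = mset (map c w)"
      using \<sigma>w by simp
    hence "prod_list (map c (permute_list \<sigma> w)) = prod_list (map c w)"
      by (metis prod_mset_prod_list)
    thus "prod_list (map c (permute_list \<sigma> w)) * p (permute_list \<sigma> w) =
        prod_list (map c w) * p (map (\<lambda>j. w ! \<sigma> j) [0..<n])"
      using w by (simp add: permute_list_def)
  qed
  have "(\<Sum>is\<in>?L. prod_list (map c is) * (\<Sum>\<sigma> | \<sigma> permutes {..<n}. p (map (\<lambda>j. is ! \<sigma> j) [0..<n]))) =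
      (\<Sum>\<sigma> | \<sigma> permutes {..<n}. \<Sum>is\<in>?L. prod_list (map c is) * p (map (\<lambda>j. is ! \<sigma> j) [0..<n]))"
    by (simp only: sum_distrib_left) (rule sum.swap)
  also have "\<dots> = (\<Sum>\<sigma> | \<sigma> permutes {..<n}. \<Sum>is\<in>?L. prod_list (map c is) * p is)"
    by (rule sum.cong[OF refl]) (rule *, simp)
  also have "\<dots> = fact n * (\<Sum>is\<in>?L. prod_list (map c is) * p is)"
    by (simp add: card_permutations)
  finally show ?thesis .
qed

section \<open>Gradient images and polytopes\<close>

text \<open>The determinant is 1 at \<open>mat 1\<close>. If it were negative at \<open>M\<close>,
  it would vanish at some point of the segment before \<open>M\<close>, where the quadratic form is
  still positive definite.\<close>

lemma det_psd_nonneg: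
  fixes M :: "real^'n^'n"
  assumes "\<And>h. h \<bullet> (M *v h) \<ge> 0"
  shows "det M \<ge> 0"
proof (rule ccontr)
  assume neg: "\<not> det M \<ge> 0"
  let ?f = "\<lambda>s. det ((1 - s) *\<^sub>R mat 1 + s *\<^sub>R M)"
  have cont: "continuous_on {0..1} ?f"
    unfolding det_def by (intro continuous_intros) 
  have "\<exists>s\<ge>0. s \<le> 1 \<and> ?f s = 0"
    using neg by (intro IVT2' cont) auto
  then obtain s where s: "0 \<le> s" "s \<le> 1" "?f s = 0" by blast
  have "s \<noteq> 1" using s neg by auto
  have "\<not> invertible ((1 - s) *\<^sub>R mat 1 + s *\<^sub>R M)"
    using s by (simp add: invertible_det_nz)
  then obtain h where h: "h \<noteq> 0" "((1 - s) *\<^sub>R mat 1 + s *\<^sub>R M) *v h = 0"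
    by (auto simp: invertible_left_inverse matrix_left_invertible_ker)
  have "0 = h \<bullet> (((1 - s) *\<^sub>R mat 1 + s *\<^sub>R M) *v h)" using h by simp
  also have "\<dots> = (1 - s) * (h \<bullet> h) + s * (h \<bullet> (M *v h))"
    by (simp add: matrix_vector_mult_add_rdistrib scaleR_matrix_vector_assoc[symmetric] inner_add_right)
  also have "\<dots> > 0"
    using h(1) s \<open>s \<noteq> 1\<close> assms[of h] by (intro add_pos_nonneg) auto
  finally show False by simp
qed

definition gibbs_weight :: "'a::euclidean_space set \<Rightarrow> 'a \<Rightarrow> 'a \<Rightarrow> real" where
  "gibbs_weight Y x y = exp (x \<bullet> y) / (\<Sum>z\<in>Y. exp (x \<bullet> z))"

text \<open>The gradient of the convex function $x \mapsto \ln \sum_{y \in Y} e^{\langle x, y\rangle}$.\<close>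

definition gibbs_mean :: "'a::euclidean_space set \<Rightarrow> 'a \<Rightarrow> 'a" where
  "gibbs_mean Y x = (\<Sum>y\<in>Y. gibbs_weight Y x y *\<^sub>R y)"

text \<open>The covariance matrix of the distribution with these weights, applied to h. It is the
  Hessian of the log-partition function, hence positive semidefinite.\<close>

definition gibbs_cov :: "'a::euclidean_space set \<Rightarrow> 'a \<Rightarrow> 'a \<Rightarrow> 'a" where
  "gibbs_cov Y x h = (\<Sum>y\<in>Y. (gibbs_weight Y x y * (h \<bullet> (y - gibbs_mean Y x))) *\<^sub>R (y - gibbs_mean Y x))"

context
  fixes Y :: "'a::euclidean_space set"
  assumes fin: "finite Y" and ne: "Y \<noteq> {}"
begin

lemma partition_pos: "(\<Sum>z\<in>Y. exp (x \<bullet> z)) > 0"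
  using fin ne by (intro sum_pos) auto

lemma gibbs_weight_pos: "gibbs_weight Y x y > 0"
  unfolding gibbs_weight_def using partition_pos by (intro divide_pos_pos) auto

lemma sum_gibbs_weight: "(\<Sum>y\<in>Y. gibbs_weight Y x y) = 1"
  unfolding gibbs_weight_def using partition_pos[of x] by (simp add: sum_divide_distrib[symmetric])

lemma gibbs_mean_in_hull: "gibbs_mean Y x \<in> convex hull Y"
  unfolding gibbs_mean_def
  by (rule convex_sum) (use fin sum_gibbs_weight gibbs_weight_pos in \<open>auto simp: less_imp_le hull_inc\<close>)

lemma has_derivative_log_partition:
  "((\<lambda>x. ln (\<Sum>y\<in>Y. exp (x \<bullet> y))) has_derivative (\<lambda>h. h \<bullet> gibbs_mean Y x)) (at x)"
proof -
  have "((\<lambda>x. ln (\<Sum>y\<in>Y. exp (x \<bullet> y))) has_derivative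
      (\<lambda>h. (\<Sum>y\<in>Y. exp (x \<bullet> y) * (h \<bullet> y)) * inverse (\<Sum>y\<in>Y. exp (x \<bullet> y)))) (at x)"
    using partition_pos[of x] by (auto intro!: derivative_eq_intros simp: field_simps)
  moreover have "(\<lambda>h. (\<Sum>y\<in>Y. exp (x \<bullet> y) * (h \<bullet> y)) * inverse (\<Sum>y\<in>Y. exp (x \<bullet> y))) =
      (\<lambda>h. h \<bullet> gibbs_mean Y x)"
    by (auto simp: gibbs_mean_def gibbs_weight_def inner_sum_right sum_distrib_right divide_inverse fun_eq_iff
        intro!: sum.cong)
  ultimately show ?thesis by simp
qed

lemma sum_gibbs_centered: "(\<Sum>y\<in>Y. gibbs_weight Y x y *\<^sub>R (y - gibbs_mean Y x)) = 0"
  by (simp add: scaleR_diff_right sum_subtractf gibbs_mean_def[symmetric] scaleR_sum_left[symmetric]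
      sum_gibbs_weight)

lemma has_derivative_gibbs_weight:
  "((\<lambda>x. gibbs_weight Y x y) has_derivative (\<lambda>h. gibbs_weight Y x y * (h \<bullet> (y - gibbs_mean Y x)))) (at x)"
proof -
  let ?Z = "\<Sum>y\<in>Y. exp (x \<bullet> y)"
  have 1: "((\<lambda>x. gibbs_weight Y x y) has_derivative
     (\<lambda>h. - exp (x \<bullet> y) * (inverse ?Z * (\<Sum>y\<in>Y. exp (x \<bullet> y) * (h \<bullet> y)) * inverse ?Z) + exp (x \<bullet> y) * (h \<bullet> y) / ?Z)) (at x)"
    unfolding gibbs_weight_def divide_inverse using partition_pos[of x]
    by (auto intro!: derivative_eq_intros simp: mult_ac)
  have m: "(\<Sum>y\<in>Y. exp (x \<bullet> y) * (h \<bullet> y)) * inverse ?Z = h \<bullet> gibbs_mean Y x" for h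
    by (auto simp: gibbs_mean_def gibbs_weight_def inner_sum_right sum_distrib_right divide_inverse fun_eq_iff
        intro!: sum.cong)
  have "- exp (x \<bullet> y) * (inverse ?Z * (\<Sum>y\<in>Y. exp (x \<bullet> y) * (h \<bullet> y)) * inverse ?Z) + exp (x \<bullet> y) * (h \<bullet> y) / ?Z
     = gibbs_weight Y x y * (h \<bullet> (y - gibbs_mean Y x))" for h
    by (simp only: mult.assoc m) (simp add: gibbs_weight_def inner_diff_right right_diff_distrib divide_inverse algebra_simps)
  with 1 show ?thesis by simp
qed

lemma has_derivative_gibbs_mean:
  "(gibbs_mean Y has_derivative gibbs_cov Y x) (at x)"
proof -
  have "((\<lambda>x. \<Sum>y\<in>Y. gibbs_weight Y x y *\<^sub>R y) has_derivative
      (\<lambda>h. \<Sum>y\<in>Y. (gibbs_weight Y x y * (h \<bullet> (y - gibbs_mean Y x))) *\<^sub>R y)) (at x)"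
    by (auto intro!: derivative_eq_intros has_derivative_gibbs_weight)
  \<comment> \<open>The derivative of the weights produces the factor y instead of y minus the mean.
    Replacing one by the other changes nothing, because the derivatives of the weights add up to
    0.\<close>
  moreover have "(\<lambda>h. \<Sum>y\<in>Y. (gibbs_weight Y x y * (h \<bullet> (y - gibbs_mean Y x))) *\<^sub>R y) = gibbs_cov Y x"
  proof
    fix h
    have "(\<Sum>y\<in>Y. gibbs_weight Y x y * (h \<bullet> (y - gibbs_mean Y x))) = h \<bullet> (\<Sum>y\<in>Y. gibbs_weight Y x y *\<^sub>R (y - gibbs_mean Y x))"
      by (simp add: inner_sum_right)
    also have "\<dots> = 0" by (simp add: sum_gibbs_centered)
    finally show "(\<Sum>y\<in>Y. (gibbs_weight Y x y * (h \<bullet> (y - gibbs_mean Y x))) *\<^sub>R y) = gibbs_cov Y x h"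
      by (simp add: gibbs_cov_def scaleR_diff_right sum_subtractf scaleR_sum_left[symmetric])
  qed
  ultimately show ?thesis by (simp add: gibbs_mean_def[abs_def])
qed

lemma gibbs_cov_psd: "h \<bullet> gibbs_cov Y x h \<ge> 0"
  unfolding gibbs_cov_def inner_sum_right
  by (intro sum_nonneg) (auto simp: gibbs_weight_pos less_imp_le mult.assoc)

text \<open>Relative to the weights p at x', the weights at x are proportional to p exp(t). The
  claim is then that t and exp(t) are positively correlated under p; this is strict because t is not
  constant on a set whose affine hull is the whole space.\<close>

lemma gibbs_mean_strict_mono:
  assumes "affine hull Y = UNIV" "x \<noteq> x'"
  shows "(gibbs_mean Y x - gibbs_mean Y x') \<bullet> (x - x') > 0"
proof -
  define t where "t y = (x - x') \<bullet> y" for y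
  define p where "p = gibbs_weight Y x'"
  define E where "E = (\<Sum>y\<in>Y. p y * exp (t y))"
  have p: "p y > 0" for y by (simp add: p_def gibbs_weight_pos)
  have sp: "(\<Sum>y\<in>Y. p y) = 1" by (simp add: p_def sum_gibbs_weight)
  have E: "E > 0" unfolding E_def using p fin ne by (intro sum_pos) auto
  have w: "gibbs_weight Y x y = p y * exp (t y) / E" for y
  proof -
    have "p z * exp (t z) = exp (x \<bullet> z) / (\<Sum>z\<in>Y. exp (x' \<bullet> z))" for z
      by (simp add: p_def gibbs_weight_def t_def inner_diff_left exp_diff)
    moreover from this have "E = (\<Sum>z\<in>Y. exp (x \<bullet> z)) / (\<Sum>z\<in>Y. exp (x' \<bullet> z))"
      by (simp add: E_def sum_divide_distrib)
    ultimately show ?thesis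
      using partition_pos[of x'] partition_pos[of x] by (simp add: gibbs_weight_def)
  qed
  have "E * ((gibbs_mean Y x - gibbs_mean Y x') \<bullet> (x - x')) =
     (\<Sum>y\<in>Y. p y * exp (t y) * t y) - E * (\<Sum>y\<in>Y. p y * t y)"
  proof -
    have "gibbs_mean Y x \<bullet> (x - x') = (\<Sum>y\<in>Y. p y * exp (t y) * t y) / E"
      by (simp add: gibbs_mean_def inner_sum_right w sum_divide_distrib t_def inner_commute[of _ "x - x'"])
    moreover have "gibbs_mean Y x' \<bullet> (x - x') = (\<Sum>y\<in>Y. p y * t y)"
      by (simp add: gibbs_mean_def inner_sum_right p_def t_def inner_commute[of _ "x - x'"])
    ultimately show ?thesis
      using E by (simp add: inner_diff_left right_diff_distrib)
  qed
  \<comment> \<open>Chebyshev's identity: twice the covariance of exp(t) and t under p is a double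
    sum over pairs, and its terms are nonnegative since exp is increasing.\<close>
  also have "2 * \<dots> = (\<Sum>y\<in>Y. \<Sum>z\<in>Y. p y * p z * ((exp (t y) - exp (t z)) * (t y - t z)))"
  proof -
    have *: "p y * p z * ((exp (t y) - exp (t z)) * (t y - t z)) =
       p y * exp (t y) * t y * p z - (p y * exp (t y)) * (p z * t z) - (p y * t y) * (p z * exp (t z)) + p y * (p z * exp (t z) * t z)" for y z
      by (simp add: algebra_simps)
    show ?thesis
      unfolding * sum.distrib sum_subtractf sum_product[symmetric] sp E_def by (simp add: algebra_simps)
  qed
  also have "\<dots> > 0"
  proof -
    have nn: "p y * p z * ((exp (t y) - exp (t z)) * (t y - t z)) \<ge> 0" for y z
      using p[of y] p[of z] by (cases "t y \<le> t z") (simp_all add: mult_nonneg_nonneg mult_nonpos_nonpos less_imp_le)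
    have "\<exists>y\<in>Y. \<exists>z\<in>Y. t y \<noteq> t z"
    proof (rule ccontr)
      assume "\<not> ?thesis"
      moreover obtain y0 where "y0 \<in> Y" using ne by auto
      ultimately have "Y \<subseteq> {y. t y = t y0}" by blast
      hence "Y \<subseteq> {y. (x - x') \<bullet> y = t y0}" unfolding t_def .
      hence "affine hull Y \<subseteq> {y. (x - x') \<bullet> y = t y0}"
        by (intro hull_minimal affine_hyperplane)
      hence "(x - x') \<bullet> y = t y0" for y using assms(1) by auto
      from this[of 0] this[of "x - x'"] assms(2) show False by auto
    qed
    then obtain y z where yz: "y \<in> Y" "z \<in> Y" "t y \<noteq> t z" by auto
    have "0 < p y * p z * ((exp (t y) - exp (t z)) * (t y - t z))"
      using p[of y] p[of z] yz(3) by (cases "t y < t z") (simp_all add: mult_pos_pos mult_neg_neg)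
    also have "\<dots> \<le> (\<Sum>z\<in>Y. p y * p z * ((exp (t y) - exp (t z)) * (t y - t z)))"
      using yz fin nn by (intro member_le_sum) auto
    also have "\<dots> \<le> (\<Sum>y\<in>Y. \<Sum>z\<in>Y. p y * p z * ((exp (t y) - exp (t z)) * (t y - t z)))"
      using yz(1) fin nn by (intro member_le_sum[of y Y "\<lambda>y. \<Sum>z\<in>Y. p y * p z * ((exp (t y) - exp (t z)) * (t y - t z))"] sum_nonneg) auto
    finally show ?thesis .
  qed
  finally show ?thesis using E by (simp add: zero_less_mult_iff)
qed

end

section \<open>Minkowski combinations of polytopes as gradient images\<close>

lemma det_zero_matrix: "det (0 :: real^'n^'n) = 0"
  by (rule det_zero_row(1)) (simp add: row_def vec_eq_iff)

lemma sum_singleton_zero: "(\<Sum>i\<in>I. {0}) = {0 :: 'a::comm_monoid_add}"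
  by (induction I rule: infinite_finite_induct) auto

lemma in_minkowski_combination:
  fixes K :: "nat \<Rightarrow> 'a::real_vector set"
  shows "x \<in> (\<Sum>i<m. (\<lambda>x. c i *\<^sub>R x) ` K i) \<longleftrightarrow> (\<exists>k. (\<forall>i<m. k i \<in> K i) \<and> x = (\<Sum>i<m. c i *\<^sub>R k i))"
proof -
  have "x \<in> (\<Sum>i<m. (\<lambda>x. c i *\<^sub>R x) ` K i) \<longleftrightarrow> (\<exists>s. (\<forall>i<m. s i \<in> (\<lambda>x. c i *\<^sub>R x) ` K i) \<and> x = (\<Sum>i<m. s i))"
    by (subst set_sum_alt) auto
  also have "\<dots> \<longleftrightarrow> (\<exists>k. (\<forall>i<m. k i \<in> K i) \<and> x = (\<Sum>i<m. c i *\<^sub>R k i))"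
  proof
    assume "\<exists>s. (\<forall>i<m. s i \<in> (\<lambda>x. c i *\<^sub>R x) ` K i) \<and> x = (\<Sum>i<m. s i)"
    then obtain s where s: "\<forall>i<m. s i \<in> (\<lambda>x. c i *\<^sub>R x) ` K i" "x = (\<Sum>i<m. s i)" by blast
    hence "\<forall>i<m. \<exists>k. k \<in> K i \<and> s i = c i *\<^sub>R k" by blast
    then obtain k where k: "\<forall>i<m. k i \<in> K i \<and> s i = c i *\<^sub>R k i" by metis
    thus "\<exists>k. (\<forall>i<m. k i \<in> K i) \<and> x = (\<Sum>i<m. c i *\<^sub>R k i)"
      using s(2) by (intro exI[of _ k]) auto
  next
    assume "\<exists>k. (\<forall>i<m. k i \<in> K i) \<and> x = (\<Sum>i<m. c i *\<^sub>R k i)"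
    then obtain k where "\<forall>i<m. k i \<in> K i" "x = (\<Sum>i<m. c i *\<^sub>R k i)" by blast
    thus "\<exists>s. (\<forall>i<m. s i \<in> (\<lambda>x. c i *\<^sub>R x) ` K i) \<and> x = (\<Sum>i<m. s i)"
      by (intro exI[of _ "\<lambda>i. c i *\<^sub>R k i"]) auto
  qed
  finally show ?thesis .
qed

lemma compact_minkowski_sum:
  fixes K :: "'i \<Rightarrow> 'a::real_normed_vector set"
  assumes "\<And>i. i \<in> I \<Longrightarrow> compact (K i)"
  shows "compact (\<Sum>i\<in>I. K i)"
  using assms
proof (induction I rule: infinite_finite_induct)
  case (insert i I)
  have "compact {x + y |x y. x \<in> K i \<and> y \<in> (\<Sum>i\<in>I. K i)}"
    using insert by (intro compact_sums) auto
  moreover have "{x + y |x y. x \<in> K i \<and> y \<in> (\<Sum>i\<in>I. K i)} = K i + (\<Sum>i\<in>I. K i)"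
    by (auto simp: set_plus_def)
  ultimately show ?case using insert.hyps by simp
qed (auto simp: set_zero)

lemma minkowski_combination_body:
  fixes K :: "nat \<Rightarrow> 'a::euclidean_space set"
  assumes "\<And>i. i < m \<Longrightarrow> convex_body (K i)"
  shows "convex_body (\<Sum>i<m. (\<lambda>x. c i *\<^sub>R x) ` K i)"
  unfolding convex_body_def
proof (intro conjI)
  have "\<forall>i. \<exists>k. i < m \<longrightarrow> k \<in> K i" using assms by (auto simp: convex_body_def)
  then obtain k where "\<forall>i. i < m \<longrightarrow> k i \<in> K i" by metis
  hence "(\<Sum>i<m. c i *\<^sub>R k i) \<in> (\<Sum>i<m. (\<lambda>x. c i *\<^sub>R x) ` K i)"
    unfolding in_minkowski_combination by blast
  thus "(\<Sum>i<m. (\<lambda>x. c i *\<^sub>R x) ` K i) \<noteq> {}" by blast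
  show "compact (\<Sum>i<m. (\<lambda>x. c i *\<^sub>R x) ` K i)"
    using assms by (intro compact_minkowski_sum compact_scaling) (auto simp: convex_body_def)
  show "convex (\<Sum>i<m. (\<lambda>x. c i *\<^sub>R x) ` K i)"
    using assms by (intro convex_set_sum convex_scaling) (auto simp: convex_body_def)
qed

text \<open>Each gradient is strictly monotone along x - x', and a nonnegative combination with a
  positive coefficient inherits this.\<close>

lemma gibbs_gradient_inj:
  fixes Y :: "nat \<Rightarrow> 'a::euclidean_space set"
  assumes Y: "\<And>i. i < m \<Longrightarrow> finite (Y i) \<and> affine hull (Y i) = UNIV"
    and c: "\<And>i. i < m \<Longrightarrow> c i \<ge> 0" "j < m" "c j > 0"
  shows "inj (\<lambda>x. \<Sum>i<m. c i *\<^sub>R gibbs_mean (Y i) x)"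
proof (rule injI, rule ccontr)
  fix x x' assume eq: "(\<Sum>i<m. c i *\<^sub>R gibbs_mean (Y i) x) = (\<Sum>i<m. c i *\<^sub>R gibbs_mean (Y i) x')"
    and ne: "x \<noteq> x'"
  have ney: "Y i \<noteq> {}" if "i < m" for i using Y[OF that] by auto
  have pos: "(gibbs_mean (Y i) x - gibbs_mean (Y i) x') \<bullet> (x - x') > 0" if "i < m" for i
    using Y[OF that] ney[OF that] ne by (intro gibbs_mean_strict_mono) auto
  have "0 = ((\<Sum>i<m. c i *\<^sub>R gibbs_mean (Y i) x) - (\<Sum>i<m. c i *\<^sub>R gibbs_mean (Y i) x')) \<bullet> (x - x')"
    using eq by simp
  also have "\<dots> = (\<Sum>i<m. c i * ((gibbs_mean (Y i) x - gibbs_mean (Y i) x') \<bullet> (x - x')))"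
    by (simp add: sum_subtractf[symmetric] inner_sum_left scaleR_diff_right[symmetric])
  also have "\<dots> > 0"
    using c pos by (intro sum_pos2[of _ j]) (auto simp: less_imp_le)
  finally show False by simp
qed

text \<open>For the second inclusion let the ball of radius e about y lie in P. Log-partition
  functions dominate support functions, so their weighted sum minus the linear function of y is at
  least e times the norm. It therefore attains its minimum, and there its gradient G - y
  vanishes.\<close>

lemma gibbs_gradient_range:
  fixes Y :: "nat \<Rightarrow> 'a::euclidean_space set"
  assumes Y: "\<And>i. i < m \<Longrightarrow> finite (Y i) \<and> Y i \<noteq> {}"
    and c: "\<And>i. i < m \<Longrightarrow> c i \<ge> 0"
  defines "P \<equiv> (\<Sum>i<m. (\<lambda>x. c i *\<^sub>R x) ` (convex hull Y i))"
    and "G \<equiv> \<lambda>x. \<Sum>i<m. c i *\<^sub>R gibbs_mean (Y i) x"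
  shows "range G \<subseteq> P" "interior P \<subseteq> range G"
proof -
  show "range G \<subseteq> P"
  proof
    fix z assume "z \<in> range G"
    then obtain x where "z = G x" by blast
    thus "z \<in> P"
      unfolding P_def G_def in_minkowski_combination using Y
      by (intro exI[of _ "\<lambda>i. gibbs_mean (Y i) x"]) (auto intro: gibbs_mean_in_hull)
  qed
  show "interior P \<subseteq> range G"
  proof
    fix y assume "y \<in> interior P"
    then obtain e where e: "e > 0" "cball y e \<subseteq> P" by (meson mem_interior_cball)
    define \<Phi> where "\<Phi> x = (\<Sum>i<m. c i * ln (\<Sum>z\<in>Y i. exp (x \<bullet> z))) - x \<bullet> y" for x
    have der: "(\<Phi> has_derivative (\<lambda>h. h \<bullet> (G x - y))) (at x)" for x
    proof -
      have "(\<Phi> has_derivative (\<lambda>h. (\<Sum>i<m. c i * (h \<bullet> gibbs_mean (Y i) x)) - h \<bullet> y)) (at x)"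
        unfolding \<Phi>_def using Y
        by (intro has_derivative_diff has_derivative_sum has_derivative_mult_right
            has_derivative_log_partition has_derivative_inner_left has_derivative_ident) auto
      thus ?thesis by (simp add: G_def inner_diff_right inner_sum_right)
    qed
    have "\<Phi> x \<ge> e * norm x" for x
    proof (cases "x = 0")
      case False
      have "y + (e / norm x) *\<^sub>R x \<in> P" using e False by (auto simp: dist_norm)
      then obtain k where k: "\<forall>i<m. k i \<in> convex hull Y i" "y + (e / norm x) *\<^sub>R x = (\<Sum>i<m. c i *\<^sub>R k i)"
        unfolding P_def in_minkowski_combination by blast
      have ln: "x \<bullet> k i \<le> ln (\<Sum>z\<in>Y i. exp (x \<bullet> z))" if "i < m" for i
      proof -
        have "convex hull Y i \<subseteq> {z. x \<bullet> z \<le> ln (\<Sum>z\<in>Y i. exp (x \<bullet> z))}"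
        proof (intro hull_minimal convex_halfspace_le subsetI CollectI)
          fix z assume "z \<in> Y i"
          hence "exp (x \<bullet> z) \<le> (\<Sum>z\<in>Y i. exp (x \<bullet> z))"
            using Y[OF that] by (intro member_le_sum) auto
          thus "x \<bullet> z \<le> ln (\<Sum>z\<in>Y i. exp (x \<bullet> z))"
            by (metis exp_gt_zero ln_exp ln_mono)
        qed
        thus ?thesis using k that by auto
      qed
      have "x \<bullet> y + e * norm x = x \<bullet> (y + (e / norm x) *\<^sub>R x)"
        using False by (simp add: inner_add_right power2_norm_eq_inner[symmetric] power2_eq_square)
      also have "\<dots> = (\<Sum>i<m. c i * (x \<bullet> k i))"
        by (simp add: k(2) inner_sum_right)
      also have "\<dots> \<le> (\<Sum>i<m. c i * ln (\<Sum>z\<in>Y i. exp (x \<bullet> z)))"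
        using c ln by (intro sum_mono mult_left_mono) auto
      finally show ?thesis by (simp add: \<Phi>_def)
    next
      case True
      have "0 \<le> ln (real (card (Y i)))" if "i < m" for i
        using Y[OF that] by (simp add: Suc_leI card_gt_0_iff)
      thus ?thesis using True c by (auto simp: \<Phi>_def intro!: sum_nonneg mult_nonneg_nonneg)
    qed
    note coercive = this
    \<comment> \<open>Outside the ball of this radius \<open>\<Phi>\<close> exceeds its value at 0,
      so the minimum over the ball is a global one.\<close>
    define R where "R = \<Phi> 0 / e"
    have "R \<ge> 0" using coercive[of 0] e by (simp add: R_def)
    have "continuous_on UNIV \<Phi>"
      using der by (meson has_derivative_continuous continuous_at_imp_continuous_on)
    then obtain x where x: "x \<in> cball 0 R" "\<And>z. z \<in> cball 0 R \<Longrightarrow> \<Phi> x \<le> \<Phi> z"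
      using continuous_attains_inf[of "cball 0 R" \<Phi>] \<open>R \<ge> 0\<close>
      by (metis cball_eq_empty compact_cball continuous_on_subset not_less subset_UNIV)
    have "\<Phi> x \<le> \<Phi> z" for z
    proof (cases "norm z \<le> R")
      case False
      have "\<Phi> x \<le> \<Phi> 0" using x \<open>R \<ge> 0\<close> by auto
      also have "\<dots> = e * R" using e by (simp add: R_def)
      also have "\<dots> \<le> e * norm z" using e False by simp
      also have "\<dots> \<le> \<Phi> z" by (rule coercive)
      finally show ?thesis .
    qed (use x in auto)
    hence "(\<lambda>h. h \<bullet> (G x - y)) = (\<lambda>h. 0)"
      by (intro differential_zero_maxmin[OF UNIV_I open_UNIV der]) auto
    hence "(G x - y) \<bullet> (G x - y) = 0" by metis
    thus "y \<in> range G" by auto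
  qed
qed

text \<open>Gromov: up to a null set, the gradient of a positive combination of log-partition functions maps
  the space bijectively onto the Minkowski combination, and its Jacobian is polynomial in $c$.\<close>

lemma volume_minkowski_gibbs:
  fixes Y :: "nat \<Rightarrow> (real ^ 'n::{finite,wellorder}) set"
  assumes Y: "\<And>i. i < m \<Longrightarrow> finite (Y i) \<and> affine hull (Y i) = UNIV"
    and c: "\<And>i. i < m \<Longrightarrow> c i \<ge> 0"
  defines "P \<equiv> (\<Sum>i<m. (\<lambda>x. c i *\<^sub>R x) ` (convex hull Y i))"
  shows "((\<lambda>x. det (\<Sum>i<m. c i *\<^sub>R matrix (gibbs_cov (Y i) x))) has_integral measure lborel P) UNIV"
proof (cases "\<exists>j<m. c j > 0")
  \<comment> \<open>All coefficients vanish. The gradient map is then constant, so this case cannot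
    go through the change of variables; both sides are 0.\<close>
  case False
  hence c0: "c i = 0" if "i < m" for i using c[OF that] that by force
  have "(\<lambda>x. det (\<Sum>i<m. c i *\<^sub>R matrix (gibbs_cov (Y i) x))) = (\<lambda>x. 0)"
    using c0 by (simp add: det_zero_matrix)
  moreover have "P = {0}"
  proof -
    have "P = (\<Sum>i<m. {0})"
      unfolding P_def using Y c0 by (intro sum.cong) (force simp: image_constant_conv)+
    thus ?thesis by (simp only: sum_singleton_zero)
  qed
  ultimately show ?thesis by simp
next
  case True
  then obtain j where j: "j < m" "c j > 0" by blast
  have ne: "finite (Y i) \<and> Y i \<noteq> {}" if "i < m" for i using Y[OF that] by auto
  define G where "G = (\<lambda>x. \<Sum>i<m. c i *\<^sub>R gibbs_mean (Y i) x)"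
  define G' where "G' = (\<lambda>x h. \<Sum>i<m. c i *\<^sub>R gibbs_cov (Y i) x h)"
  have lin: "linear (gibbs_cov (Y i) x)" if "i < m" for i x
    using has_derivative_gibbs_mean[of "Y i"] ne[OF that] has_derivative_linear by blast
  have der: "(G has_derivative G' x) (at x within UNIV)" for x
    unfolding G_def G'_def using ne
    by (intro has_derivative_sum has_derivative_scaleR_right has_derivative_gibbs_mean) auto
  have mat: "matrix (G' x) = (\<Sum>i<m. c i *\<^sub>R matrix (gibbs_cov (Y i) x))" for x
    by (simp add: matrix_def G'_def vec_eq_iff)
  have detnn: "det (matrix (G' x)) \<ge> 0" for x
  proof (rule det_psd_nonneg)
    fix h :: "real^'n::{finite,wellorder}"
    have "linear (G' x)" using der has_derivative_linear by blast
    hence "matrix (G' x) *v h = G' x h" by (metis matrix_vector_mul)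
    thus "h \<bullet> (matrix (G' x) *v h) \<ge> 0"
      using ne c by (auto simp: G'_def inner_sum_right intro!: sum_nonneg mult_nonneg_nonneg gibbs_cov_psd)
  qed
  have "inj G" unfolding G_def using Y c j by (intro gibbs_gradient_inj[of m Y c j]) auto
  have ran: "range G \<subseteq> P" "interior P \<subseteq> range G"
    unfolding P_def G_def using gibbs_gradient_range[of m Y c] ne c by blast+
  have body: "convex_body P"
    unfolding P_def using ne
    by (intro minkowski_combination_body) (auto simp: convex_body_def finite_imp_compact_convex_hull)
  hence comp: "compact P" and conv: "convex P" by (auto simp: convex_body_def)
  have "negligible (frontier P)" using conv by (rule negligible_convex_frontier)
  moreover have "P - range G \<subseteq> frontier P" "range G - P \<subseteq> frontier P"
    using ran closure_subset[of P] by (auto simp: frontier_def)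
  ultimately have negl: "negligible (P - range G \<union> (range G - P))"
    by (meson Un_least negligible_subset)
  have lmP: "P \<in> lmeasurable" using comp by (rule lmeasurable_compact)
  have "range G \<in> lmeasurable" "measure lebesgue (range G) = measure lebesgue P"
    using lmeasurable_negligible_symdiff[OF lmP negl] measure_negligible_symdiff[OF lmP negl] by auto
  hence "((\<lambda>x. \<bar>det (matrix (G' x))\<bar>) has_integral measure lebesgue P) UNIV"
    using has_measure_differentiable_image[OF _ der \<open>inj G\<close>] by auto
  moreover have "measure lebesgue P = measure lborel P"
    using comp by (simp add: borel_compact)
  ultimately show ?thesis using detnn by (simp add: mat)
qed

text \<open>The change of variables theorem of HOL-Analysis requires a well-ordered index type.\<close>

typedef (overloaded) ('n::finite) ordered_index = "{..<CARD('n)}"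
  by (rule exI[of _ 0]) simp

instantiation ordered_index :: (finite) wellorder
begin

definition "x \<le> y \<longleftrightarrow> Rep_ordered_index x \<le> Rep_ordered_index y"
definition "x < y \<longleftrightarrow> Rep_ordered_index x < Rep_ordered_index y"

instance
proof
  fix x y z :: "'a ordered_index" and P :: "'a ordered_index \<Rightarrow> bool"
  show "x < y \<longleftrightarrow> x \<le> y \<and> \<not> y \<le> x" "x \<le> x" "x \<le> y \<Longrightarrow> y \<le> z \<Longrightarrow> x \<le> z" "x \<le> y \<or> y \<le> x"
    by (auto simp: less_eq_ordered_index_def less_ordered_index_def)
  show "x \<le> y \<Longrightarrow> y \<le> x \<Longrightarrow> x = y"
    by (simp add: less_eq_ordered_index_def Rep_ordered_index_inject[symmetric])
  show "P x" if *: "\<And>x. (\<And>y. y < x \<Longrightarrow> P y) \<Longrightarrow> P x"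
  proof (induction x rule: measure_induct_rule[of Rep_ordered_index])
    case (less x)
    show ?case by (rule *, rule less) (simp add: less_ordered_index_def)
  qed
qed

end

instance ordered_index :: (finite) finite
proof
  have "(UNIV :: 'a ordered_index set) = Abs_ordered_index ` {..<CARD('a)}"
    by (metis type_definition.Abs_image type_definition_ordered_index)
  thus "finite (UNIV :: 'a ordered_index set)"
    by (metis finite_imageI finite_lessThan)
qed

section \<open>Polarization of the determinant\<close>

lemma det_rows_sum:
  fixes a :: "'n::finite \<Rightarrow> 'i \<Rightarrow> 'b::comm_ring_1^'n"
  assumes "finite S"
  shows "det (\<chi> r. \<Sum>i\<in>S. a r i) = (\<Sum>f | \<forall>r. f r \<in> S. det (\<chi> r. a r (f r)))"
proof -
  have "(\<Prod>r\<in>UNIV. (\<Sum>i\<in>S. a r i) $ p r) = (\<Sum>f | \<forall>r. f r \<in> S. \<Prod>r\<in>UNIV. a r (f r) $ p r)" for p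
    using prod_sum_PiE[of "UNIV :: 'n set" "\<lambda>_. S" "\<lambda>r i. a r i $ p r"] assms
    by (simp add: PiE_UNIV_domain sum_component Pi_def)
  thus ?thesis
    unfolding det_def by (simp add: sum_distrib_left sum.swap[of _ "{f. \<forall>r. f r \<in> S}"])
qed

text \<open>Multilinearity in the rows gives one term for each choice of a matrix index per row; an
  enumeration of the rows turns choices into words. The coefficients \<open>p\<close> are fixed
  before m and c, because polarization evaluates the same form at other arguments.\<close>

lemma det_sum_words:
  fixes M :: "nat \<Rightarrow> real^'n^'n"
  shows "\<exists>p. \<forall>m c. det (\<Sum>i<m. c i *\<^sub>R M i) =
    (\<Sum>is | length is = CARD('n) \<and> set is \<subseteq> {..<m}. prod_list (map c is) * p is)"
proof -
  let ?n = "CARD('n)"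
  obtain e where e: "bij_betw e (UNIV::'n set) {..<?n}"
    using ex_bij_betw_finite_nat[of "UNIV::'n set"] by (auto simp: atLeast0LessThan)
  define e' where "e' = inv_into UNIV e"
  have e': "e' (e r) = r" for r using e by (simp add: e'_def bij_betw_def)
  have ee': "e (e' j) = j" if "j < ?n" for j
    using e that by (simp add: e'_def bij_betw_def f_inv_into_f)
  have er: "e r < ?n" for r using e by (auto simp: bij_betw_def)
  define p where "p is = det (\<chi> r. M (is ! e r) $ r)" for "is"
  have "det (\<Sum>i<m. c i *\<^sub>R M i) =
    (\<Sum>is | length is = ?n \<and> set is \<subseteq> {..<m}. prod_list (map c is) * p is)" for m c
  proof -
    have "(\<Sum>i<m. c i *\<^sub>R M i) = (\<chi> r. \<Sum>i<m. c i *s M i $ r)"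
      by (simp add: vec_eq_iff)
    hence "det (\<Sum>i<m. c i *\<^sub>R M i) =
        (\<Sum>f | \<forall>r. f r \<in> {..<m}. det (\<chi> r. c (f r) *s M (f r) $ r))"
      by (simp add: det_rows_sum)
    also have "\<dots> = (\<Sum>f | \<forall>r. f r \<in> {..<m}. (\<Prod>r\<in>UNIV. c (f r)) * det (\<chi> r. M (f r) $ r))"
      by (simp add: det_rows_mul)
    also have "\<dots> = (\<Sum>is | length is = ?n \<and> set is \<subseteq> {..<m}. prod_list (map c is) * p is)"
    proof (rule sum.reindex_bij_witness[of _ "\<lambda>is r. is ! e r" "\<lambda>f. map (\<lambda>j. f (e' j)) [0..<?n]"])
      fix f :: "'n \<Rightarrow> nat" assume "f \<in> {f. \<forall>r. f r \<in> {..<m}}"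
      hence f: "f r < m" for r by auto
      show "(\<lambda>r. map (\<lambda>j. f (e' j)) [0..<?n] ! e r) = f"
        by (simp add: er e')
      show "map (\<lambda>j. f (e' j)) [0..<?n] \<in> {is. length is = ?n \<and> set is \<subseteq> {..<m}}"
        using f by auto
      have "prod_list (map c (map (\<lambda>j. f (e' j)) [0..<?n])) = (\<Prod>j<?n. c (f (e' j)))"
        by (simp add: prod.list_conv_set_nth atLeast0LessThan)
      also have "\<dots> = (\<Prod>r\<in>UNIV. c (f r))"
        by (rule prod.reindex_bij_betw[OF e, of "\<lambda>j. c (f (e' j))", symmetric, simplified e'])
      finally show "prod_list (map c (map (\<lambda>j. f (e' j)) [0..<?n])) * p (map (\<lambda>j. f (e' j)) [0..<?n]) =
          (\<Prod>r\<in>UNIV. c (f r)) * det (\<chi> r. M (f r) $ r)"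
        by (simp add: p_def er e')
    next
      fix w assume "w \<in> {is. length is = ?n \<and> set is \<subseteq> {..<m}}"
      hence w: "length w = ?n" "set w \<subseteq> {..<m}" by auto
      show "map (\<lambda>j. w ! e (e' j)) [0..<?n] = w"
        using w by (intro nth_equalityI) (auto simp: ee')
      have "w ! e r \<in> set w" for r using w er[of r] by (auto intro: nth_mem)
      thus "(\<lambda>r. w ! e r) \<in> {f. \<forall>r. f r \<in> {..<m}}" using w by blast
    qed
    finally show ?thesis .
  qed
  thus ?thesis by blast
qed

text \<open>Symmetrizing the coefficients and rewriting them by polarization removes the unknown
  \<open>p\<close>. Only determinants of nonnegative combinations of the matrices remain, and each
  of these integrates to a volume.\<close>

lemma det_polarization:
  fixes M :: "nat \<Rightarrow> real^'n^'n"
  shows "det (\<Sum>i<m. c i *\<^sub>R M i) =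
    (\<Sum>is | length is = CARD('n) \<and> set is \<subseteq> {..<m}. prod_list (map c is) *
      ((\<Sum>S\<in>Pow {..<CARD('n)}. (-1) ^ (CARD('n) - card S) *
        det (\<Sum>i<m. real (card {j\<in>S. is ! j = i}) *\<^sub>R M i)) / fact CARD('n)))"
proof -
  let ?n = "CARD('n)"
  obtain p where p: "\<And>m c. det (\<Sum>i<m. c i *\<^sub>R M i) =
    (\<Sum>is | length is = CARD('n) \<and> set is \<subseteq> {..<m}. prod_list (map c is) * p is)"
    using det_sum_words[of M] by blast
  have "fact ?n * det (\<Sum>i<m. c i *\<^sub>R M i) =
      (\<Sum>is | length is = ?n \<and> set is \<subseteq> {..<m}. prod_list (map c is) *
        (\<Sum>\<sigma> | \<sigma> permutes {..<?n}. p (map (\<lambda>j. is ! \<sigma> j) [0..<?n])))"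
    unfolding p by (rule symmetrized_words[symmetric])
  also have "\<dots> = (\<Sum>is | length is = ?n \<and> set is \<subseteq> {..<m}. prod_list (map c is) *
      (\<Sum>S\<in>Pow {..<?n}. (-1) ^ (?n - card S) *
        det (\<Sum>i<m. real (card {j\<in>S. is ! j = i}) *\<^sub>R M i)))"
    by (intro sum.cong refl) (simp add: p polarization_words)
  finally show ?thesis
    by (simp add: field_simps sum_divide_distrib[symmetric])
qed

section \<open>Repeated summands and permuted coordinates\<close>

lemma scaleR_add_image:
  fixes K :: "'a::real_vector set"
  assumes "convex K" "a \<ge> 0" "b \<ge> 0"
  shows "(\<lambda>x. (a + b) *\<^sub>R x) ` K = (\<lambda>x. a *\<^sub>R x) ` K + (\<lambda>x. b *\<^sub>R x) ` K"
proof
  show "(\<lambda>x. (a + b) *\<^sub>R x) ` K \<subseteq> (\<lambda>x. a *\<^sub>R x) ` K + (\<lambda>x. b *\<^sub>R x) ` K"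
    by (auto simp: scaleR_add_left)
  show "(\<lambda>x. a *\<^sub>R x) ` K + (\<lambda>x. b *\<^sub>R x) ` K \<subseteq> (\<lambda>x. (a + b) *\<^sub>R x) ` K"
  proof
    fix z assume "z \<in> (\<lambda>x. a *\<^sub>R x) ` K + (\<lambda>x. b *\<^sub>R x) ` K"
    then obtain x y where xy: "x \<in> K" "y \<in> K" "z = a *\<^sub>R x + b *\<^sub>R y"
      by (auto elim!: set_plus_elim)
    show "z \<in> (\<lambda>x. (a + b) *\<^sub>R x) ` K"
    proof (cases "a + b = 0")
      case False
      hence "(a / (a + b)) *\<^sub>R x + (b / (a + b)) *\<^sub>R y \<in> K"
        using assms xy by (intro convexD) (auto simp: add_divide_distrib[symmetric])
      moreover have "z = (a + b) *\<^sub>R ((a / (a + b)) *\<^sub>R x + (b / (a + b)) *\<^sub>R y)"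
        using False by (simp add: xy scaleR_add_right)
      ultimately show ?thesis by blast
    next
      case True
      hence "a = 0" "b = 0" using assms by auto
      thus ?thesis using xy by auto
    qed
  qed
qed

text \<open>For a convex set the sum of k copies is its dilate by k, so equal summands can be
  collected. Thus the counting arguments that occur in polarization stand for Minkowski sums of
  subfamilies.\<close>

lemma sum_count_scaleR:
  fixes K :: "nat \<Rightarrow> 'a::real_vector set"
  assumes "finite S" "\<And>i. i < m \<Longrightarrow> convex (K i) \<and> K i \<noteq> {}" "\<And>j. j \<in> S \<Longrightarrow> f j < m"
  shows "(\<Sum>i<m. (\<lambda>x. real (card {j\<in>S. f j = i}) *\<^sub>R x) ` K i) = (\<Sum>j\<in>S. K (f j))"
  using assms(1,3)
proof induction
  case empty
  have "(\<Sum>i<m. (\<lambda>x. real (card {j\<in>{}. f j = i}) *\<^sub>R x) ` K i) = (\<Sum>i<m. {0})"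
    using assms(2) by (intro sum.cong) (auto simp: image_constant_conv)
  thus ?case by (simp add: sum_singleton_zero)
next
  case (insert a S)
  let ?C = "\<lambda>S i. (\<lambda>x. real (card {j\<in>S. f j = i}) *\<^sub>R x) ` K i"
  have fa: "f a < m" using insert.prems by simp
  have "?C (insert a S) i = (if i = f a then K i else {0}) + ?C S i" if "i < m" for i
  proof (cases "i = f a")
    case True
    have "{j \<in> insert a S. f j = i} = insert a {j \<in> S. f j = i}" using True by auto
    hence c: "card {j \<in> insert a S. f j = i} = Suc (card {j \<in> S. f j = i})"
      using insert.hyps by simp
    have "?C (insert a S) i = (\<lambda>x. 1 *\<^sub>R x) ` K i + ?C S i"
      unfolding c using assms(2)[OF that] by (subst scaleR_add_image[symmetric]) auto
    thus ?thesis using True by simp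
  next
    case False
    hence "{j \<in> insert a S. f j = i} = {j \<in> S. f j = i}" by auto
    thus ?thesis using False by simp
  qed
  hence "(\<Sum>i<m. ?C (insert a S) i) = (\<Sum>i<m. if i = f a then K i else 0) + (\<Sum>i<m. ?C S i)"
    unfolding sum.distrib[symmetric] by (intro sum.cong) auto
  also have "(\<Sum>i<m. if i = f a then K i else 0) = K (f a)" using fa by (subst sum.delta) auto
  also have "(\<Sum>i<m. ?C S i) = (\<Sum>j\<in>S. K (f j))" using insert by simp
  finally show ?case using insert.hyps by simp
qed

text \<open>Relabelling coordinates takes boxes to boxes with the same side lengths, and these
  determine Lebesgue measure. This carries results for well-ordered index types over to all finite
  ones.\<close>

lemma measure_lborel_permute:
  fixes \<pi> :: "'m::finite \<Rightarrow> 'n::finite" and X :: "(real^'n) set"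
  assumes "bij \<pi>" and X: "X \<in> sets borel"
  shows "measure lborel ((\<lambda>x. \<chi> i. x $ \<pi> i) ` X) = measure lborel X"
proof -
  define T :: "real^'n \<Rightarrow> real^'m" where "T x = (\<chi> i. x $ \<pi> i)" for x
  define U :: "real^'m \<Rightarrow> real^'n" where "U y = (\<chi> j. y $ inv \<pi> j)" for y
  have UT: "U (T x) = x" for x using assms by (simp add: U_def T_def vec_eq_iff bij_is_surj surj_f_inv_f)
  have TU: "T (U y) = y" for y using assms by (simp add: U_def T_def vec_eq_iff bij_is_inj)
  have lin: "linear T" "linear U"
    by (auto intro!: linearI simp: T_def U_def vec_eq_iff)
  have meas: "T \<in> borel_measurable borel" "U \<in> borel_measurable borel"
    using lin by (simp_all add: borel_measurable_continuous_onI linear_continuous_on linear_linear)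
  have "lborel = distr lborel borel T"
  proof (rule lborel_eqI)
    fix l u :: "real^'m" assume le: "\<And>b. b \<in> Basis \<Longrightarrow> l \<bullet> b \<le> u \<bullet> b"
    have le': "l $ i \<le> u $ i" for i
      using le[of "axis i 1"] by (auto simp: inner_axis Basis_vec_def)
    have "T -` box l u = box (U l) (U u)"
    proof (intro set_eqI iffI)
      fix x assume "x \<in> T -` box l u"
      hence "l $ i < x $ \<pi> i \<and> x $ \<pi> i < u $ i" for i by (auto simp: T_def mem_box_cart)
      from this[of "inv \<pi> _"] show "x \<in> box (U l) (U u)"
        using assms by (simp add: U_def mem_box_cart bij_is_surj surj_f_inv_f)
    next
      fix x assume "x \<in> box (U l) (U u)"
      hence "l $ inv \<pi> j < x $ j \<and> x $ j < u $ inv \<pi> j" for j by (auto simp: U_def mem_box_cart)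
      from this[of "\<pi> _"] show "x \<in> T -` box l u"
        using assms by (simp add: T_def mem_box_cart bij_is_inj)
    qed
    hence "emeasure (distr lborel borel T) (box l u) = emeasure lborel (box (U l) (U u))"
      using meas by (simp add: emeasure_distr)
    also have "\<dots> = (\<Prod>b\<in>Basis. (U u - U l) \<bullet> b)"
      by (subst emeasure_lborel_box) (auto simp: Basis_vec_def inner_axis U_def le')
    also have "(\<Prod>b\<in>Basis. (U u - U l) \<bullet> b) = (\<Prod>j\<in>UNIV. (u - l) $ inv \<pi> j)"
      by (subst Basis_vec_def) (simp add: UNION_singleton_eq_range prod.reindex inj_on_def axis_eq_axis inner_axis U_def)
    also have "\<dots> = (\<Prod>i\<in>UNIV. (u - l) $ i)"
      using assms by (intro prod.reindex_bij_betw[of "inv \<pi>"]) (simp add: bij_imp_bij_inv)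
    also have "\<dots> = (\<Prod>b\<in>Basis. (u - l) \<bullet> b)"
      by (subst Basis_vec_def) (simp add: UNION_singleton_eq_range prod.reindex inj_on_def axis_eq_axis inner_axis)
    finally show "emeasure (distr lborel borel T) (box l u) = (\<Prod>b\<in>Basis. (u - l) \<bullet> b)" .
  qed simp
  moreover have TX: "T ` X = U -` X" using UT TU by (auto simp: image_iff) (metis TU)
  moreover have "U -` X \<in> sets borel" using measurable_sets[OF meas(2) X] by simp
  ultimately have "measure lborel (T ` X) = measure (distr lborel borel T) (U -` X)" by simp
  also have "\<dots> = measure lborel (T -` (U -` X))"
    using meas \<open>U -` X \<in> sets borel\<close> by (subst measure_distr) auto
  also have "T -` (U -` X) = X" by (auto simp: UT)
  finally show ?thesis by (simp add: T_def[abs_def])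
qed

section \<open>Existence of the mixed volume\<close>

definition polar_volume :: "'a::euclidean_space set list \<Rightarrow> real" where
  "polar_volume Ks = (\<Sum>S\<in>Pow {..<DIM('a)}. (-1) ^ (DIM('a) - card S) *
     measure lborel (\<Sum>j\<in>S. Ks ! j)) / fact DIM('a)"

lemma polar_volume_count:
  fixes K :: "nat \<Rightarrow> 'a::euclidean_space set"
  assumes "\<And>i. i < m \<Longrightarrow> convex_body (K i)" "length is = DIM('a)" "set is \<subseteq> {..<m}"
  shows "polar_volume (map K is) = (\<Sum>S\<in>Pow {..<DIM('a)}. (-1) ^ (DIM('a) - card S) *
    measure lborel (\<Sum>i<m. (\<lambda>x. real (card {j\<in>S. is ! j = i}) *\<^sub>R x) ` K i)) / fact DIM('a)"
proof -
  have "(\<Sum>i<m. (\<lambda>x. real (card {j\<in>S. is ! j = i}) *\<^sub>R x) ` K i) = (\<Sum>j\<in>S. map K is ! j)"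
    if "S \<in> Pow {..<DIM('a)}" for S
  proof -
    have "(\<Sum>i<m. (\<lambda>x. real (card {j\<in>S. is ! j = i}) *\<^sub>R x) ` K i) = (\<Sum>j\<in>S. K (is ! j))"
      using that assms finite_subset[of S "{..<DIM('a)}"]
      by (intro sum_count_scaleR) (auto simp: convex_body_def subset_iff)
    also have "\<dots> = (\<Sum>j\<in>S. map K is ! j)"
      using that assms(2) by (intro sum.cong) auto
    finally show ?thesis .
  qed
  thus ?thesis unfolding polar_volume_def by simp
qed

definition volume_polynomial :: "nat \<Rightarrow> (nat \<Rightarrow> 'a::euclidean_space set) \<Rightarrow> (nat \<Rightarrow> real) \<Rightarrow> bool" where
  "volume_polynomial m K c \<longleftrightarrow> measure lborel (\<Sum>i<m. (\<lambda>x. c i *\<^sub>R x) ` K i) =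
     (\<Sum>is | length is = DIM('a) \<and> set is \<subseteq> {..<m}. prod_list (map c is) * polar_volume (map K is))"

text \<open>The identity \<open>det_polarization\<close> is linear in the determinants on both
  sides, and each of them integrates to the volume of a Minkowski combination of the same polytopes.
  Integrating it termwise is the whole proof.\<close>

lemma volume_polynomial_polytope_wellorder:
  fixes Y :: "nat \<Rightarrow> (real ^ 'n::{finite,wellorder}) set"
  assumes Y: "\<And>i. i < m \<Longrightarrow> finite (Y i) \<and> affine hull (Y i) = UNIV"
    and c: "\<And>i. i < m \<Longrightarrow> c i \<ge> 0"
  shows "volume_polynomial m (\<lambda>i. convex hull (Y i)) c"
proof -
  let ?vol = "\<lambda>c. measure lborel (\<Sum>i<m. (\<lambda>x. c i *\<^sub>R x) ` (convex hull (Y i)))"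
  let ?F = "\<lambda>c x. det (\<Sum>i<m. c i *\<^sub>R matrix (gibbs_cov (Y i) x))"
  let ?L = "{is. length is = CARD('n) \<and> set is \<subseteq> {..<m}}"
  let ?cnt = "\<lambda>S is i. real (card {j\<in>S. is ! j = i})"
  have I: "(?F c has_integral ?vol c) UNIV" if "\<And>i. i < m \<Longrightarrow> c i \<ge> 0" for c
    using volume_minkowski_gibbs[of m Y c] Y that by blast
  have bodies: "convex_body (convex hull (Y i))" if "i < m" for i
    using Y[OF that] by (auto simp: convex_body_def finite_imp_compact_convex_hull)
  have "((\<lambda>x. \<Sum>is\<in>?L. prod_list (map c is) *
      ((\<Sum>S\<in>Pow {..<CARD('n)}. (-1) ^ (CARD('n) - card S) * ?F (?cnt S is) x) / fact CARD('n)))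
    has_integral (\<Sum>is\<in>?L. prod_list (map c is) *
      ((\<Sum>S\<in>Pow {..<CARD('n)}. (-1) ^ (CARD('n) - card S) * ?vol (?cnt S is)) / fact CARD('n)))) UNIV"
    by (intro has_integral_sum has_integral_mult_right has_integral_divide I finite_words) auto
  hence "(?F c has_integral (\<Sum>is\<in>?L. prod_list (map c is) *
      ((\<Sum>S\<in>Pow {..<CARD('n)}. (-1) ^ (CARD('n) - card S) * ?vol (?cnt S is)) / fact CARD('n)))) UNIV"
    unfolding det_polarization[where c = c, symmetric] .
  hence "?vol c = (\<Sum>is\<in>?L. prod_list (map c is) *
      ((\<Sum>S\<in>Pow {..<CARD('n)}. (-1) ^ (CARD('n) - card S) * ?vol (?cnt S is)) / fact CARD('n)))"
    using has_integral_unique[OF I[of c]] c by blast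
  also have "\<dots> = (\<Sum>is\<in>?L. prod_list (map c is) * polar_volume (map (\<lambda>i. convex hull (Y i)) is))"
    using bodies by (intro sum.cong refl) (subst polar_volume_count[of m], auto)
  finally show ?thesis unfolding volume_polynomial_def by simp
qed

lemma linear_image_minkowski_sum:
  assumes "linear f"
  shows "f ` (\<Sum>i\<in>I. K i) = (\<Sum>i\<in>I. f ` K i)"
proof (induction I rule: infinite_finite_induct)
  case (insert i I)
  have "f ` (K i + (\<Sum>i\<in>I. K i)) = f ` K i + f ` (\<Sum>i\<in>I. K i)"
    by (force simp: set_plus_def linear_add[OF assms] image_iff)
  thus ?case using insert by simp
qed (auto simp: linear_0[OF assms])

text \<open>The relabelling of coordinates \<open>T\<close> is linear, surjective and volume
  preserving, so it commutes with hulls and Minkowski combinations and transports both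
  sides.\<close>

lemma volume_polynomial_polytope:
  fixes Y :: "nat \<Rightarrow> (real ^ 'n) set"
  assumes Y: "\<And>i. i < m \<Longrightarrow> finite (Y i) \<and> affine hull (Y i) = UNIV"
    and c: "\<And>i. i < m \<Longrightarrow> c i \<ge> 0"
  shows "volume_polynomial m (\<lambda>i. convex hull (Y i)) c"
proof -
  have card: "CARD('n ordered_index) = CARD('n)"
    using type_definition.card[OF type_definition_ordered_index[where 'n = 'n]] by simp
  obtain \<pi> :: "'n ordered_index \<Rightarrow> 'n" where \<pi>: "bij \<pi>"
    using finite_same_card_bij[OF finite finite card] by blast
  define T :: "real^'n \<Rightarrow> real^('n ordered_index)" where "T x = (\<chi> i. x $ \<pi> i)" for x
  have lin: "linear T" by (auto intro!: linearI simp: T_def vec_eq_iff)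
  have surj: "surj T"
  proof (rule surjI)
    show "T (\<chi> j. y $ inv \<pi> j) = y" for y
      using \<pi> by (simp add: T_def vec_eq_iff bij_is_inj)
  qed
  have meas: "measure lborel (T ` X) = measure lborel X" if "compact X" for X
    unfolding T_def[abs_def] using that by (intro measure_lborel_permute \<pi> borel_compact)
  let ?K = "\<lambda>i. convex hull (Y i)"
  have TK: "T ` ?K i = convex hull (T ` Y i)" for i
    by (rule convex_hull_linear_image[OF lin])
  have comp: "compact (?K i)" if "i < m" for i using Y[OF that] by (simp add: finite_imp_compact_convex_hull)
  have "volume_polynomial m (\<lambda>i. convex hull (T ` Y i)) c"
  proof (rule volume_polynomial_polytope_wellorder)
    fix i assume i: "i < m"
    have "affine hull (T ` Y i) = T ` (affine hull (Y i))"
      using lin by (intro affine_hull_linear_image[symmetric]) (simp add: linear_linear)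
    thus "finite (T ` Y i) \<and> affine hull (T ` Y i) = UNIV" using Y[OF i] surj by simp
  qed (rule c)
  moreover have "measure lborel (\<Sum>i<m. (\<lambda>x. c i *\<^sub>R x) ` (T ` ?K i)) = measure lborel (\<Sum>i<m. (\<lambda>x. c i *\<^sub>R x) ` ?K i)"
  proof -
    have "(\<Sum>i<m. (\<lambda>x. c i *\<^sub>R x) ` (T ` ?K i)) = T ` (\<Sum>i<m. (\<lambda>x. c i *\<^sub>R x) ` ?K i)"
      unfolding linear_image_minkowski_sum[OF lin] by (simp add: image_image linear_scale[OF lin])
    moreover have "compact (\<Sum>i<m. (\<lambda>x. c i *\<^sub>R x) ` ?K i)"
      using comp by (intro compact_minkowski_sum compact_scaling) auto
    ultimately show ?thesis by (simp add: meas)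
  qed
  moreover have "polar_volume (map (\<lambda>i. T ` ?K i) is) = polar_volume (map ?K is)"
    if "length is = CARD('n)" "set is \<subseteq> {..<m}" for "is"
  proof -
    have "measure lborel (\<Sum>j\<in>S. map (\<lambda>i. T ` ?K i) is ! j) = measure lborel (\<Sum>j\<in>S. map ?K is ! j)"
      if S: "S \<in> Pow {..<CARD('n)}" for S
    proof -
      have "(\<Sum>j\<in>S. map (\<lambda>i. T ` ?K i) is ! j) = (\<Sum>j\<in>S. T ` (map ?K is ! j))"
        using S \<open>length is = _\<close> by (intro sum.cong) auto
      also have "\<dots> = T ` (\<Sum>j\<in>S. map ?K is ! j)"
        by (rule linear_image_minkowski_sum[OF lin, symmetric])
      also have "measure lborel \<dots> = measure lborel (\<Sum>j\<in>S. map ?K is ! j)"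
      proof (intro meas compact_minkowski_sum)
        fix j assume "j \<in> S"
        hence "j < length is" using S \<open>length is = _\<close> by auto
        hence "is ! j < m" using nth_mem \<open>set is \<subseteq> _\<close> by blast
        thus "compact (map ?K is ! j)" using comp \<open>j < length is\<close> by simp
      qed
      finally show ?thesis .
    qed
    thus ?thesis by (simp add: polar_volume_def card)
  qed
  ultimately show ?thesis unfolding volume_polynomial_def TK[symmetric] by (simp add: card)
qed

text \<open>The approximating sums contain the limit sum and lie in neighbourhoods of it that shrink
  to it. The limit is compact and convex, so its frontier is negligible and the measure is upper
  semicontinuous at it.\<close>

lemma measure_minkowski_sum_limit:
  fixes K :: "'i \<Rightarrow> 'a::euclidean_space set"
  assumes "finite I" and K: "\<And>i. i \<in> I \<Longrightarrow> convex_body (K i)"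
    and P: "\<And>i k. i \<in> I \<Longrightarrow> compact (P k i) \<and> K i \<subseteq> P k i \<and> P k i \<subseteq> K i + cball 0 (e k)"
    and e: "e \<longlonglongrightarrow> 0" "\<And>k. e k \<ge> 0"
  shows "(\<lambda>k. measure lborel (\<Sum>i\<in>I. P k i)) \<longlonglongrightarrow> measure lborel (\<Sum>i\<in>I. K i)"
proof -
  let ?X = "\<Sum>i\<in>I. K i" and ?P = "\<lambda>k. \<Sum>i\<in>I. P k i"
  have conv: "convex ?X" using K by (intro convex_set_sum) (auto simp: convex_body_def)
  have comp: "compact ?X" using K by (intro compact_minkowski_sum) (auto simp: convex_body_def)
  have compP: "compact (?P k)" for k using P by (intro compact_minkowski_sum) auto
  have sub: "?X \<subseteq> ?P k" for k
    using assms(1) P by (auto simp: set_sum_alt) blast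
  have near: "\<exists>x\<in>?X. dist x y \<le> card I * e k" if y: "y \<in> ?P k" for y k
  proof -
    obtain s where s: "y = sum s I" "\<forall>i\<in>I. s i \<in> P k i" using y assms(1) by (auto simp: set_sum_alt)
    have "\<forall>i\<in>I. \<exists>x. x \<in> K i \<and> dist x (s i) \<le> e k"
    proof
      fix i assume i: "i \<in> I"
      hence "s i \<in> K i + cball 0 (e k)" using s P by blast
      then obtain x v where "x \<in> K i" "norm v \<le> e k" "s i = x + v" by (auto elim!: set_plus_elim)
      thus "\<exists>x. x \<in> K i \<and> dist x (s i) \<le> e k" by (intro exI[of _ x]) (auto simp: dist_norm)
    qed
    then obtain x where x: "\<forall>i\<in>I. x i \<in> K i \<and> dist (x i) (s i) \<le> e k" by metis
    have "dist (sum x I) y \<le> (\<Sum>i\<in>I. e k)"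
      unfolding s dist_norm sum_subtractf[symmetric] using x by (intro sum_norm_le) (auto simp: dist_norm)
    moreover have "sum x I \<in> ?X" using x assms(1) by (auto simp: set_sum_alt)
    ultimately show ?thesis by auto
  qed
  have bor: "measure lebesgue ?X = measure lborel ?X" "measure lebesgue (?P k) = measure lborel (?P k)" for k
    using comp compP by (auto simp: borel_compact)
  show ?thesis
  proof (rule LIMSEQ_I)
    fix r :: real assume "r > 0"
    obtain d where d: "d > 0" "\<And>T. \<lbrakk>T \<in> lmeasurable; \<And>y. y \<in> T \<Longrightarrow> \<exists>x. x \<in> ?X \<and> dist x y < d\<rbrakk>
                        \<Longrightarrow> measure lebesgue T < measure lebesgue ?X + r"
      using measure_semicontinuous_with_hausdist_explicit[OF compact_imp_bounded[OF comp]
        negligible_convex_frontier[OF conv] \<open>r > 0\<close>] by blast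
    have "(\<lambda>k. card I * e k) \<longlonglongrightarrow> 0" using tendsto_mult_right_zero[OF e(1)] .
    hence "\<forall>\<^sub>F k in sequentially. card I * e k < d" using d(1) by (simp add: order_tendsto_iff)
    then obtain N where N: "\<And>k. k \<ge> N \<Longrightarrow> card I * e k < d" by (auto simp: eventually_sequentially)
    show "\<exists>N. \<forall>k\<ge>N. norm (measure lborel (?P k) - measure lborel ?X) < r"
    proof (intro exI allI impI)
      fix k assume "k \<ge> N"
      have "measure lebesgue (?P k) < measure lebesgue ?X + r"
        using near N[OF \<open>k \<ge> N\<close>] by (intro d(2) lmeasurable_compact compP) (meson le_less_trans)
      moreover have "measure lebesgue ?X \<le> measure lebesgue (?P k)"
        using comp compP sub by (intro measure_mono_fmeasurable fmeasurableD lmeasurable_compact) auto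
      ultimately show "norm (measure lborel (?P k) - measure lborel ?X) < r" by (simp add: bor)
    qed
  qed
qed

lemma outer_polytope:
  fixes K :: "'a::euclidean_space set"
  assumes "compact K" "convex K" "K \<noteq> {}" "e > 0"
  obtains Y where "finite Y" "affine hull Y = UNIV" "K \<subseteq> convex hull Y" "convex hull Y \<subseteq> K + cball 0 e"
proof -
  \<comment> \<open>The cube of half-side d contains the ball of radius d, so that adding it to a
    d-net covers K, and it lies in the ball of radius e, because the norm is at most the sum of the
    absolute coordinates. It also makes the polytope full dimensional.\<close>
  define d where "d = e / DIM('a)"
  have d: "d > 0" using assms by (simp add: d_def)
  obtain N where N: "finite N" "N \<subseteq> K" "K \<subseteq> (\<Union>x\<in>N. ball x d)"
    using compactE_image[OF assms(1), of K "\<lambda>x. ball x d"] d by (metis (no_types, lifting) centre_in_ball open_ball UN_I subsetI)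
  let ?o = "\<Sum>i\<in>Basis. d *\<^sub>R i :: 'a"
  obtain V where V: "finite V" "cbox (- ?o) ?o = convex hull V"
    using cube_convex_hull[OF d, of "0::'a"] by auto
  have ball: "ball 0 d \<subseteq> cbox (- ?o) ?o"
  proof
    fix x :: 'a assume "x \<in> ball 0 d"
    hence "\<bar>x \<bullet> i\<bar> \<le> d" if "i \<in> Basis" for i
      using Basis_le_norm[OF that, of x] by (simp add: dist_norm)
    thus "x \<in> cbox (- ?o) ?o" by (force simp: mem_box inner_sum_left_Basis abs_le_iff)
  qed
  have cb: "cbox (- ?o) ?o \<subseteq> cball 0 e"
  proof
    fix x :: 'a assume "x \<in> cbox (- ?o) ?o"
    hence "\<bar>x \<bullet> i\<bar> \<le> d" if "i \<in> Basis" for i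
      using that by (force simp: mem_box inner_sum_left_Basis abs_le_iff)
    hence "norm x \<le> (\<Sum>i\<in>(Basis::'a set). d)"
      by (intro order_trans[OF norm_le_l1 sum_mono]) auto
    thus "x \<in> cball 0 e" by (simp add: d_def dist_norm)
  qed
  have hull: "convex hull (N + V) = convex hull N + cbox (- ?o) ?o"
    by (simp add: convex_hull_set_plus V(2))
  obtain x where x: "x \<in> N" using N(3) assms(3) by blast
  show thesis
  proof (rule that)
    show "finite (N + V)" using N V by (simp add: finite_set_plus)
    show "convex hull (N + V) \<subseteq> K + cball 0 e"
      unfolding hull using cb N(2) assms(2) by (intro set_plus_mono2 hull_minimal)
    show "K \<subseteq> convex hull (N + V)"
    proof
      fix y assume "y \<in> K"
      then obtain x where "x \<in> N" "dist x y < d" using N(3) by auto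
      hence "y - x \<in> cbox (- ?o) ?o" using ball by (auto simp: dist_norm norm_minus_commute)
      hence "x + (y - x) \<in> convex hull (N + V)" unfolding hull using \<open>x \<in> N\<close> hull_inc by (intro set_plus_intro) 
      thus "y \<in> convex hull (N + V)" by simp
    qed
    have "ball x d \<subseteq> convex hull (N + V)"
    proof
      fix y assume "y \<in> ball x d"
      hence "y - x \<in> cbox (- ?o) ?o" using ball by (auto simp: dist_norm norm_minus_commute)
      hence "x + (y - x) \<in> convex hull (N + V)" unfolding hull using x hull_inc by (intro set_plus_intro)
      thus "y \<in> convex hull (N + V)" by simp
    qed
    hence "interior (convex hull (N + V)) \<noteq> {}" using d by (metis centre_in_ball empty_iff interior_maximal open_ball subsetD)
    thus "affine hull (N + V) = UNIV"
      by (metis affine_hull_convex_hull affine_hull_nonempty_interior)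
  qed
qed

lemma volume_polynomial_body:
  fixes K :: "nat \<Rightarrow> (real ^ 'n) set"
  assumes K: "\<And>i. i < m \<Longrightarrow> convex_body (K i)"
    and c: "\<And>i. i < m \<Longrightarrow> c i \<ge> 0"
  shows "volume_polynomial m K c"
proof -
  define e where "e k = inverse (real (Suc k))" for k
  have e: "e k > 0" "e \<longlonglongrightarrow> 0" for k
    using LIMSEQ_inverse_real_of_nat by (auto simp: e_def[abs_def])
  have "\<forall>k i. \<exists>Y. i < m \<longrightarrow> finite Y \<and> affine hull Y = UNIV \<and> K i \<subseteq> convex hull Y \<and> convex hull Y \<subseteq> K i + cball 0 (e k)"
    using outer_polytope[OF _ _ _ e(1)] K unfolding convex_body_def by metis
  then obtain Y where Y: "\<And>k i. i < m \<Longrightarrow> finite (Y k i) \<and> affine hull (Y k i) = UNIV \<and>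
      K i \<subseteq> convex hull (Y k i) \<and> convex hull (Y k i) \<subseteq> K i + cball 0 (e k)" by metis
  let ?P = "\<lambda>k i. convex hull (Y k i)"
  let ?L = "{is. length is = CARD('n) \<and> set is \<subseteq> {..<m}}"
  have comp: "compact (?P k i)" if "i < m" for k i using Y[OF that] by (simp add: finite_imp_compact_convex_hull)
  \<comment> \<open>A common bound for the coefficients, since
    \<open>measure_minkowski_sum_limit\<close> takes one error for all summands.\<close>
  define C where "C = (\<Sum>i<m. c i)"
  have C: "c i \<le> C" if "i < m" for i
    unfolding C_def using c that by (intro member_le_sum) auto
  have C0: "C \<ge> 0" using c by (auto simp: C_def intro!: sum_nonneg)
  have "(\<lambda>k. measure lborel (\<Sum>i<m. (\<lambda>x. c i *\<^sub>R x) ` ?P k i)) \<longlonglongrightarrow>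
      measure lborel (\<Sum>i<m. (\<lambda>x. c i *\<^sub>R x) ` K i)"
  proof (rule measure_minkowski_sum_limit)
    show "(\<lambda>k. C * e k) \<longlonglongrightarrow> 0" using tendsto_mult_right_zero[OF e(2)] .
    show "C * e k \<ge> 0" for k using C0 e(1)[of k] by simp
    fix i k assume i: "i \<in> {..<m}"
    show "convex_body ((\<lambda>x. c i *\<^sub>R x) ` K i)"
      using K i by (auto simp: convex_body_def compact_scaling convex_scaling)
    have "(\<lambda>x. c i *\<^sub>R x) ` ?P k i \<subseteq> (\<lambda>x. c i *\<^sub>R x) ` K i + cball 0 (C * e k)"
    proof safe
      fix y assume "y \<in> ?P k i"
      hence "y \<in> K i + cball 0 (e k)" using Y i by blast
      then obtain x v where xv: "x \<in> K i" "norm v \<le> e k" "y = x + v" by (auto elim!: set_plus_elim)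
      have "norm (c i *\<^sub>R v) \<le> C * e k"
        using xv c[of i] C[of i] C0 i by (auto intro!: mult_mono)
      thus "c i *\<^sub>R y \<in> (\<lambda>x. c i *\<^sub>R x) ` K i + cball 0 (C * e k)"
        unfolding xv(3) scaleR_add_right using xv by (intro set_plus_intro) auto
    qed
    thus "compact ((\<lambda>x. c i *\<^sub>R x) ` ?P k i) \<and> (\<lambda>x. c i *\<^sub>R x) ` K i \<subseteq> (\<lambda>x. c i *\<^sub>R x) ` ?P k i \<and>
        (\<lambda>x. c i *\<^sub>R x) ` ?P k i \<subseteq> (\<lambda>x. c i *\<^sub>R x) ` K i + cball 0 (C * e k)"
      using Y[of i k] i comp by (auto simp: compact_scaling)
  qed simp
  moreover have "measure lborel (\<Sum>i<m. (\<lambda>x. c i *\<^sub>R x) ` ?P k i) =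
      (\<Sum>is\<in>?L. prod_list (map c is) * polar_volume (map (?P k) is))" for k
    using volume_polynomial_polytope[of m "Y k" c] Y c by (simp add: volume_polynomial_def)
  moreover have "(\<lambda>k. \<Sum>is\<in>?L. prod_list (map c is) * polar_volume (map (?P k) is)) \<longlonglongrightarrow>
      (\<Sum>is\<in>?L. prod_list (map c is) * polar_volume (map K is))"
  proof (intro tendsto_sum tendsto_mult_left)
    fix w assume w: "w \<in> ?L"
    have "(\<lambda>k. measure lborel (\<Sum>j\<in>S. map (?P k) w ! j)) \<longlonglongrightarrow> measure lborel (\<Sum>j\<in>S. map K w ! j)"
      if "S \<in> Pow {..<CARD('n)}" for S
    proof (rule measure_minkowski_sum_limit[OF _ _ _ e(2)])
      show "finite S" using that finite_subset[of S "{..<CARD('n)}"] by simp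
      fix j k assume "j \<in> S"
      hence j: "j < length w" "w ! j < m" using that w by (auto simp: subset_iff)
      show "convex_body (map K w ! j)" using j K by simp
      show "compact (map (?P k) w ! j) \<and> map K w ! j \<subseteq> map (?P k) w ! j \<and>
          map (?P k) w ! j \<subseteq> map K w ! j + cball 0 (e k)"
        using j Y comp by simp
    qed (use e(1) less_imp_le in blast)
    thus "(\<lambda>k. polar_volume (map (?P k) w)) \<longlonglongrightarrow> polar_volume (map K w)"
      unfolding polar_volume_def by (intro tendsto_intros) auto
  qed
  ultimately show ?thesis
    unfolding volume_polynomial_def by (simp add: LIMSEQ_unique)
qed

section \<open>Symmetry and uniqueness\<close>

lemma polar_volume_mset:
  fixes Ks Ls :: "'a::euclidean_space set list"
  assumes "length Ks = DIM('a)" "mset Ls = mset Ks"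
  shows "polar_volume Ls = polar_volume Ks"
proof -
  let ?n = "DIM('a)"
  obtain \<sigma> where \<sigma>: "\<sigma> permutes {..<?n}" "permute_list \<sigma> Ks = Ls"
    using mset_eq_permutation[OF assms(2)] assms(1) by metis
  have nth: "Ls ! j = Ks ! \<sigma> j" if "j < ?n" for j
    using permute_list_nth[of \<sigma> Ks j] \<sigma> that assms(1) by simp
  have inj: "inj_on \<sigma> S" for S using permutes_inj[OF \<sigma>(1)] inj_on_subset by blast
  have "(\<Sum>S\<in>Pow {..<?n}. (-1) ^ (?n - card S) * measure lborel (\<Sum>j\<in>S. Ls ! j)) =
      (\<Sum>S\<in>Pow {..<?n}. (-1) ^ (?n - card S) * measure lborel (\<Sum>j\<in>S. Ks ! j))"
  proof (rule sum.reindex_bij_betw[of "\<lambda>S. \<sigma> ` S", THEN trans[rotated]])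
    show "bij_betw (\<lambda>S. \<sigma> ` S) (Pow {..<?n}) (Pow {..<?n})"
      using permutes_imp_bij[OF \<sigma>(1)] by (rule bij_betw_Pow)
    show "(\<Sum>S\<in>Pow {..<?n}. (-1) ^ (?n - card S) * measure lborel (\<Sum>j\<in>S. Ls ! j)) =
      (\<Sum>S\<in>Pow {..<?n}. (-1) ^ (?n - card (\<sigma> ` S)) * measure lborel (\<Sum>j\<in>\<sigma> ` S. Ks ! j))"
    proof (rule sum.cong[OF refl])
      fix S assume "S \<in> Pow {..<?n}"
      hence "(\<Sum>j\<in>\<sigma> ` S. Ks ! j) = (\<Sum>j\<in>S. Ls ! j)"
        unfolding sum.reindex[OF inj] by (intro sum.cong) (auto simp: nth)
      thus "(-1) ^ (?n - card S) * measure lborel (\<Sum>j\<in>S. Ls ! j) =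
         (-1) ^ (?n - card (\<sigma> ` S)) * measure lborel (\<Sum>j\<in>\<sigma> ` S. Ks ! j)"
        by (simp add: card_image[OF inj])
    qed
  qed
  thus ?thesis by (simp add: polar_volume_def)
qed

text \<open>Polarizing the expansion at the word 0, ..., n-1 recovers the sum of V over all
  rearrangements of \<open>Ks\<close>, and symmetry makes these n! values equal.\<close>

lemma is_mixed_volume_eq_polar_volume:
  fixes V :: "'a::euclidean_space set list \<Rightarrow> real"
  assumes "is_mixed_volume V" "body_tuple Ks"
  shows "V Ks = polar_volume Ks"
proof -
  let ?n = "DIM('a)"
  let ?K = "\<lambda>i. Ks ! i"
  have len: "length Ks = ?n" and bodies: "\<And>i. i < ?n \<Longrightarrow> convex_body (?K i)"
    using assms(2) by (auto simp: body_tuple_def)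
  have poly: "measure lborel (\<Sum>i<?n. (\<lambda>x. c i *\<^sub>R x) ` ?K i) =
      (\<Sum>is | length is = ?n \<and> set is \<subseteq> {..<?n}. prod_list (map c is) * V (map ?K is))"
    if "\<And>i. c i \<ge> 0" for c
    using assms(1) bodies that unfolding is_mixed_volume_def by blast
  have sym: "V (map ?K (map (\<lambda>j. [0..<?n] ! \<sigma> j) [0..<?n])) = V Ks" if "\<sigma> permutes {..<?n}" for \<sigma>
  proof -
    have "map ?K (map (\<lambda>j. [0..<?n] ! \<sigma> j) [0..<?n]) = permute_list \<sigma> Ks"
      using len permutes_in_image[OF that] by (auto simp: permute_list_def)
    hence "mset (map ?K (map (\<lambda>j. [0..<?n] ! \<sigma> j) [0..<?n])) = mset Ks"
      using that len by simp
    thus ?thesis using assms unfolding is_mixed_volume_def by blast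
  qed
  have "map ?K [0..<?n] = Ks" using len by (metis map_nth)
  hence "polar_volume Ks = (\<Sum>S\<in>Pow {..<?n}. (-1) ^ (?n - card S) *
      measure lborel (\<Sum>i<?n. (\<lambda>x. real (card {j\<in>S. [0..<?n] ! j = i}) *\<^sub>R x) ` ?K i)) / fact ?n"
    using polar_volume_count[of ?n ?K "[0..<?n]"] bodies by (auto simp: atLeast0LessThan)
  also have "\<dots> = (\<Sum>\<sigma> | \<sigma> permutes {..<?n}. V (map ?K (map (\<lambda>j. [0..<?n] ! \<sigma> j) [0..<?n]))) / fact ?n"
    using polarization_words[of "[0..<?n]" ?n ?n "\<lambda>is. V (map ?K is)"] by (simp add: poly atLeast0LessThan)
  also have "\<dots> = (\<Sum>\<sigma> | \<sigma> permutes {..<?n}. V Ks) / fact ?n"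
    by (intro arg_cong2[of _ _ _ _ "(/)"] sum.cong refl sym) auto
  also have "\<dots> = V Ks" by (simp add: card_permutations)
  finally show ?thesis by simp
qed

text \<open>All later facts about \<open>mixed_volume\<close> are derived from this one.\<close>

lemma is_mixed_volume_mixed_volume:
  "is_mixed_volume (mixed_volume :: (real ^ 'n) set list \<Rightarrow> real)"
proof -
  let ?V = "\<lambda>Ks :: (real^'n) set list. if body_tuple Ks then polar_volume Ks else 0"
  have "is_mixed_volume ?V"
    unfolding is_mixed_volume_def
  proof (intro conjI allI impI)
    fix Ks Ls :: "(real^'n) set list" assume a: "body_tuple Ks \<and> mset Ls = mset Ks"
    hence "body_tuple Ls" unfolding body_tuple_def by (metis mset_eq_length set_mset_mset)
    thus "?V Ls = ?V Ks" using a polar_volume_mset[of Ks Ls] by (auto simp: body_tuple_def)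
  next
    fix m K and c :: "nat \<Rightarrow> real"
    assume a: "\<forall>i<m. convex_body (K i :: (real^'n) set) \<and> 0 \<le> c i"
    have "(\<Sum>is | length is = CARD('n) \<and> set is \<subseteq> {..<m}. prod_list (map c is) * polar_volume (map K is)) =
        (\<Sum>is | length is = CARD('n) \<and> set is \<subseteq> {..<m}. prod_list (map c is) * ?V (map K is))"
      using a by (intro sum.cong) (auto simp: body_tuple_def subset_iff)
    thus "measure lborel (\<Sum>i<m. (\<lambda>x. c i *\<^sub>R x) ` K i) =
      (\<Sum>is | length is = DIM(real^'n) \<and> set is \<subseteq> {..<m}. prod_list (map c is) * ?V (map K is))"
      using volume_polynomial_body[of m K c] a unfolding volume_polynomial_def by simp
  qed
  moreover have "U = ?V" if "is_mixed_volume U \<and> (\<forall>Ks. \<not> body_tuple Ks \<longrightarrow> U Ks = 0)" for U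
    using that is_mixed_volume_eq_polar_volume[of U] by (intro ext) auto
  ultimately have "mixed_volume = ?V"
    unfolding mixed_volume_def by (intro the_equality) auto
  thus ?thesis using \<open>is_mixed_volume ?V\<close> by simp
qed

section \<open>The Brunn-Minkowski inequality\<close>

text \<open>Nonempty families of nondegenerate boxes that overlap only in boundaries: their unions
  have positive volume, which can be divided in a prescribed ratio.\<close>

definition box_family :: "'a::euclidean_space set set \<Rightarrow> bool" where
  "box_family F \<longleftrightarrow> finite F \<and> F \<noteq> {} \<and> (\<forall>l\<in>F. interior l \<noteq> {} \<and> (\<exists>a b. l = cbox a b)) \<and>
     pairwise (\<lambda>A B. interior A \<inter> interior B = {}) F"

text \<open>A box whose interior misses the open half-space is dropped. It would leave a degenerate
  slice, and dropping it is what lowers the number of boxes.\<close>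

definition cut_below :: "'a::euclidean_space set set \<Rightarrow> 'a \<Rightarrow> real \<Rightarrow> 'a set set" where
  "cut_below F k t = (\<lambda>l. l \<inter> {x. x \<bullet> k \<le> t}) ` {l\<in>F. interior l \<inter> {x. x \<bullet> k < t} \<noteq> {}}"

definition cut_above :: "'a::euclidean_space set set \<Rightarrow> 'a \<Rightarrow> real \<Rightarrow> 'a set set" where
  "cut_above F k t = (\<lambda>l. l \<inter> {x. x \<bullet> k \<ge> t}) ` {l\<in>F. interior l \<inter> {x. x \<bullet> k > t} \<noteq> {}}"

lemma interior_halfspaces_component:
  fixes k :: "'a::euclidean_space"
  assumes "k \<in> Basis"
  shows "interior {x. x \<bullet> k \<le> t} = {x. x \<bullet> k < t}" "interior {x. x \<bullet> k \<ge> t} = {x. x \<bullet> k > t}"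
  using interior_halfspace_le[of k t] interior_halfspace_ge[of k t] nonzero_Basis[OF assms]
  by (simp_all add: inner_commute)

lemma negligible_level: "k \<in> Basis \<Longrightarrow> negligible {x :: 'a::euclidean_space. x \<bullet> k = t}"
  using negligible_hyperplane[of k t] by (auto simp: inner_commute)

lemma box_family_compact: "box_family F \<Longrightarrow> compact (\<Union>F)"
  unfolding box_family_def by (intro compact_Union) (auto intro: compact_cbox)

lemma box_family_cut:
  assumes F: "box_family F" and k: "k \<in> Basis"
  shows "cut_below F k t \<noteq> {} \<Longrightarrow> box_family (cut_below F k t)"
    and "cut_above F k t \<noteq> {} \<Longrightarrow> box_family (cut_above F k t)"
proof -
  have disj: "interior A \<inter> interior B = {}" if "A \<in> F" "B \<in> F" "A \<noteq> B" for A B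
    using F that by (auto simp: box_family_def pairwise_def)
  show "box_family (cut_below F k t)" if "cut_below F k t \<noteq> {}"
    unfolding box_family_def
  proof (intro conjI ballI that)
    show "finite (cut_below F k t)" using F by (auto simp: cut_below_def box_family_def)
    fix l assume "l \<in> cut_below F k t"
    then obtain l' where l': "l' \<in> F" "interior l' \<inter> {x. x \<bullet> k < t} \<noteq> {}" "l = l' \<inter> {x. x \<bullet> k \<le> t}"
      by (auto simp: cut_below_def)
    show "interior l \<noteq> {}" using l' k by (simp add: interior_halfspaces_component)
    obtain a b where "l' = cbox a b" using l'(1) F unfolding box_family_def by blast
    thus "\<exists>a b. l = cbox a b" unfolding l'(3) using interval_split(1)[OF k, of a b t] by auto
  next
    show "pairwise (\<lambda>A B. interior A \<inter> interior B = {}) (cut_below F k t)"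
    proof (rule pairwiseI)
      fix A B assume AB: "A \<in> cut_below F k t" "B \<in> cut_below F k t" "A \<noteq> B"
      obtain l where l: "l \<in> F" "A = l \<inter> {x. x \<bullet> k \<le> t}" using AB(1) by (auto simp: cut_below_def)
      obtain l' where l': "l' \<in> F" "B = l' \<inter> {x. x \<bullet> k \<le> t}" using AB(2) by (auto simp: cut_below_def)
      have "l \<noteq> l'" "A \<subseteq> l" "B \<subseteq> l'" using l l' AB(3) by auto
      with l(1) l'(1) show "interior A \<inter> interior B = {}" using disj[of l l'] interior_mono[of A l] interior_mono[of B l'] by blast
    qed
  qed
  show "box_family (cut_above F k t)" if "cut_above F k t \<noteq> {}"
    unfolding box_family_def
  proof (intro conjI ballI that)
    show "finite (cut_above F k t)" using F by (auto simp: cut_above_def box_family_def)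
    fix l assume "l \<in> cut_above F k t"
    then obtain l' where l': "l' \<in> F" "interior l' \<inter> {x. x \<bullet> k > t} \<noteq> {}" "l = l' \<inter> {x. x \<bullet> k \<ge> t}"
      by (auto simp: cut_above_def)
    show "interior l \<noteq> {}" using l' k by (simp add: interior_halfspaces_component)
    obtain a b where "l' = cbox a b" using l'(1) F unfolding box_family_def by blast
    thus "\<exists>a b. l = cbox a b" unfolding l'(3) using interval_split(2)[OF k, of a b t] by auto
  next
    show "pairwise (\<lambda>A B. interior A \<inter> interior B = {}) (cut_above F k t)"
    proof (rule pairwiseI)
      fix A B assume AB: "A \<in> cut_above F k t" "B \<in> cut_above F k t" "A \<noteq> B"
      obtain l where l: "l \<in> F" "A = l \<inter> {x. x \<bullet> k \<ge> t}" using AB(1) by (auto simp: cut_above_def)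
      obtain l' where l': "l' \<in> F" "B = l' \<inter> {x. x \<bullet> k \<ge> t}" using AB(2) by (auto simp: cut_above_def)
      have "l \<noteq> l'" "A \<subseteq> l" "B \<subseteq> l'" using l l' AB(3) by auto
      with l(1) l'(1) show "interior A \<inter> interior B = {}" using disj[of l l'] interior_mono[of A l] interior_mono[of B l'] by blast
    qed
  qed
qed

text \<open>A dropped box is the closure of its interior and hence lies in the opposite closed
  half-space, so only a subset of the cutting hyperplane gets lost.\<close>

lemma measure_cut:
  assumes F: "box_family F" and k: "k \<in> Basis"
  shows "measure lebesgue (\<Union>(cut_below F k t)) = measure lebesgue (\<Union>F \<inter> {x. x \<bullet> k \<le> t})"
    and "measure lebesgue (\<Union>(cut_above F k t)) = measure lebesgue (\<Union>F \<inter> {x. x \<bullet> k \<ge> t})"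
    and "measure lebesgue (\<Union>F) = measure lebesgue (\<Union>(cut_below F k t)) + measure lebesgue (\<Union>(cut_above F k t))"
proof -
  have lm: "\<Union>F \<in> lmeasurable" using box_family_compact[OF F] by (rule lmeasurable_compact)
  have meas: "{x. x \<bullet> k \<le> t} \<in> sets lebesgue" "{x. x \<bullet> k \<ge> t} \<in> sets lebesgue" by auto
  have lm': "\<Union>F \<inter> {x. x \<bullet> k \<le> t} \<in> lmeasurable" "\<Union>F \<inter> {x. x \<bullet> k \<ge> t} \<in> lmeasurable"
    using lm meas by (auto intro: fmeasurable_Int_fmeasurable)
  have cl: "l = closure (interior l)" if "l \<in> F" for l
    using F that unfolding box_family_def
    by (metis closed_cbox convex_box(1) convex_closure_interior closure_closed)
  have 1: "\<Union>F \<inter> {x. x \<bullet> k \<le> t} - \<Union>(cut_below F k t) \<subseteq> {x. x \<bullet> k = t}"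
  proof
    fix x assume x: "x \<in> \<Union>F \<inter> {x. x \<bullet> k \<le> t} - \<Union>(cut_below F k t)"
    then obtain l where l: "l \<in> F" "x \<in> l" "x \<bullet> k \<le> t" by auto
    hence "interior l \<inter> {x. x \<bullet> k < t} = {}" using x by (auto simp: cut_below_def)
    hence "interior l \<subseteq> {x. x \<bullet> k \<ge> t}" by force
    hence "closure (interior l) \<subseteq> {x. x \<bullet> k \<ge> t}"
      by (intro closure_minimal closed_halfspace_component_ge)
    hence "x \<bullet> k \<ge> t" using l cl by blast
    thus "x \<in> {x. x \<bullet> k = t}" using l by simp
  qed
  have 2: "\<Union>F \<inter> {x. x \<bullet> k \<ge> t} - \<Union>(cut_above F k t) \<subseteq> {x. x \<bullet> k = t}"
  proof
    fix x assume x: "x \<in> \<Union>F \<inter> {x. x \<bullet> k \<ge> t} - \<Union>(cut_above F k t)"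
    then obtain l where l: "l \<in> F" "x \<in> l" "x \<bullet> k \<ge> t" by auto
    hence "interior l \<inter> {x. x \<bullet> k > t} = {}" using x by (auto simp: cut_above_def)
    hence "interior l \<subseteq> {x. x \<bullet> k \<le> t}" by force
    hence "closure (interior l) \<subseteq> {x. x \<bullet> k \<le> t}"
      by (intro closure_minimal closed_halfspace_component_le)
    hence "x \<bullet> k \<le> t" using l cl by blast
    thus "x \<in> {x. x \<bullet> k = t}" using l by simp
  qed
  have sub: "\<Union>(cut_below F k t) \<subseteq> \<Union>F \<inter> {x. x \<bullet> k \<le> t}" "\<Union>(cut_above F k t) \<subseteq> \<Union>F \<inter> {x. x \<bullet> k \<ge> t}"
    by (auto simp: cut_below_def cut_above_def)
  note neg = negligible_level[OF k, of t]
  show b: "measure lebesgue (\<Union>(cut_below F k t)) = measure lebesgue (\<Union>F \<inter> {x. x \<bullet> k \<le> t})"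
    using 1 sub by (intro measure_negligible_symdiff[OF lm'(1)] negligible_subset[OF neg]) auto
  show a: "measure lebesgue (\<Union>(cut_above F k t)) = measure lebesgue (\<Union>F \<inter> {x. x \<bullet> k \<ge> t})"
    using 2 sub by (intro measure_negligible_symdiff[OF lm'(2)] negligible_subset[OF neg]) auto
  have "measure lebesgue (\<Union>F) = measure lebesgue ((\<Union>F \<inter> {x. x \<bullet> k \<le> t}) \<union> (\<Union>F \<inter> {x. x \<bullet> k \<ge> t}))"
    by (rule arg_cong[of _ _ "measure lebesgue"]) auto
  also have "\<dots> = measure lebesgue (\<Union>F \<inter> {x. x \<bullet> k \<le> t}) + measure lebesgue (\<Union>F \<inter> {x. x \<bullet> k \<ge> t})"
    using measure_Un3_negligible[OF lm', of "{}"] by (force intro: negligible_subset[OF neg])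
  finally show "measure lebesgue (\<Union>F) = measure lebesgue (\<Union>(cut_below F k t)) + measure lebesgue (\<Union>(cut_above F k t))"
    by (simp add: a b)
qed

text \<open>The increments are nonnegative and bounded by those of a box around X, for which the
  volume below the level t is the explicit continuous function \<open>\<psi>\<close>.\<close>

lemma continuous_measure_halfspace:
  fixes X :: "'a::euclidean_space set"
  assumes "compact X" and k: "k \<in> Basis"
  shows "continuous_on UNIV (\<lambda>t. measure lebesgue (X \<inter> {x. x \<bullet> k \<le> t}))"
proof -
  obtain a b where ab: "X \<subseteq> cbox a b" using bounded_subset_cbox_symmetric compact_imp_bounded assms(1) by metis
  define \<psi> where "\<psi> t = (\<Prod>i\<in>Basis-{k}. max 0 (b \<bullet> i - a \<bullet> i)) * max 0 (min (b \<bullet> k) t - a \<bullet> k)" for t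
  have \<psi>: "measure lebesgue (cbox a b \<inter> {x. x \<bullet> k \<le> t}) = \<psi> t" for t
  proof -
    let ?b = "\<Sum>i\<in>Basis. (if i = k then min (b\<bullet>k) t else b\<bullet>i) *\<^sub>R i"
    have "measure lebesgue (cbox a b \<inter> {x. x \<bullet> k \<le> t}) = measure lborel (cbox a ?b)"
      by (simp add: interval_split[OF k])
    also have "\<dots> = (\<Prod>i\<in>Basis. max 0 (?b \<bullet> i - a \<bullet> i))"
    proof (cases "\<forall>i\<in>Basis. a \<bullet> i \<le> ?b \<bullet> i")
      case True
      thus ?thesis by (auto simp: measure_lborel_cbox_eq inner_diff_left intro!: prod.cong)
    next
      case False
      then obtain i where i: "i \<in> Basis" "\<not> a \<bullet> i \<le> ?b \<bullet> i" by blast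
      hence "(\<Prod>i\<in>Basis. max 0 (?b \<bullet> i - a \<bullet> i)) = 0"
        by (intro prod_zero bexI[of _ i]) (auto simp: max_def)
      moreover have "measure lborel (cbox a ?b) = 0"
        by (subst measure_lborel_cbox_eq, subst if_not_P[OF False]) simp
      ultimately show ?thesis by simp
    qed
    also have "\<dots> = \<psi> t"
      unfolding prod.remove[OF finite_Basis k] \<psi>_def using k
      by (auto simp: inner_sum_left_Basis mult.commute intro!: prod.cong)
    finally show ?thesis .
  qed
  have c\<psi>: "continuous_on UNIV \<psi>" unfolding \<psi>_def by (intro continuous_intros)
  let ?\<phi> = "\<lambda>t. measure lebesgue (X \<inter> {x. x \<bullet> k \<le> t})"
  have lmX: "X \<inter> {x. x \<bullet> k \<le> t} \<in> lmeasurable" for t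
    using assms(1) by (intro lmeasurable_compact compact_Int_closed closed_halfspace_component_le)
  have lmB: "cbox a b \<inter> {x. x \<bullet> k \<le> t} \<in> lmeasurable" for t
    by (intro lmeasurable_compact compact_Int_closed closed_halfspace_component_le compact_cbox)
  have inc: "0 \<le> ?\<phi> t - ?\<phi> s \<and> ?\<phi> t - ?\<phi> s \<le> \<psi> t - \<psi> s" if "s \<le> t" for s t
  proof -
    have sub: "X \<inter> {x. x \<bullet> k \<le> s} \<subseteq> X \<inter> {x. x \<bullet> k \<le> t}"
       "cbox a b \<inter> {x. x \<bullet> k \<le> s} \<subseteq> cbox a b \<inter> {x. x \<bullet> k \<le> t}" using that by auto
    have "?\<phi> t - ?\<phi> s = measure lebesgue ((X \<inter> {x. x \<bullet> k \<le> t}) - (X \<inter> {x. x \<bullet> k \<le> s}))"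
      using sub by (intro measurable_measure_Diff[symmetric] lmX fmeasurableD)
    also have "\<dots> \<le> measure lebesgue ((cbox a b \<inter> {x. x \<bullet> k \<le> t}) - (cbox a b \<inter> {x. x \<bullet> k \<le> s}))"
      using ab lmX lmB by (intro measure_mono_fmeasurable sets.Diff fmeasurable_Diff fmeasurableD) auto
    also have "\<dots> = \<psi> t - \<psi> s"
      using sub by (subst measurable_measure_Diff) (auto simp: \<psi> lmB fmeasurableD)
    finally show ?thesis using sub lmX by (auto intro!: measure_mono_fmeasurable fmeasurableD)
  qed
  show ?thesis
    unfolding continuous_on_iff
  proof (intro ballI allI impI)
    fix t e :: real assume "e > 0"
    then obtain d where d: "d > 0" "\<And>s. dist s t < d \<Longrightarrow> dist (\<psi> s) (\<psi> t) < e"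
      using c\<psi> unfolding continuous_on_iff by blast
    have "dist (?\<phi> s) (?\<phi> t) < e" if "dist s t < d" for s
      using inc[of s t] inc[of t s] d(2)[OF that] by (cases "s \<le> t") (auto simp: dist_real_def)
    thus "\<exists>d>0. \<forall>s\<in>UNIV. dist s t < d \<longrightarrow> dist (?\<phi> s) (?\<phi> t) < e" using d(1) by blast
  qed
qed

text \<open>The Brunn-Minkowski inequality for two boxes with side lengths p and q: apply the
  inequality of arithmetic and geometric means to the ratios p/(p+q) and to the ratios q/(p+q), and
  add.\<close>

lemma root_prod_add_le:
  fixes p q :: "'i \<Rightarrow> real"
  assumes "finite I" "I \<noteq> {}" "\<And>i. i \<in> I \<Longrightarrow> p i > 0" "\<And>i. i \<in> I \<Longrightarrow> q i > 0"
  shows "(\<Prod>i\<in>I. p i) powr (1 / card I) + (\<Prod>i\<in>I. q i) powr (1 / card I) \<le> (\<Prod>i\<in>I. p i + q i) powr (1 / card I)"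
proof -
  let ?n = "card I"
  have n: "?n > 0" using assms by (simp add: card_gt_0_iff)
  have pos: "(\<Prod>i\<in>I. p i + q i) > 0" using assms by (intro prod_pos) (auto intro: add_pos_pos)
  have amgm: "(\<Prod>i\<in>I. r i / (p i + q i)) powr (1 / ?n) \<le> (\<Sum>i\<in>I. r i / (p i + q i)) / ?n"
    if "\<And>i. i \<in> I \<Longrightarrow> r i > 0" for r
    using arith_geom_mean[of I "\<lambda>i. r i / (p i + q i)"] assms that
    by (simp add: sum_divide_distrib less_imp_le add_pos_pos)
  have split: "(\<Prod>i\<in>I. r i / (p i + q i)) powr (1 / ?n) = (\<Prod>i\<in>I. r i) powr (1 / ?n) / (\<Prod>i\<in>I. p i + q i) powr (1 / ?n)"
    if "\<And>i. i \<in> I \<Longrightarrow> r i > 0" for r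
    using that assms by (simp add: prod_dividef powr_divide prod_nonneg less_imp_le add_pos_pos)
  have "((\<Prod>i\<in>I. p i) powr (1 / ?n) + (\<Prod>i\<in>I. q i) powr (1 / ?n)) / (\<Prod>i\<in>I. p i + q i) powr (1 / ?n) \<le>
      (\<Sum>i\<in>I. p i / (p i + q i)) / ?n + (\<Sum>i\<in>I. q i / (p i + q i)) / ?n"
    using amgm[of p] amgm[of q] split[of p] split[of q] assms by (simp add: add_divide_distrib)
  also have "\<dots> = (\<Sum>i\<in>I. 1) / ?n"
  proof -
    have "p i / (p i + q i) + q i / (p i + q i) = 1" if "i \<in> I" for i
      using assms(3,4)[OF that] by (simp add: add_divide_distrib[symmetric])
    thus ?thesis by (simp add: add_divide_distrib[symmetric] sum.distrib[symmetric])
  qed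
  also have "\<dots> = 1" using n by simp
  finally show ?thesis using pos by (simp add: divide_le_eq)
qed

lemma cbox_add_subset:
  fixes a b c d :: "'a::euclidean_space"
  assumes "\<And>i. i \<in> Basis \<Longrightarrow> a \<bullet> i \<le> b \<bullet> i" "\<And>i. i \<in> Basis \<Longrightarrow> c \<bullet> i \<le> d \<bullet> i"
  shows "cbox (a + c) (b + d) \<subseteq> cbox a b + cbox c d"
proof
  fix x assume x: "x \<in> cbox (a + c) (b + d)"
  \<comment> \<open>Each coordinate is the least admissible one that leaves a remainder of at most d
    for the second summand.\<close>
  define y where "y = (\<Sum>i\<in>Basis. max (a \<bullet> i) (x \<bullet> i - d \<bullet> i) *\<^sub>R i)"
  have y: "y \<bullet> i = max (a \<bullet> i) (x \<bullet> i - d \<bullet> i)" if "i \<in> Basis" for i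
    using that by (simp add: y_def)
  have "y \<in> cbox a b" "x - y \<in> cbox c d"
    using x assms by (auto simp: mem_box y inner_diff_left inner_add_left max_def)
  hence "y + (x - y) \<in> cbox a b + cbox c d" by (rule set_plus_intro)
  thus "x \<in> cbox a b + cbox c d" by simp
qed

lemma box_family_measure_pos:
  assumes "box_family F"
  shows "measure lebesgue (\<Union>F) > 0"
proof -
  obtain l where l: "l \<in> F" "interior l \<noteq> {}" using assms unfolding box_family_def by blast
  have "\<not> negligible (\<Union>F)"
    using l open_not_negligible[of "interior l"] negligible_subset[of "\<Union>F" "interior l"] interior_subset[of l] by blast
  moreover have "\<Union>F \<in> lmeasurable" using box_family_compact[OF assms] by (rule lmeasurable_compact)
  ultimately have "measure lebesgue (\<Union>F) \<noteq> 0" by (auto simp: negligible_iff_measure)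
  thus ?thesis using measure_nonneg[of lebesgue "\<Union>F"] by linarith
qed

lemma compact_set_plus:
  fixes A B :: "'a::real_normed_vector set"
  assumes "compact A" "compact B"
  shows "compact (A + B)"
proof -
  have "A + B = {x + y |x y. x \<in> A \<and> y \<in> B}" by (auto simp: set_plus_def)
  thus ?thesis using compact_sums[OF assms] by simp
qed

lemma card_cut:
  assumes "finite F"
  shows "card (cut_below F k t) \<le> card F" "card (cut_above F k t) \<le> card F"
    and "l \<in> F \<Longrightarrow> interior l \<inter> {x. x \<bullet> k < t} = {} \<Longrightarrow> card (cut_below F k t) < card F"
    and "l \<in> F \<Longrightarrow> interior l \<inter> {x. x \<bullet> k > t} = {} \<Longrightarrow> card (cut_above F k t) < card F"
proof -
  show "card (cut_below F k t) \<le> card F" "card (cut_above F k t) \<le> card F"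
    unfolding cut_below_def cut_above_def using assms
    by (intro order_trans[OF card_image_le card_mono]; simp)+
  show "card (cut_below F k t) < card F" if "l \<in> F" "interior l \<inter> {x. x \<bullet> k < t} = {}"
    unfolding cut_below_def using assms that
    by (intro le_less_trans[OF card_image_le] psubset_card_mono) auto
  show "card (cut_above F k t) < card F" if "l \<in> F" "interior l \<inter> {x. x \<bullet> k > t} = {}"
    unfolding cut_above_def using assms that
    by (intro le_less_trans[OF card_image_le] psubset_card_mono) auto
qed

text \<open>Two boxes with disjoint interiors are separated in some coordinate direction. Cutting
  along a facet of one of them removes one box of the pair from each side and keeps the other
  there.\<close>

lemma separating_cut:
  assumes F: "box_family F" and "card F \<noteq> 1"
  obtains k t where "k \<in> Basis" "card (cut_below F k t) < card F" "card (cut_above F k t) < card F"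
    "cut_below F k t \<noteq> {}" "cut_above F k t \<noteq> {}"
proof -
  note obtained = that
  have fin: "finite F" "F \<noteq> {}" using F by (auto simp: box_family_def)
  then obtain l m where lm: "l \<in> F" "m \<in> F" "l \<noteq> m"
    using assms(2) by (metis card_1_singleton_iff is_singletonI' is_singleton_altdef)
  have disj: "interior l \<inter> interior m = {}" using F lm by (auto simp: box_family_def pairwise_def)
  obtain a b where l: "l = cbox a b" "interior l \<noteq> {}" using F lm(1) unfolding box_family_def by blast
  obtain c d where m: "m = cbox c d" "interior m \<noteq> {}" using F lm(2) unfolding box_family_def by blast
  have ne: "box a b \<noteq> {}" "box c d \<noteq> {}" using l m by auto
  then obtain k where k: "k \<in> Basis" "b \<bullet> k \<le> c \<bullet> k \<or> d \<bullet> k \<le> a \<bullet> k"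
    using disj unfolding l(1) m(1) interior_cbox disjoint_interval(4) box_ne_empty(2) by (metis not_le)
  have main: thesis if "l' \<in> F" "m' \<in> F" "interior l' \<noteq> {}" "interior m' \<noteq> {}"
    "interior l' \<subseteq> {x. x \<bullet> k < t}" "interior m' \<subseteq> {x. x \<bullet> k > t}" for l' m' t
  proof (rule obtained[OF k(1)])
    show "cut_below F k t \<noteq> {}" "cut_above F k t \<noteq> {}"
      using that(1-6) unfolding cut_below_def cut_above_def by blast+
    show "card (cut_below F k t) < card F" using that(2,6) by (intro card_cut(3)[OF fin(1)]) force+
    show "card (cut_above F k t) < card F" using that(1,5) by (intro card_cut(4)[OF fin(1)]) force+
  qed
  have sub: "interior l \<subseteq> {x. x \<bullet> k < b \<bullet> k}" "interior l \<subseteq> {x. x \<bullet> k > a \<bullet> k}"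
    "interior m \<subseteq> {x. x \<bullet> k < d \<bullet> k}" "interior m \<subseteq> {x. x \<bullet> k > c \<bullet> k}"
    unfolding l(1) m(1) interior_cbox using k(1) by (simp_all add: subset_iff mem_box)
  show thesis
    using k(2)
  proof
    assume "b \<bullet> k \<le> c \<bullet> k"
    hence "interior m \<subseteq> {x. x \<bullet> k > b \<bullet> k}" using sub(4) by auto
    thus thesis by (rule main[OF lm(1,2) l(2) m(2) sub(1)])
  next
    assume "d \<bullet> k \<le> a \<bullet> k"
    hence "interior l \<subseteq> {x. x \<bullet> k > d \<bullet> k}" using sub(2) by auto
    thus thesis by (rule main[OF lm(2,1) m(2) l(2) sub(3)])
  qed
qed

text \<open>The induction of Hadwiger and Ohmann: a hyperplane separating two boxes of one family and
  a parallel hyperplane splitting the other family in the same volume ratio reduce the number of boxes.\<close>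

lemma brunn_minkowski_boxes:
  fixes F G :: "'a::euclidean_space set set"
  assumes "box_family F" "box_family G"
  shows "measure lebesgue (\<Union>F) powr (1 / DIM('a)) + measure lebesgue (\<Union>G) powr (1 / DIM('a))
    \<le> measure lebesgue (\<Union>F + \<Union>G) powr (1 / DIM('a))"
  using assms
proof (induction "card F + card G" arbitrary: F G rule: less_induct)
  case less
  let ?n = "DIM('a)" and ?\<mu> = "measure lebesgue :: 'a set \<Rightarrow> real"
  \<comment> \<open>Formulated for a free pair, because the roles are exchanged when only the second
    family has more than one box.\<close>
  have step: "?\<mu> (\<Union>F) powr (1 / ?n) + ?\<mu> (\<Union>G) powr (1 / ?n) \<le> ?\<mu> (\<Union>F + \<Union>G) powr (1 / ?n)"
    if F: "box_family F" and G: "box_family G" and "card F \<noteq> 1"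
      and IH: "\<And>F' G'. card F' + card G' < card F + card G \<Longrightarrow> box_family F' \<Longrightarrow> box_family G' \<Longrightarrow>
        ?\<mu> (\<Union>F') powr (1 / ?n) + ?\<mu> (\<Union>G') powr (1 / ?n) \<le> ?\<mu> (\<Union>F' + \<Union>G') powr (1 / ?n)"
    for F G :: "'a set set"
  proof -
    obtain k t where k: "k \<in> Basis" "card (cut_below F k t) < card F" "card (cut_above F k t) < card F"
      "cut_below F k t \<noteq> {}" "cut_above F k t \<noteq> {}"
      using separating_cut[OF F \<open>card F \<noteq> 1\<close>] by blast
    have finG: "finite G" using G by (simp add: box_family_def)
    define A1 A2 where "A1 = cut_below F k t" and "A2 = cut_above F k t"
    have A: "box_family A1" "box_family A2" using box_family_cut[OF F k(1)] k by (auto simp: A1_def A2_def)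
    define a b where "a = ?\<mu> (\<Union>F)" and "b = ?\<mu> (\<Union>G)"
    have ab: "a > 0" "b > 0" using box_family_measure_pos F G by (auto simp: a_def b_def)
    have a12: "a = ?\<mu> (\<Union>A1) + ?\<mu> (\<Union>A2)" "?\<mu> (\<Union>A1) > 0" "?\<mu> (\<Union>A2) > 0"
      unfolding a_def A1_def A2_def using measure_cut(3)[OF F k(1)] box_family_measure_pos A
      by (auto simp: A1_def A2_def)
    define r where "r = ?\<mu> (\<Union>A1) / a"
    have r: "r > 0" "r < 1" using a12 ab by (auto simp: r_def divide_less_eq)
    let ?\<phi> = "\<lambda>t. ?\<mu> (\<Union>G \<inter> {x. x \<bullet> k \<le> t})"
    have cG: "compact (\<Union>G)" by (rule box_family_compact[OF G])
    have cont: "continuous_on UNIV ?\<phi>" by (rule continuous_measure_halfspace[OF cG k(1)])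
    obtain R where R: "R > 0" "\<And>x. x \<in> \<Union>G \<Longrightarrow> norm x < R"
      using compact_imp_bounded[OF cG] by (metis bounded_pos_less)
    have comp: "\<bar>x \<bullet> k\<bar> < R" if "x \<in> \<Union>G" for x
      using R(2)[OF that] Basis_le_norm[OF k(1), of x] by simp
    have "\<Union>G \<inter> {x. x \<bullet> k \<le> - R} = {}" "\<Union>G \<inter> {x. x \<bullet> k \<le> R} = \<Union>G"
      using comp by (force simp: abs_less_iff)+
    hence "?\<phi> (- R) = 0" "?\<phi> R = b" by (simp_all add: b_def)
    then obtain s where s: "?\<phi> s = r * b"
      using IVT'[of ?\<phi> "- R" "r * b" R] R(1) r ab continuous_on_subset[OF cont] by auto
    define B1 B2 where "B1 = cut_below G k s" and "B2 = cut_above G k s"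
    have B1: "?\<mu> (\<Union>B1) = r * b" using measure_cut(1)[OF G k(1)] s by (simp add: B1_def)
    have B2: "?\<mu> (\<Union>B2) = (1 - r) * b"
      using measure_cut(3)[OF G k(1), of s] B1 by (simp add: B1_def B2_def b_def algebra_simps)
    have "B1 \<noteq> {}" "B2 \<noteq> {}" using B1 B2 r ab by auto
    hence B: "box_family B1" "box_family B2" using box_family_cut[OF G k(1)] by (auto simp: B1_def B2_def)
    have A1: "?\<mu> (\<Union>A1) = r * a" using ab by (simp add: r_def)
    have A2: "?\<mu> (\<Union>A2) = (1 - r) * a" using a12(1) A1 by (simp add: algebra_simps)
    have card: "card A1 + card B1 < card F + card G" "card A2 + card B2 < card F + card G"
      using k card_cut(1,2)[OF finG, of k s] by (auto simp: A1_def A2_def B1_def B2_def intro: add_less_le_mono)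
    \<comment> \<open>The lower bound to be shown for the volume of the sum. It is homogeneous of
      degree 1 in (a, b), so the two parts, with volumes in the ratio r to 1 - r for both families,
      contribute r M and (1 - r) M.\<close>
    define M where "M = (a powr (1 / ?n) + b powr (1 / ?n)) powr ?n"
    have scaled: "q * M \<le> ?\<mu> (\<Union>A' + \<Union>B')"
      if "q > 0" "?\<mu> (\<Union>A') = q * a" "?\<mu> (\<Union>B') = q * b"
        "?\<mu> (\<Union>A') powr (1 / ?n) + ?\<mu> (\<Union>B') powr (1 / ?n) \<le> ?\<mu> (\<Union>A' + \<Union>B') powr (1 / ?n)" for q A' B'
    proof -
      have "q powr (1 / ?n) * (a powr (1 / ?n) + b powr (1 / ?n)) \<le> ?\<mu> (\<Union>A' + \<Union>B') powr (1 / ?n)"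
        using that ab by (simp add: powr_mult algebra_simps)
      hence "(q powr (1 / ?n) * (a powr (1 / ?n) + b powr (1 / ?n))) powr ?n \<le> (?\<mu> (\<Union>A' + \<Union>B') powr (1 / ?n)) powr ?n"
        using that ab by (intro powr_mono2) auto
      thus ?thesis using that ab by (simp add: powr_mult powr_powr M_def)
    qed
    have IH1: "r * M \<le> ?\<mu> (\<Union>A1 + \<Union>B1)"
      by (rule scaled[OF r(1) A1 B1 IH[OF card(1) A(1) B(1)]])
    have IH2: "(1 - r) * M \<le> ?\<mu> (\<Union>A2 + \<Union>B2)"
      using r(2) by (intro scaled A2 B2 IH card A B) simp
    have c: "compact (\<Union>A1 + \<Union>B1)" "compact (\<Union>A2 + \<Union>B2)" "compact (\<Union>F + \<Union>G)"
      using A B F G by (auto intro!: compact_set_plus box_family_compact)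
    have sub: "\<Union>A1 \<subseteq> \<Union>F" "\<Union>A2 \<subseteq> \<Union>F" "\<Union>B1 \<subseteq> \<Union>G" "\<Union>B2 \<subseteq> \<Union>G"
      by (auto simp: A1_def A2_def B1_def B2_def cut_below_def cut_above_def)
    have half: "\<Union>A1 \<subseteq> {x. x \<bullet> k \<le> t}" "\<Union>A2 \<subseteq> {x. x \<bullet> k \<ge> t}" "\<Union>B1 \<subseteq> {x. x \<bullet> k \<le> s}" "\<Union>B2 \<subseteq> {x. x \<bullet> k \<ge> s}"
      by (auto simp: A1_def A2_def B1_def B2_def cut_below_def cut_above_def)
    \<comment> \<open>The partial sums lie on opposite sides of the level t + s, so their volumes
      add up.\<close>
    have "(\<Union>A1 + \<Union>B1) \<inter> (\<Union>A2 + \<Union>B2) \<subseteq> {x. x \<bullet> k = t + s}"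
    proof
      fix x assume x: "x \<in> (\<Union>A1 + \<Union>B1) \<inter> (\<Union>A2 + \<Union>B2)"
      then obtain p q where "p \<in> \<Union>A1" "q \<in> \<Union>B1" "x = p + q" by (blast elim: set_plus_elim)
      hence "x \<bullet> k \<le> t + s" using half(1,3) by (fastforce simp: inner_add_left)
      moreover obtain p' q' where "p' \<in> \<Union>A2" "q' \<in> \<Union>B2" "x = p' + q'" using x by (blast elim: set_plus_elim)
      hence "x \<bullet> k \<ge> t + s" using half(2,4) by (fastforce simp: inner_add_left)
      ultimately show "x \<in> {x. x \<bullet> k = t + s}" by simp
    qed
    hence "negligible ((\<Union>A1 + \<Union>B1) \<inter> (\<Union>A2 + \<Union>B2))" by (rule negligible_subset[OF negligible_level[OF k(1)]])
    hence "?\<mu> ((\<Union>A1 + \<Union>B1) \<union> (\<Union>A2 + \<Union>B2)) = ?\<mu> (\<Union>A1 + \<Union>B1) + ?\<mu> (\<Union>A2 + \<Union>B2)"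
      using measure_Un3_negligible[OF lmeasurable_compact[OF c(1)] lmeasurable_compact[OF c(2)], of "{}"] by simp
    moreover have "?\<mu> ((\<Union>A1 + \<Union>B1) \<union> (\<Union>A2 + \<Union>B2)) \<le> ?\<mu> (\<Union>F + \<Union>G)"
      using c sub by (intro measure_mono_fmeasurable fmeasurableD lmeasurable_compact compact_Un Un_least set_plus_mono2)
    ultimately have M: "M \<le> ?\<mu> (\<Union>F + \<Union>G)" using IH1 IH2 by (simp add: algebra_simps)
    have "a powr (1 / ?n) + b powr (1 / ?n) = M powr (1 / ?n)" by (simp add: M_def powr_powr)
    also have "\<dots> \<le> ?\<mu> (\<Union>F + \<Union>G) powr (1 / ?n)" using M by (intro powr_mono2) (auto simp: M_def)
    finally show ?thesis by (simp add: a_def b_def)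
  qed
  consider "card F \<noteq> 1" | "card G \<noteq> 1" | "card F = 1" "card G = 1" by blast
  thus ?case
  proof cases
    case 1
    show ?thesis by (rule step[OF less.prems 1 less.hyps])
  next
    case 2
    have "?\<mu> (\<Union>G) powr (1 / ?n) + ?\<mu> (\<Union>F) powr (1 / ?n) \<le> ?\<mu> (\<Union>G + \<Union>F) powr (1 / ?n)"
      by (rule step[OF less.prems(2,1) 2 less.hyps]) simp_all
    thus ?thesis by (simp add: add.commute)
  next
    case 3
    then obtain l m where lm: "F = {l}" "G = {m}" by (metis card_1_singletonE)
    obtain a b where l: "l = cbox a b" "box a b \<noteq> {}" using less.prems(1) lm unfolding box_family_def by (metis insertI1 interior_cbox)
    obtain c d where m: "m = cbox c d" "box c d \<noteq> {}" using less.prems(2) lm unfolding box_family_def by (metis insertI1 interior_cbox)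
    have ab: "a \<bullet> i < b \<bullet> i" "c \<bullet> i < d \<bullet> i" if "i \<in> Basis" for i
      using l(2) m(2) that by (auto simp: box_ne_empty)
    have "measure lborel (cbox a b) powr (1 / ?n) + measure lborel (cbox c d) powr (1 / ?n)
        = (\<Prod>i\<in>Basis. (b - a) \<bullet> i) powr (1 / ?n) + (\<Prod>i\<in>Basis. (d - c) \<bullet> i) powr (1 / ?n)"
      using ab by (simp add: measure_lborel_cbox_eq less_imp_le)
    also have "\<dots> \<le> (\<Prod>i\<in>Basis. (b - a) \<bullet> i + (d - c) \<bullet> i) powr (1 / ?n)"
      using ab by (intro root_prod_add_le) (auto simp: inner_diff_left)
    also have "\<dots> = measure lborel (cbox (a + c) (b + d)) powr (1 / ?n)"
      using ab by (simp add: measure_lborel_cbox_eq less_imp_le inner_add_left inner_diff_left add_mono algebra_simps)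
    also have "\<dots> = ?\<mu> (cbox (a + c) (b + d)) powr (1 / ?n)" by simp
    also have "\<dots> \<le> ?\<mu> (cbox a b + cbox c d) powr (1 / ?n)"
      using cbox_add_subset[of a b c d] ab
      by (intro powr_mono2 measure_mono_fmeasurable fmeasurableD lmeasurable_compact compact_set_plus compact_cbox)
        (auto simp: less_imp_le)
    finally show ?thesis by (simp add: lm l m)
  qed
qed

lemma inner_box_family:
  fixes K :: "'a::euclidean_space set"
  assumes "bounded K" "interior K \<noteq> {}" "e > 0"
  obtains F where "box_family F" "\<Union>F \<subseteq> K" "measure lebesgue (interior K) - e < measure lebesgue (\<Union>F)"
proof -
  let ?S = "interior K"
  have bS: "bounded ?S" using assms(1) interior_subset bounded_subset by blast
  obtain a where a: "?S \<subseteq> cbox (- a) a" using bS bounded_subset_cbox_symmetric by metis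
  have "?S \<subseteq> box (- a) a" using a interior_maximal[OF a] by simp
  hence "box (- a) a \<noteq> {}" using assms(2) by blast
  \<comment> \<open>Every box of the covering contains a point of the interior and lies in the set
    that the gauge assigns to it; this choice keeps the boxes inside the interior.\<close>
  have g: "gauge (\<lambda>x. if x \<in> ?S then ?S else UNIV)" by (auto simp: gauge_def)
  obtain D where D: "countable D" "\<And>K. K \<in> D \<Longrightarrow> interior K \<noteq> {} \<and> (\<exists>c d. K = cbox c d)"
    "pairwise (\<lambda>A B. interior A \<inter> interior B = {}) D"
    "\<And>K. K \<in> D \<Longrightarrow> \<exists>x \<in> ?S \<inter> K. K \<subseteq> (if x \<in> ?S then ?S else UNIV)" "?S \<subseteq> \<Union>D"
    using covering_lemma[OF a \<open>box (- a) a \<noteq> {}\<close> g] by metis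
  have sub: "l \<subseteq> ?S" if "l \<in> D" for l using D(4)[OF that] by auto
  hence eq: "\<Union>D = ?S" using D(5) by blast
  have lmS: "?S \<in> lmeasurable" using bS by (simp add: lmeasurable_open)
  have lmD: "l \<in> lmeasurable" if "l \<in> D" for l using D(2)[OF that] by auto
  \<comment> \<open>The cap by the full measure forces the finite subfamily to have a positive
    measure, hence to be nonempty.\<close>
  define e' where "e' = min e (measure lebesgue ?S)"
  have "\<not> negligible ?S" using assms(2) open_not_negligible by blast
  hence "measure lebesgue ?S \<noteq> 0" using lmS by (auto simp: negligible_iff_measure)
  hence "measure lebesgue ?S > 0" using measure_nonneg[of lebesgue ?S] by linarith
  hence e': "e' > 0" using assms(3) by (simp add: e'_def)
  obtain D' where D': "D' \<subseteq> D" "finite D'" "measure lebesgue (\<Union>D) - e' < measure lebesgue (\<Union>D')"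
  proof (rule measure_countable_Union_approachable[OF D(1) e' lmD])
    show "measure lebesgue (\<Union>D') \<le> measure lebesgue ?S" if "D' \<subseteq> D" "finite D'" for D'
      using that lmS lmD sub by (intro measure_mono_fmeasurable fmeasurableD fmeasurable.finite_Union) auto
  qed auto
  have "D' \<noteq> {}" using D'(3) by (auto simp: eq e'_def)
  show thesis
  proof (rule that)
    show "box_family D'" unfolding box_family_def
      using D' D(2,3) \<open>D' \<noteq> {}\<close> pairwise_subset[OF D(3) D'(1)] by blast
    show "\<Union>D' \<subseteq> K" using D'(1) sub interior_subset[of K] by blast
    show "measure lebesgue ?S - e < measure lebesgue (\<Union>D')" using D'(3) by (simp add: eq e'_def)
  qed
qed

lemma measure_interior_convex:
  fixes K :: "'a::euclidean_space set"
  assumes "compact K" "convex K"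
  shows "measure lebesgue (interior K) = measure lborel K"
proof -
  have "measure lebesgue (interior K) = measure lebesgue K"
    using assms by (intro measure_negligible_symdiff lmeasurable_compact negligible_subset[OF negligible_convex_frontier[OF assms(2)]])
      (auto simp: frontier_def dest: interior_subset[THEN subsetD] closure_subset[THEN subsetD])
  thus ?thesis using assms by (simp add: borel_compact)
qed

lemma brunn_minkowski:
  fixes K L :: "'a::euclidean_space set"
  assumes "convex_body K" "convex_body L" "interior K \<noteq> {}" "interior L \<noteq> {}"
  shows "measure lborel K powr (1 / DIM('a)) + measure lborel L powr (1 / DIM('a))
    \<le> measure lborel (K + L) powr (1 / DIM('a))"
proof -
  let ?n = "DIM('a)" and ?\<mu> = "measure lebesgue :: 'a set \<Rightarrow> real"
  have K: "compact K" "convex K" and L: "compact L" "convex L" using assms by (auto simp: convex_body_def)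
  have sum: "measure lborel (K + L) = ?\<mu> (K + L)"
    using compact_set_plus[OF K(1) L(1)] by (simp add: borel_compact)
  define e where "e k = inverse (real (Suc k))" for k
  have e: "e k > 0" "e \<longlonglongrightarrow> 0" for k
    using LIMSEQ_inverse_real_of_nat by (auto simp: e_def[abs_def])
  \<comment> \<open>The truncation at 0 keeps the root monotone while e k still exceeds the
    volume.\<close>
  have bound: "max 0 (measure lborel K - e k) powr (1 / ?n) + max 0 (measure lborel L - e k) powr (1 / ?n)
      \<le> measure lborel (K + L) powr (1 / ?n)" for k
  proof -
    obtain F where F: "box_family F" "\<Union>F \<subseteq> K" "measure lborel K - e k < ?\<mu> (\<Union>F)"
      using inner_box_family[OF compact_imp_bounded[OF K(1)] assms(3) e(1)] measure_interior_convex[OF K] by metis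
    obtain G where G: "box_family G" "\<Union>G \<subseteq> L" "measure lborel L - e k < ?\<mu> (\<Union>G)"
      using inner_box_family[OF compact_imp_bounded[OF L(1)] assms(4) e(1)] measure_interior_convex[OF L] by metis
    have "max 0 (measure lborel K - e k) powr (1 / ?n) + max 0 (measure lborel L - e k) powr (1 / ?n)
        \<le> ?\<mu> (\<Union>F) powr (1 / ?n) + ?\<mu> (\<Union>G) powr (1 / ?n)"
      using F(3) G(3) by (intro add_mono powr_mono2) (auto simp: less_imp_le)
    also have "\<dots> \<le> ?\<mu> (\<Union>F + \<Union>G) powr (1 / ?n)" by (rule brunn_minkowski_boxes[OF F(1) G(1)])
    also have "\<dots> \<le> ?\<mu> (K + L) powr (1 / ?n)"
      using F G K L by (intro powr_mono2 measure_mono_fmeasurable fmeasurableD lmeasurable_compact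
        compact_set_plus box_family_compact set_plus_mono2) auto
    finally show ?thesis by (simp add: sum)
  qed
  have lim: "(\<lambda>k. max 0 (v - e k) powr (1 / ?n)) \<longlonglongrightarrow> v powr (1 / ?n)" if "v \<ge> 0" for v :: real
  proof -
    have "(\<lambda>k. max 0 (v - e k)) \<longlonglongrightarrow> max 0 (v - 0)" by (intro tendsto_intros e)
    hence "(\<lambda>k. max 0 (v - e k)) \<longlonglongrightarrow> v" using that by simp
    thus ?thesis by (rule tendsto_powr2) auto
  qed
  show ?thesis
    by (rule LIMSEQ_le_const2[OF tendsto_add[OF lim lim]]) (use bound in auto)
qed

section \<open>Mixed volumes as derivatives\<close>

text \<open>One-sided, because the volume of X + aA is polynomial in a only for a >= 0.\<close>

definition right_slope :: "(real \<Rightarrow> real) \<Rightarrow> real \<Rightarrow> bool" where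
  "right_slope f D \<longleftrightarrow> ((\<lambda>t. (f t - f 0) / t) \<longlongrightarrow> D) (at_right 0)"

lemma right_slope_unique: "right_slope f D \<Longrightarrow> right_slope f E \<Longrightarrow> D = E"
  unfolding right_slope_def by (rule tendsto_unique) auto

lemma right_slope_cong:
  assumes "right_slope f D" "\<And>t. t \<ge> 0 \<Longrightarrow> f t = g t"
  shows "right_slope g D"
  using assms(1) unfolding right_slope_def
  by (rule Lim_transform_eventually) (auto simp: eventually_at_filter assms(2))

text \<open>The device that turns inequalities between volumes into inequalities between mixed
  volumes. Equality at 0 is what makes the difference quotients comparable.\<close>

lemma right_slope_mono:
  assumes "right_slope f D" "right_slope g E" "f 0 = g 0" "\<And>t. t > 0 \<Longrightarrow> f t \<le> g t"
  shows "D \<le> E"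
  using assms unfolding right_slope_def
  by (intro tendsto_le[of "at_right 0" _ E _ D]) (auto simp: eventually_at_filter divide_right_mono)

lemma right_slope_DERIV:
  assumes "(f has_real_derivative D) (at 0)"
  shows "right_slope f D"
  using assms unfolding right_slope_def has_field_derivative_iff
  by (auto intro: tendsto_within_subset)

lemma right_slope_scale:
  assumes "right_slope f D"
  shows "right_slope (\<lambda>t. c * f t) (c * D)"
  using tendsto_mult_left[OF assms[unfolded right_slope_def], of c]
  by (simp add: right_slope_def right_diff_distrib)

lemma right_slope_power_sum:
  assumes "finite A"
  shows "right_slope (\<lambda>t. \<Sum>w\<in>A. g w * t ^ k w) (\<Sum>w\<in>A. if k w = 1 then g w else 0)"
proof (rule right_slope_DERIV)
  have *: "real (k w) * 0 ^ (k w - Suc 0) = (if k w = 1 then 1 else 0)" for w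
    by (cases "k w"; cases "k w - 1") auto
  have "((\<lambda>t. \<Sum>w\<in>A. g w * t ^ k w) has_real_derivative (\<Sum>w\<in>A. g w * (real (k w) * 0 ^ (k w - Suc 0)))) (at 0)"
    by (auto intro!: derivative_eq_intros sum.cong)
  thus "((\<lambda>t. \<Sum>w\<in>A. g w * t ^ k w) has_real_derivative (\<Sum>w\<in>A. if k w = 1 then g w else 0)) (at 0)"
    unfolding * by (simp add: if_distrib cong: if_cong)
qed

text \<open>These words index the expansion of the volume of X + bB + aA: the letter 0 stands for X,
  1 for B and 2 for A.\<close>

abbreviation words3 :: "nat \<Rightarrow> nat list set" where
  "words3 n \<equiv> {w. length w = n \<and> set w \<subseteq> {..<3}}"

lemma finite_words3: "finite (words3 n)"
  by (rule finite_words)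

lemma prod_list_words3:
  assumes "set w \<subseteq> {..<3::nat}" "c 0 = (1::real)"
  shows "prod_list (map c w) = c 1 ^ count_list w 1 * c 2 ^ count_list w 2"
  using assms(1)
proof (induction w)
  case (Cons i w)
  hence "i = 0 \<or> i = 1 \<or> i = 2" by auto
  thus ?case using Cons assms(2) by (elim disjE) simp_all
qed simp

lemma sum_prod_words3:
  "(\<Sum>w\<in>words3 n. (b::real) ^ count_list w 1 * a ^ count_list w 2) = (1 + b + a) ^ n"
proof (induction n)
  case 0
  have "words3 0 = {[]}" by auto
  thus ?case by simp
next
  case (Suc n)
  let ?f = "\<lambda>w. b ^ count_list w 1 * a ^ count_list w 2"
  have "words3 (Suc n) = (\<lambda>(i, w). i # w) ` ({0,1,2} \<times> words3 n)"
    by (auto simp: length_Suc_conv image_iff)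
  hence "(\<Sum>w\<in>words3 (Suc n). ?f w) = (\<Sum>(i, w)\<in>{0,1,2} \<times> words3 n. ?f (i # w))"
    by (simp add: sum.reindex inj_on_def case_prod_unfold)
  also have "\<dots> = (\<Sum>i\<in>{0::nat,1,2}. \<Sum>w\<in>words3 n. ?f (i # w))"
    by (simp add: sum.cartesian_product)
  also have "\<dots> = (1 + b + a) * (\<Sum>w\<in>words3 n. ?f w)"
    by (simp add: sum_distrib_left[symmetric] algebra_simps)
  finally show ?case using Suc by simp
qed

text \<open>Both are read off the generating function (1 + b + a)^n of
  \<open>sum_prod_words3\<close>: first its slope in a at 0, then the slope of the result in
  b.\<close>

lemma count_words3:
  shows "(\<Sum>w\<in>words3 n. if count_list w 2 = 1 then (b::real) ^ count_list w 1 else 0) = n * (1 + b) ^ (n - 1)"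
    and "(\<Sum>w\<in>words3 n. if count_list w 1 = 1 \<and> count_list w 2 = 1 then 1 else 0) = real n * real (n - 1)"
proof -
  show 1: "(\<Sum>w\<in>words3 n. if count_list w 2 = 1 then b ^ count_list w 1 else 0) = n * (1 + b) ^ (n - 1)" for b :: real
  proof (rule right_slope_unique)
    show "right_slope (\<lambda>a. (1 + b + a) ^ n) (\<Sum>w\<in>words3 n. if count_list w 2 = 1 then b ^ count_list w 1 else 0)"
      using right_slope_power_sum[OF finite_words3, of "\<lambda>w. b ^ count_list w 1" "\<lambda>w. count_list w 2" n]
      by (simp only: sum_prod_words3)
    show "right_slope (\<lambda>a. (1 + b + a) ^ n) (n * (1 + b) ^ (n - 1))"
      by (rule right_slope_DERIV) (auto intro!: derivative_eq_intros)
  qed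
  show "(\<Sum>w\<in>words3 n. if count_list w 1 = 1 \<and> count_list w 2 = 1 then 1 else 0) = real n * real (n - 1)"
  proof (rule right_slope_unique)
    have "(\<lambda>b. \<Sum>w\<in>words3 n. (if count_list w 2 = 1 then 1 else 0) * b ^ count_list w 1) = (\<lambda>b::real. n * (1 + b) ^ (n - 1))"
      unfolding 1[symmetric] by (intro ext sum.cong) auto
    moreover have "(\<Sum>w\<in>words3 n. if count_list w 1 = 1 then (if count_list w 2 = 1 then 1 else 0) else 0) =
        (\<Sum>w\<in>words3 n. if count_list w 1 = 1 \<and> count_list w 2 = 1 then 1 else (0::real))"
      by (intro sum.cong) auto
    moreover note right_slope_power_sum[OF finite_words3, of "\<lambda>w. if count_list w 2 = 1 then 1 else 0" "\<lambda>w. count_list w 1" n]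
    ultimately show "right_slope (\<lambda>b. real n * (1 + b) ^ (n - 1))
        (\<Sum>w\<in>words3 n. if count_list w 1 = 1 \<and> count_list w 2 = 1 then 1 else 0)"
      by (simp only:)
    show "right_slope (\<lambda>b. real n * (1 + b) ^ (n - 1)) (real n * real (n - 1))"
      by (rule right_slope_DERIV) (auto intro!: derivative_eq_intros)
  qed
qed

section \<open>Mixed volumes with one and with two distinguished bodies\<close>

lemma convex_body_add: "convex_body A \<Longrightarrow> convex_body B \<Longrightarrow> convex_body (A + B)"
  by (auto simp: convex_body_def compact_set_plus convex_set_plus)

lemma convex_body_scaleR: "convex_body A \<Longrightarrow> convex_body ((\<lambda>x. c *\<^sub>R x) ` A)"
  by (auto simp: convex_body_def compact_scaling convex_scaling)

lemma convex_body_translate: "convex_body A \<Longrightarrow> convex_body ((\<lambda>x. z + x) ` A)"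
  by (auto simp: convex_body_def compact_translation convex_translation)

lemma convex_body_segment: "convex_body (closed_segment a b)"
  by (simp add: convex_body_def)

definition mixed_volume1 :: "(real^'n) set \<Rightarrow> (real^'n) set \<Rightarrow> real" where
  "mixed_volume1 K A = mixed_volume (replicate (CARD('n) - 1) K @ [A])"

definition mixed_volume2 :: "(real^'n) set \<Rightarrow> (real^'n) set \<Rightarrow> (real^'n) set \<Rightarrow> real" where
  "mixed_volume2 A B K = mixed_volume ([A, B] @ replicate (CARD('n) - 2) K)"

lemma mixed_volume_mset:
  fixes Ks Ls :: "(real^'n) set list"
  assumes "body_tuple Ks" "mset Ls = mset Ks"
  shows "mixed_volume Ls = mixed_volume Ks"
  using is_mixed_volume_mixed_volume[where 'n = 'n, unfolded is_mixed_volume_def, THEN conjunct1] assms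
  by blast

lemma mset_words3:
  fixes w :: "nat list"
  assumes "set w \<subseteq> {..<3}"
  shows "mset w = replicate_mset (length w - count_list w 1 - count_list w 2) 0
    + replicate_mset (count_list w 1) 1 + replicate_mset (count_list w 2) 2"
proof -
  have "mset w = replicate_mset (count_list w 0) 0 + replicate_mset (count_list w 1) 1 + replicate_mset (count_list w 2) 2"
  proof (rule multiset_eqI)
    fix i :: nat
    consider "i = 0" | "i = 1" | "i = 2" | "i \<ge> 3" by linarith
    thus "count (mset w) i = count (replicate_mset (count_list w 0) 0 + replicate_mset (count_list w 1) 1 + replicate_mset (count_list w 2) 2) i"
    proof cases
      case 4
      hence "i \<notin> set w" using assms by auto
      thus ?thesis using 4 by (auto simp: count_mset_0_iff simp del: count_mset)
    qed (auto simp: count_mset)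
  qed
  moreover from arg_cong[OF this, of size] have "length w - count_list w 1 - count_list w 2 = count_list w 0" by simp
  ultimately show ?thesis by simp
qed

context
  fixes X A B :: "(real^'n) set"
  assumes X: "convex_body X" and A: "convex_body A" and B: "convex_body B"
begin

private abbreviation (input) "bodies \<equiv> \<lambda>i. if i = 0 then X else if i = 1 then B else A"

private lemma bodies: "convex_body (bodies i)" for i :: nat using X A B by simp

private lemma body_tuple_map_bodies: "length w = CARD('n) \<Longrightarrow> body_tuple (map bodies w)"
  by (auto simp: body_tuple_def bodies X A B)

private lemma map_bodies_mset: "length w = CARD('n) \<Longrightarrow> mset Ls = mset (map bodies w) \<Longrightarrow> mixed_volume (map bodies w) = mixed_volume Ls"
  by (rule mixed_volume_mset[symmetric]) (auto intro: body_tuple_map_bodies)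

lemma volume_expansion:
  assumes "a \<ge> 0" "b \<ge> 0"
  shows "measure lborel (X + (\<lambda>x. b *\<^sub>R x) ` B + (\<lambda>x. a *\<^sub>R x) ` A) =
    (\<Sum>w\<in>words3 CARD('n). b ^ count_list w 1 * a ^ count_list w 2 * mixed_volume (map bodies w))"
proof -
  let ?c = "\<lambda>i::nat. if i = 0 then 1 else if i = 1 then b else a"
  have "measure lborel (\<Sum>i<3. (\<lambda>x. ?c i *\<^sub>R x) ` bodies i) =
      (\<Sum>w | length w = DIM(real^'n) \<and> set w \<subseteq> {..<3}. prod_list (map ?c w) * mixed_volume (map bodies w))"
    using is_mixed_volume_mixed_volume[where 'n = 'n] assms X A B unfolding is_mixed_volume_def
    by (auto simp del: map_eq_conv)
  also have "(\<Sum>i<3. (\<lambda>x. ?c i *\<^sub>R x) ` bodies i) = X + (\<lambda>x. b *\<^sub>R x) ` B + (\<lambda>x. a *\<^sub>R x) ` A"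
    by (simp add: numeral_3_eq_3 lessThan_Suc add_ac)
  also have "(\<Sum>w | length w = DIM(real^'n) \<and> set w \<subseteq> {..<3}. prod_list (map ?c w) * mixed_volume (map bodies w)) =
     (\<Sum>w\<in>words3 CARD('n). b ^ count_list w 1 * a ^ count_list w 2 * mixed_volume (map bodies w))"
    by (intro sum.cong) (auto simp: prod_list_words3)
  finally show ?thesis .
qed

lemma mixed_volume_word1:
  assumes "w \<in> words3 CARD('n)" "count_list w 1 = 0" "count_list w 2 = 1"
  shows "mixed_volume (map bodies w) = mixed_volume1 X A"
proof -
  have "mset w = replicate_mset (CARD('n) - 1) 0 + {#2#}"
    using mset_words3[of w] assms by simp
  hence "mset (replicate (CARD('n) - 1) X @ [A]) = mset (map bodies w)" by simp
  thus ?thesis unfolding mixed_volume1_def using assms(1) by (intro map_bodies_mset) auto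
qed

lemma mixed_volume_word2:
  assumes "w \<in> words3 CARD('n)" "count_list w 1 = 1" "count_list w 2 = 1"
  shows "mixed_volume (map bodies w) = mixed_volume2 A B X"
proof -
  have "mset w = replicate_mset (CARD('n) - 2) 0 + {#1#} + {#2#}"
    using mset_words3[of w] assms by (simp add: numeral_2_eq_2)
  hence "mset ([A, B] @ replicate (CARD('n) - 2) X) = mset (map bodies w)" by simp
  thus ?thesis unfolding mixed_volume2_def using assms(1) by (intro map_bodies_mset) auto
qed

text \<open>Taking b = 0 in the three-letter expansion removes all words with the letter 1, by the
  convention 0 ^ 0 = 1. The linear term in a then collects the n words with exactly one letter
  2.\<close>

lemma right_slope_volume: "right_slope (\<lambda>a. measure lborel (X + (\<lambda>x. a *\<^sub>R x) ` A)) (CARD('n) * mixed_volume1 X A)"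
proof -
  have "right_slope (\<lambda>a. \<Sum>w\<in>words3 CARD('n). (0 ^ count_list w 1 * mixed_volume (map bodies w)) * a ^ count_list w 2)
      (\<Sum>w\<in>words3 CARD('n). if count_list w 2 = 1 then 0 ^ count_list w 1 * mixed_volume (map bodies w) else 0)"
    by (rule right_slope_power_sum[OF finite_words3])
  moreover have "(\<Sum>w\<in>words3 CARD('n). if count_list w 2 = 1 then 0 ^ count_list w 1 * mixed_volume (map bodies w) else 0) =
     (\<Sum>w\<in>words3 CARD('n). if count_list w 2 = 1 then 0 ^ count_list w 1 else 0) * mixed_volume1 X A"
    unfolding sum_distrib_right by (intro sum.cong refl) (use mixed_volume_word1 in \<open>auto simp: power_0_left\<close>)
  moreover have "measure lborel (X + (\<lambda>x. a *\<^sub>R x) ` A) =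
     (\<Sum>w\<in>words3 CARD('n). (0 ^ count_list w 1 * mixed_volume (map bodies w)) * a ^ count_list w 2)" if "a \<ge> 0" for a
  proof -
    have "(\<lambda>x. 0 *\<^sub>R x) ` B = 0" using B by (auto simp: convex_body_def)
    thus ?thesis using volume_expansion[OF that order.refl] by (simp add: mult_ac)
  qed
  ultimately show ?thesis using count_words3(1)[where b = 0 and n = "CARD('n)"] by (auto elim!: right_slope_cong)
qed

end

context
  fixes X A B :: "(real^'n) set"
  assumes X: "convex_body X" and A: "convex_body A" and B: "convex_body B"
begin

private abbreviation (input) "triple \<equiv> \<lambda>i. if i = 0 then X else if i = 1 then B else A"

lemma mixed_volume1_expansion:
  assumes "b \<ge> 0"
  shows "CARD('n) * mixed_volume1 (X + (\<lambda>x. b *\<^sub>R x) ` B) A =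
    (\<Sum>w\<in>words3 CARD('n). if count_list w 2 = 1 then b ^ count_list w 1 * mixed_volume (map triple w) else 0)"
proof (rule right_slope_unique)
  show "right_slope (\<lambda>a. measure lborel (X + (\<lambda>x. b *\<^sub>R x) ` B + (\<lambda>x. a *\<^sub>R x) ` A))
      (CARD('n) * mixed_volume1 (X + (\<lambda>x. b *\<^sub>R x) ` B) A)"
    by (rule right_slope_volume) (auto intro: convex_body_add convex_body_scaleR X A B)
  have "right_slope (\<lambda>a. \<Sum>w\<in>words3 CARD('n). (b ^ count_list w 1 * mixed_volume (map triple w)) * a ^ count_list w 2)
      (\<Sum>w\<in>words3 CARD('n). if count_list w 2 = 1 then b ^ count_list w 1 * mixed_volume (map triple w) else 0)"
    by (rule right_slope_power_sum[OF finite_words3])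
  thus "right_slope (\<lambda>a. measure lborel (X + (\<lambda>x. b *\<^sub>R x) ` B + (\<lambda>x. a *\<^sub>R x) ` A))
      (\<Sum>w\<in>words3 CARD('n). if count_list w 2 = 1 then b ^ count_list w 1 * mixed_volume (map triple w) else 0)"
    by (rule right_slope_cong) (simp add: volume_expansion[OF X A B _ assms] mult_ac)
qed

text \<open>The linear coefficient in a of the volume of X + bB + aA is n times the mixed volume on
  the left. Its own linear coefficient in b comes from the n (n - 1) words with one letter 1 and one
  letter 2.\<close>

lemma right_slope_mixed_volume1:
  "right_slope (\<lambda>b. mixed_volume1 (X + (\<lambda>x. b *\<^sub>R x) ` B) A) (real (CARD('n) - 1) * mixed_volume2 A B X)"
proof -
  let ?g = "\<lambda>w. if count_list w 2 = 1 then mixed_volume (map triple w) else 0"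
  have "right_slope (\<lambda>b. \<Sum>w\<in>words3 CARD('n). ?g w * b ^ count_list w 1)
      (\<Sum>w\<in>words3 CARD('n). if count_list w 1 = 1 then ?g w else 0)"
    by (rule right_slope_power_sum[OF finite_words3])
  also have "(\<Sum>w\<in>words3 CARD('n). if count_list w 1 = 1 then ?g w else 0) =
     (\<Sum>w\<in>words3 CARD('n). if count_list w 1 = 1 \<and> count_list w 2 = 1 then 1 else 0) * mixed_volume2 A B X"
    unfolding sum_distrib_right by (intro sum.cong refl) (use mixed_volume_word2[OF X A B] in auto)
  also have "\<dots> = CARD('n) * (real (CARD('n) - 1) * mixed_volume2 A B X)"
    by (simp only: count_words3(2) mult.assoc)
  finally have "right_slope (\<lambda>b. CARD('n) * mixed_volume1 (X + (\<lambda>x. b *\<^sub>R x) ` B) A) (CARD('n) * (real (CARD('n) - 1) * mixed_volume2 A B X))"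
  proof (rule right_slope_cong)
    fix b :: real assume "b \<ge> 0"
    thus "(\<Sum>w\<in>words3 CARD('n). ?g w * b ^ count_list w 1) = CARD('n) * mixed_volume1 (X + (\<lambda>x. b *\<^sub>R x) ` B) A"
      unfolding mixed_volume1_expansion[OF \<open>b \<ge> 0\<close>] by (intro sum.cong) auto
  qed
  from right_slope_scale[OF this, of "1 / CARD('n)"] show ?thesis by simp
qed

text \<open>In the expansion of the volume of X + tB + (te)A the coefficient of t collects the words
  with exactly one letter different from 0; those with the letter 2 carry the factor e.\<close>

lemma mixed_volume1_linear:
  assumes "e \<ge> 0"
  shows "mixed_volume1 X (B + (\<lambda>x. e *\<^sub>R x) ` A) = mixed_volume1 X B + e * mixed_volume1 X A"
proof -
  let ?V = "\<lambda>w. mixed_volume (map triple w)"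
  have vol: "measure lborel (X + (\<lambda>x. t *\<^sub>R x) ` (B + (\<lambda>x. e *\<^sub>R x) ` A)) =
      (\<Sum>w\<in>words3 CARD('n). (e ^ count_list w 2 * ?V w) * t ^ (count_list w 1 + count_list w 2))" if "t \<ge> 0" for t
  proof -
    have "X + (\<lambda>x. t *\<^sub>R x) ` (B + (\<lambda>x. e *\<^sub>R x) ` A) = X + (\<lambda>x. t *\<^sub>R x) ` B + (\<lambda>x. (t * e) *\<^sub>R x) ` A"
    proof -
      have "(\<lambda>x. t *\<^sub>R x) ` (B + (\<lambda>x. e *\<^sub>R x) ` A) = (\<lambda>x. t *\<^sub>R x) ` B + (\<lambda>x. (t * e) *\<^sub>R x) ` A"
        by (force simp: set_plus_def image_iff scaleR_add_right)
      thus ?thesis by (simp add: add.assoc)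
    qed
    thus ?thesis using that assms
      by (simp add: volume_expansion[OF X A B] power_mult_distrib power_add mult_ac)
  qed
  have c1: "right_slope (\<lambda>t. measure lborel (X + (\<lambda>x. t *\<^sub>R x) ` (B + (\<lambda>x. e *\<^sub>R x) ` A)))
     (\<Sum>w\<in>words3 CARD('n). if count_list w 1 + count_list w 2 = 1 then e ^ count_list w 2 * ?V w else 0)"
    by (rule right_slope_cong[OF right_slope_power_sum[OF finite_words3]]) (simp add: vol)
  have c2: "right_slope (\<lambda>t. measure lborel (X + (\<lambda>x. t *\<^sub>R x) ` (B + (\<lambda>x. e *\<^sub>R x) ` A)))
     (CARD('n) * mixed_volume1 X (B + (\<lambda>x. e *\<^sub>R x) ` A))"
    using X A B by (intro right_slope_volume[OF _ _ X] convex_body_add convex_body_scaleR)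
  have b1: "right_slope (\<lambda>t. measure lborel (X + (\<lambda>x. t *\<^sub>R x) ` B))
     (\<Sum>w\<in>words3 CARD('n). if count_list w 1 = 1 then 0 ^ count_list w 2 * ?V w else 0)"
  proof (rule right_slope_cong[OF right_slope_power_sum[OF finite_words3]])
    fix t :: real assume "t \<ge> 0"
    have "(\<lambda>x. 0 *\<^sub>R x) ` A = 0" using A by (auto simp: convex_body_def)
    thus "(\<Sum>w\<in>words3 CARD('n). (0 ^ count_list w 2 * ?V w) * t ^ count_list w 1) = measure lborel (X + (\<lambda>x. t *\<^sub>R x) ` B)"
      using volume_expansion[OF X A B order.refl \<open>t \<ge> 0\<close>] by (simp add: mult_ac)
  qed
  have b2: "right_slope (\<lambda>t. measure lborel (X + (\<lambda>x. t *\<^sub>R x) ` B)) (CARD('n) * mixed_volume1 X B)"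
    by (rule right_slope_volume[OF X B X])
  have a1: "right_slope (\<lambda>t. measure lborel (X + (\<lambda>x. t *\<^sub>R x) ` A))
     (\<Sum>w\<in>words3 CARD('n). if count_list w 2 = 1 then 0 ^ count_list w 1 * ?V w else 0)"
  proof (rule right_slope_cong[OF right_slope_power_sum[OF finite_words3]])
    fix t :: real assume "t \<ge> 0"
    have "(\<lambda>x. 0 *\<^sub>R x) ` B = 0" using B by (auto simp: convex_body_def)
    thus "(\<Sum>w\<in>words3 CARD('n). (0 ^ count_list w 1 * ?V w) * t ^ count_list w 2) = measure lborel (X + (\<lambda>x. t *\<^sub>R x) ` A)"
      using volume_expansion[OF X A B \<open>t \<ge> 0\<close> order.refl] by (simp add: mult_ac)
  qed
  have a2: "right_slope (\<lambda>t. measure lborel (X + (\<lambda>x. t *\<^sub>R x) ` A)) (CARD('n) * mixed_volume1 X A)"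
    by (rule right_slope_volume[OF X A X])
  have split: "(\<Sum>w\<in>words3 CARD('n). if count_list w 1 + count_list w 2 = 1 then e ^ count_list w 2 * ?V w else 0) =
      (\<Sum>w\<in>words3 CARD('n). if count_list w 1 = 1 then 0 ^ count_list w 2 * ?V w else 0) +
      e * (\<Sum>w\<in>words3 CARD('n). if count_list w 2 = 1 then 0 ^ count_list w 1 * ?V w else 0)"
    unfolding sum_distrib_left sum.distrib[symmetric]
    by (intro sum.cong refl) (auto simp: power_0_left add_is_1)
  have "CARD('n) * mixed_volume1 X (B + (\<lambda>x. e *\<^sub>R x) ` A) =
      CARD('n) * mixed_volume1 X B + e * (CARD('n) * mixed_volume1 X A)"
    using right_slope_unique[OF c2 c1] right_slope_unique[OF b2 b1] right_slope_unique[OF a2 a1] split by simp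
  hence "CARD('n) * mixed_volume1 X (B + (\<lambda>x. e *\<^sub>R x) ` A) = CARD('n) * (mixed_volume1 X B + e * mixed_volume1 X A)"
    by (simp add: algebra_simps)
  thus ?thesis by simp
qed

end

section \<open>Homothety, monotonicity and positivity\<close>

lemma measure_homothety:
  fixes K :: "'a::euclidean_space set"
  assumes "compact K"
  shows "measure lborel ((\<lambda>x. z + c *\<^sub>R x) ` K) = \<bar>c\<bar> ^ DIM('a) * measure lborel K"
proof -
  have c: "compact ((\<lambda>x. z + c *\<^sub>R x) ` K)"
    using assms by (intro compact_continuous_image continuous_intros)
  have "(\<lambda>x. z + c *\<^sub>R x) ` K = (\<lambda>x. c *\<^sub>R x + z) ` K" by (simp add: add.commute)
  thus ?thesis
    using measure_lebesgue_affine[of c z K] c assms by (simp add: borel_compact)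
qed

lemma measure_translate:
  fixes K :: "'a::euclidean_space set"
  assumes "compact K"
  shows "measure lborel ((\<lambda>x. z + x) ` K) = measure lborel K"
  using measure_homothety[OF assms, of z 1] by simp

lemma measure_scaleR:
  fixes K :: "'a::euclidean_space set"
  assumes "compact K"
  shows "measure lborel ((\<lambda>x. c *\<^sub>R x) ` K) = \<bar>c\<bar> ^ DIM('a) * measure lborel K"
  using measure_homothety[OF assms, of 0 c] by simp

lemma measure_mono_compact:
  fixes K L :: "'a::euclidean_space set"
  assumes "compact K" "compact L" "K \<subseteq> L"
  shows "measure lborel K \<le> measure lborel L"
  using measure_mono_fmeasurable[of K L lebesgue] assms
  by (simp add: borel_compact lmeasurable_compact fmeasurableD)

lemma measure_pos_iff_interior:
  fixes K :: "'a::euclidean_space set"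
  assumes "compact K" "convex K"
  shows "measure lborel K > 0 \<longleftrightarrow> interior K \<noteq> {}"
proof -
  have "measure lebesgue K = 0 \<longleftrightarrow> negligible K"
    using lmeasurable_compact[OF assms(1)] by (auto simp: negligible_iff_measure)
  hence "measure lborel K = 0 \<longleftrightarrow> interior K = {}"
    using assms by (simp add: negligible_convex_interior borel_compact)
  thus ?thesis by (simp add: zero_less_measure_iff less_le)
qed

lemma translate_eq_plus: "(\<lambda>x. z + x) ` A = {z} + A"
  by (auto simp: set_plus_def)

lemma mixed_volume1_self:
  fixes K :: "(real^'n) set"
  assumes "convex_body K"
  shows "mixed_volume1 K K = measure lborel K"
proof -
  have K: "compact K" "convex K" using assms by (auto simp: convex_body_def)
  have "right_slope (\<lambda>t. (1 + t) ^ CARD('n) * measure lborel K) (CARD('n) * measure lborel K)"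
    by (rule right_slope_DERIV) (auto intro!: derivative_eq_intros)
  hence "right_slope (\<lambda>t. measure lborel (K + (\<lambda>x. t *\<^sub>R x) ` K)) (CARD('n) * measure lborel K)"
  proof (rule right_slope_cong)
    fix t :: real assume "t \<ge> 0"
    have "K + (\<lambda>x. t *\<^sub>R x) ` K = (\<lambda>x. (1 + t) *\<^sub>R x) ` K"
      using scaleR_add_image[OF K(2), of 1 t] \<open>t \<ge> 0\<close> by simp
    thus "(1 + t) ^ CARD('n) * measure lborel K = measure lborel (K + (\<lambda>x. t *\<^sub>R x) ` K)"
      using measure_scaleR[OF K(1), of "1 + t"] \<open>t \<ge> 0\<close> by simp
  qed
  from right_slope_unique[OF this right_slope_volume[OF assms assms assms]] show ?thesis by simp
qed

lemma mixed_volume1_mono: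
  fixes X A B :: "(real^'n) set"
  assumes "convex_body X" "convex_body A" "convex_body B" "A \<subseteq> B"
  shows "mixed_volume1 X A \<le> mixed_volume1 X B"
proof -
  have "CARD('n) * mixed_volume1 X A \<le> CARD('n) * mixed_volume1 X B"
  proof (rule right_slope_mono)
    show "right_slope (\<lambda>t. measure lborel (X + (\<lambda>x. t *\<^sub>R x) ` A)) (CARD('n) * mixed_volume1 X A)"
      "right_slope (\<lambda>t. measure lborel (X + (\<lambda>x. t *\<^sub>R x) ` B)) (CARD('n) * mixed_volume1 X B)"
      using assms by (auto intro: right_slope_volume)
    have "(\<lambda>x. 0 *\<^sub>R x) ` A = {0}" "(\<lambda>x. 0 *\<^sub>R x) ` B = {0}" using assms by (auto simp: convex_body_def)
    thus "measure lborel (X + (\<lambda>x. 0 *\<^sub>R x) ` A) = measure lborel (X + (\<lambda>x. 0 *\<^sub>R x) ` B)" by simp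
    show "measure lborel (X + (\<lambda>x. t *\<^sub>R x) ` A) \<le> measure lborel (X + (\<lambda>x. t *\<^sub>R x) ` B)" for t
      using assms by (intro measure_mono_compact compact_set_plus compact_scaling set_plus_mono2 image_mono)
        (auto simp: convex_body_def)
  qed
  thus ?thesis by simp
qed

lemma mixed_volume1_point:
  fixes X :: "(real^'n) set"
  assumes X: "convex_body X"
  shows "mixed_volume1 X {z} = 0"
proof -
  have z: "convex_body {z}" by (simp add: convex_body_def)
  have "right_slope (\<lambda>t. measure lborel (X + (\<lambda>x. t *\<^sub>R x) ` {z})) 0"
  proof (rule right_slope_cong)
    show "right_slope (\<lambda>t. measure lborel X) 0" by (rule right_slope_DERIV) simp
    show "measure lborel X = measure lborel (X + (\<lambda>x. t *\<^sub>R x) ` {z})" for t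
      using measure_translate[of X "t *\<^sub>R z"] X unfolding translate_eq_plus by (simp add: add.commute convex_body_def)
  qed
  from right_slope_unique[OF this right_slope_volume[OF X z X]] show ?thesis by simp
qed

lemma mixed_volume1_homothety:
  fixes X A :: "(real^'n) set"
  assumes "convex_body X" "convex_body A" "c \<ge> 0"
  shows "mixed_volume1 X ((\<lambda>x. z + c *\<^sub>R x) ` A) = c * mixed_volume1 X A"
proof -
  have "(\<lambda>x. z + c *\<^sub>R x) ` A = {z} + (\<lambda>x. c *\<^sub>R x) ` A" by (auto simp: set_plus_def)
  moreover have "convex_body {z}" by (simp add: convex_body_def)
  ultimately show ?thesis
    using mixed_volume1_linear[OF assms(1,2), of "{z}" c] assms mixed_volume1_point by simp
qed

lemma mixed_volume1_nonneg:
  assumes "convex_body X" "convex_body A"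
  shows "mixed_volume1 X A \<ge> 0"
proof -
  obtain z where "z \<in> A" using assms by (auto simp: convex_body_def)
  thus ?thesis
    using mixed_volume1_mono[of X "{z}" A] mixed_volume1_point[of X z] assms by (simp add: convex_body_def)
qed

text \<open>A ball in A contains a homothet of X with ratio e / R, whose mixed volume with X is e /
  R times the volume of X.\<close>

lemma mixed_volume1_pos:
  fixes X A :: "(real^'n) set"
  assumes "convex_body X" "interior X \<noteq> {}" "convex_body A" "interior A \<noteq> {}"
  shows "mixed_volume1 X A > 0"
proof -
  have X: "compact X" "convex X" "X \<noteq> {}" using assms by (auto simp: convex_body_def)
  obtain z e where e: "e > 0" "cball z e \<subseteq> A" using assms(4) mem_interior_cball by blast
  obtain R where R: "R > 0" "\<And>x. x \<in> X \<Longrightarrow> norm x \<le> R" using compact_imp_bounded[OF X(1)] by (metis bounded_pos)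
  have "(\<lambda>x. z + (e / R) *\<^sub>R x) ` X \<subseteq> cball z e"
  proof
    fix y assume "y \<in> (\<lambda>x. z + (e / R) *\<^sub>R x) ` X"
    then obtain x where x: "x \<in> X" "y = z + (e / R) *\<^sub>R x" by blast
    have "e / R * norm x \<le> e / R * R" using R x e by (intro mult_left_mono) auto
    thus "y \<in> cball z e" using R e by (simp add: x dist_norm)
  qed
  hence "(\<lambda>x. z + (e / R) *\<^sub>R x) ` X \<subseteq> A" using e by blast
  moreover have "convex_body ((\<lambda>x. z + (e / R) *\<^sub>R x) ` X)"
    using convex_body_translate[OF convex_body_scaleR[OF assms(1)]] by (simp add: image_image)
  ultimately have "e / R * measure lborel X \<le> mixed_volume1 X A"
    using mixed_volume1_mono[of X "(\<lambda>x. z + (e / R) *\<^sub>R x) ` X" A] assms R e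
    by (simp add: mixed_volume1_homothety mixed_volume1_self)
  moreover have "e / R * measure lborel X > 0"
    using measure_pos_iff_interior[OF X(1,2)] assms(2) e R by simp
  ultimately show ?thesis by linarith
qed

lemma mixed_volume2_self:
  fixes K B :: "(real^'n) set"
  assumes "CARD('n) \<ge> 2" "convex_body K" "convex_body B"
  shows "mixed_volume2 K B K = mixed_volume1 K B"
proof -
  have "mset ([K, B] @ replicate (CARD('n) - 2) K) = mset (replicate (Suc (CARD('n) - 2)) K @ [B])" by simp
  also have "Suc (CARD('n) - 2) = CARD('n) - 1" using assms(1) by simp
  finally show ?thesis
    unfolding mixed_volume1_def mixed_volume2_def
    by (rule mixed_volume_mset[rotated]) (use assms in \<open>auto simp: body_tuple_def\<close>)
qed

text \<open>The difference of the mixed volumes of $K + bB$ with $C$ and with $A$ vanishes at $b = 0$ and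
  is nonnegative for $b > 0$.\<close>

lemma mixed_volume2_le:
  fixes K A B C :: "(real^'n) set"
  assumes n: "CARD('n) \<ge> 2" and bodies: "convex_body K" "convex_body A" "convex_body B" "convex_body C"
    and "A \<subseteq> C" and eq: "mixed_volume1 K A = mixed_volume1 K C"
  shows "mixed_volume2 A B K \<le> mixed_volume2 C B K"
proof -
  have "real (CARD('n) - 1) * mixed_volume2 A B K \<le> real (CARD('n) - 1) * mixed_volume2 C B K"
  proof (rule right_slope_mono[OF right_slope_mixed_volume1 right_slope_mixed_volume1])
    have "(\<lambda>x. 0 *\<^sub>R x) ` B = {0}" using bodies by (auto simp: convex_body_def)
    thus "mixed_volume1 (K + (\<lambda>x. 0 *\<^sub>R x) ` B) A = mixed_volume1 (K + (\<lambda>x. 0 *\<^sub>R x) ` B) C"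
      using eq by simp
  qed (use assms in \<open>auto intro!: mixed_volume1_mono convex_body_add convex_body_scaleR\<close>)
  thus ?thesis using n by simp
qed

lemma mixed_volume2_homothety:
  fixes K A B :: "(real^'n) set"
  assumes n: "CARD('n) \<ge> 2" and bodies: "convex_body K" "convex_body A" "convex_body B" and "c \<ge> 0"
  shows "mixed_volume2 ((\<lambda>x. z + c *\<^sub>R x) ` A) B K = c * mixed_volume2 A B K"
proof -
  have h: "convex_body ((\<lambda>x. z + c *\<^sub>R x) ` A)"
    using convex_body_translate[OF convex_body_scaleR[OF bodies(2)]] by (simp add: image_image)
  have "right_slope (\<lambda>b. mixed_volume1 (K + (\<lambda>x. b *\<^sub>R x) ` B) ((\<lambda>x. z + c *\<^sub>R x) ` A))
      (c * (real (CARD('n) - 1) * mixed_volume2 A B K))"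
    by (rule right_slope_cong[OF right_slope_scale[OF right_slope_mixed_volume1]])
      (use assms in \<open>auto simp: mixed_volume1_homothety convex_body_add convex_body_scaleR\<close>)
  from right_slope_unique[OF this right_slope_mixed_volume1[OF bodies(1) h bodies(3)]]
  show ?thesis using n by simp
qed

section \<open>Sums with a segment\<close>

lemma scaleR_closed_segment: "(\<lambda>x. t *\<^sub>R x) ` closed_segment 0 u = closed_segment 0 (t *\<^sub>R (u::'a::real_vector))"
  using closed_segment_linear_image[of "\<lambda>x. t *\<^sub>R x" 0 u] by (simp add: linear_scaleR)

lemma closed_segment_0: "t \<ge> 0 \<Longrightarrow> closed_segment 0 (t *\<^sub>R u) = {a *\<^sub>R (u::'a::real_vector) |a. 0 \<le> a \<and> a \<le> t}"
proof (intro set_eqI iffI)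
  fix x assume t: "t \<ge> 0" and "x \<in> closed_segment 0 (t *\<^sub>R u)"
  then obtain s where "0 \<le> s" "s \<le> 1" "x = (s * t) *\<^sub>R u" by (auto simp: in_segment)
  thus "x \<in> {a *\<^sub>R u |a. 0 \<le> a \<and> a \<le> t}" using t mult_right_mono[of s 1 t] by (intro CollectI exI[of _ "s * t"]) auto
next
  fix x assume t: "t \<ge> 0" and "x \<in> {a *\<^sub>R u |a. 0 \<le> a \<and> a \<le> t}"
  then obtain a where a: "x = a *\<^sub>R u" "0 \<le> a" "a \<le> t" by blast
  show "x \<in> closed_segment 0 (t *\<^sub>R u)"
  proof (cases "t = 0")
    case False
    thus ?thesis using a t unfolding in_segment by (intro exI[of _ "a / t"]) (auto simp: divide_le_eq)
  qed (use a in auto)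
qed

context
  fixes X :: "(real^'n) set" and u :: "real^'n"
  assumes X: "convex_body X"
begin

private abbreviation (input) "f \<equiv> \<lambda>t. measure lborel (X + closed_segment 0 (t *\<^sub>R u))"

private lemma X_compact_convex: "compact X" "convex X" using X by (auto simp: convex_body_def)

text \<open>X + [0, (t+h)u] is the union of X + [0, tu] and the translate of X + [0, hu] by tu; by
  convexity these overlap exactly in X + tu. So the growth of the volume is additive in the
  length.\<close>

private lemma union_translate:
  assumes "t \<ge> 0" "h \<ge> 0"
  shows "f (t + h) = f t + f h - measure lborel X"
proof -
  let ?P = "X + closed_segment 0 (t *\<^sub>R u)"
  let ?Q = "(\<lambda>x. t *\<^sub>R u + x) ` (X + closed_segment 0 (h *\<^sub>R u))"
  have cP: "compact ?P" by (intro compact_set_plus X_compact_convex compact_segment)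
  have cQ': "compact (X + closed_segment 0 (h *\<^sub>R u))" by (intro compact_set_plus X_compact_convex compact_segment)
  hence cQ: "compact ?Q" by (rule compact_translation)
  have un: "?P \<union> ?Q = X + closed_segment 0 ((t + h) *\<^sub>R u)"
  proof (intro set_eqI iffI)
    fix x assume "x \<in> ?P \<union> ?Q"
    thus "x \<in> X + closed_segment 0 ((t + h) *\<^sub>R u)"
    proof
      assume "x \<in> ?P"
      then obtain y a where "y \<in> X" "0 \<le> a" "a \<le> t" "x = y + a *\<^sub>R u"
        using assms by (auto simp: closed_segment_0 elim!: set_plus_elim)
      thus ?thesis using assms by (auto simp: closed_segment_0 intro!: set_plus_intro exI[of _ a])
    next
      assume "x \<in> ?Q"
      then obtain y a where "y \<in> X" "0 \<le> a" "a \<le> h" "x = t *\<^sub>R u + (y + a *\<^sub>R u)"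
        using assms by (auto simp: closed_segment_0 elim!: set_plus_elim)
      hence "x = y + (t + a) *\<^sub>R u" "y \<in> X" "0 \<le> t + a" "t + a \<le> t + h" using assms by (auto simp: algebra_simps)
      thus ?thesis using assms by (auto simp: closed_segment_0 simp del: add_le_cancel_left intro!: set_plus_intro exI[of _ "t + a"])
    qed
  next
    fix x assume "x \<in> X + closed_segment 0 ((t + h) *\<^sub>R u)"
    then obtain y a where y: "y \<in> X" "0 \<le> a" "a \<le> t + h" "x = y + a *\<^sub>R u"
      using assms by (auto simp: closed_segment_0 elim!: set_plus_elim)
    show "x \<in> ?P \<union> ?Q"
    proof (cases "a \<le> t")
      case True
      hence "x \<in> ?P" using y assms by (auto simp: closed_segment_0 intro!: set_plus_intro exI[of _ a])
      thus ?thesis by blast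
    next
      case False
      hence "y + (a - t) *\<^sub>R u \<in> X + closed_segment 0 (h *\<^sub>R u)"
        using y assms by (auto simp: closed_segment_0 intro!: set_plus_intro exI[of _ "a - t"])
      moreover have "x = t *\<^sub>R u + (y + (a - t) *\<^sub>R u)" by (simp add: y algebra_simps)
      ultimately show ?thesis by blast
    qed
  qed
  have int: "?P \<inter> ?Q = (\<lambda>x. t *\<^sub>R u + x) ` X"
  proof (intro set_eqI iffI)
    fix x assume x: "x \<in> ?P \<inter> ?Q"
    then obtain y a where y: "y \<in> X" "0 \<le> a" "a \<le> t" "x = y + a *\<^sub>R u"
      using assms by (auto simp: closed_segment_0 elim!: set_plus_elim)
    obtain y' b where y': "y' \<in> X" "0 \<le> b" "b \<le> h" "x = t *\<^sub>R u + (y' + b *\<^sub>R u)"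
      using assms x by (auto simp: closed_segment_0 elim!: set_plus_elim)
    define z where "z = x - t *\<^sub>R u"
    have zy: "z = y - (t - a) *\<^sub>R u" "z = y' + b *\<^sub>R u" using y y' by (auto simp: z_def algebra_simps)
    have "z \<in> X"
    proof (cases "t - a + b = 0")
      case True
      hence "b = 0" using y y' by linarith
      thus ?thesis using zy(2) y' by simp
    next
      case False
      \<comment> \<open>In multiples of u, the point z lies b beyond y' and t - a before y, so it
        divides the segment from y' to y of length \<open>?d\<close>.\<close>
      let ?d = "t - a + b"
      have d: "?d > 0" using False y y' by linarith
      have "?d *\<^sub>R z = b *\<^sub>R y + (t - a) *\<^sub>R y'"
      proof -
        have "?d *\<^sub>R z = b *\<^sub>R z + (t - a) *\<^sub>R z" by (simp add: algebra_simps)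
        also have "\<dots> = b *\<^sub>R (y - (t - a) *\<^sub>R u) + (t - a) *\<^sub>R (y' + b *\<^sub>R u)" using zy by metis
        finally show ?thesis by (simp add: algebra_simps)
      qed
      hence "z = (1 / ?d) *\<^sub>R (b *\<^sub>R y + (t - a) *\<^sub>R y')"
        using False by (metis divide_self_if scaleR_one scaleR_scaleR times_divide_eq_left mult_1)
      hence "z = (b / ?d) *\<^sub>R y + ((t - a) / ?d) *\<^sub>R y'" by (simp add: scaleR_add_right)
      moreover have "b / ?d + (t - a) / ?d = 1" using d by (simp add: add_divide_distrib[symmetric])
      moreover have "b / ?d \<ge> 0" "(t - a) / ?d \<ge> 0" using d y y' by auto
      ultimately show ?thesis using convexD[OF X_compact_convex(2) y(1) y'(1)] by simp
    qed
    moreover have "x = t *\<^sub>R u + z" by (simp add: z_def)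
    ultimately show "x \<in> (\<lambda>x. t *\<^sub>R u + x) ` X" by blast
  next
    fix x assume "x \<in> (\<lambda>x. t *\<^sub>R u + x) ` X"
    then obtain y where y: "y \<in> X" "x = t *\<^sub>R u + y" by blast
    have "y + t *\<^sub>R u \<in> ?P" using y assms by (intro set_plus_intro) (auto simp: closed_segment_0)
    moreover have "y + 0 \<in> X + closed_segment 0 (h *\<^sub>R u)" using y by (intro set_plus_intro) auto
    ultimately show "x \<in> ?P \<inter> ?Q" by (auto simp: y add.commute)
  qed
  have "measure lebesgue (?P \<union> ?Q) = measure lebesgue ?P + measure lebesgue ?Q - measure lebesgue (?P \<inter> ?Q)"
    using lmeasurable_compact[OF cP] lmeasurable_compact[OF cQ] by (rule measure_Un3)
  hence "measure lborel (?P \<union> ?Q) = measure lborel ?P + measure lborel ?Q - measure lborel (?P \<inter> ?Q)"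
    using cP cQ compact_Un[OF cP cQ] compact_Int[OF cP cQ] by (simp add: borel_compact)
  thus ?thesis unfolding un int using measure_translate[OF cQ'] measure_translate[OF X_compact_convex(1)] by simp
qed

text \<open>The increment is additive in t, so its quotient by t is the same for t and for t / k; as
  k grows, the latter tends to the slope at 0. Thus n times the mixed volume with [0, u] acts as the
  volume of the shadow of X.\<close>

lemma volume_plus_segment:
  assumes "t \<ge> 0"
  shows "measure lborel (X + closed_segment 0 (t *\<^sub>R u)) =
    measure lborel X + t * (CARD('n) * mixed_volume1 X (closed_segment 0 u))"
proof (cases "t = 0")
  case False
  hence t: "t > 0" using assms by simp
  define D where "D = CARD('n) * mixed_volume1 X (closed_segment 0 u)"
  define g where "g t = f t - measure lborel X" for t
  have f0: "f 0 = measure lborel X" by simp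
  have slope: "((\<lambda>t. g t / t) \<longlongrightarrow> D) (at_right 0)"
    using right_slope_volume[OF X convex_body_segment X, of 0 u]
    unfolding right_slope_def scaleR_closed_segment f0 g_def D_def .
  have multiple: "g (real k * s) = real k * g s" if "s \<ge> 0" for k s
  proof (induction k)
    case (Suc k)
    have "g (real (Suc k) * s) = g (real k * s + s)" by (simp add: algebra_simps)
    also have "\<dots> = g (real k * s) + g s" unfolding g_def using union_translate[of "real k * s" s] that by simp
    finally show ?case using Suc by (simp add: algebra_simps)
  qed (simp add: g_def)
  have "(\<lambda>k. g (t / real (Suc k)) / (t / real (Suc k))) \<longlonglongrightarrow> D"
  proof (rule filterlim_compose[OF slope])
    have "(\<lambda>k. t * inverse (real (Suc k))) \<longlonglongrightarrow> t * 0" by (intro tendsto_mult_left LIMSEQ_inverse_real_of_nat)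
    hence "(\<lambda>k. t / real (Suc k)) \<longlonglongrightarrow> 0" by (simp add: divide_inverse)
    thus "filterlim (\<lambda>k. t / real (Suc k)) (at_right 0) sequentially"
      using t by (auto simp: filterlim_at)
  qed
  moreover have "g (t / real (Suc k)) / (t / real (Suc k)) = g t / t" for k
    using multiple[of "t / real (Suc k)" "Suc k"] t by (simp del: of_nat_Suc)
  ultimately have "(\<lambda>k::nat. g t / t) \<longlonglongrightarrow> D" by (simp only:)
  hence "g t / t = D" by (simp add: LIMSEQ_const_iff)
  thus ?thesis using t by (simp add: g_def D_def field_simps)
qed simp

text \<open>X and X + tu both lie in X + [0, tu], and their intersection is a translate of the set
  on the left. Inclusion-exclusion for the union gives the bound.\<close>

lemma volume_minus_translate_le:
  assumes "t \<ge> 0"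
  shows "measure lborel X - measure lborel (X \<inter> (\<lambda>y. y - t *\<^sub>R u) ` X) \<le>
    t * (CARD('n) * mixed_volume1 X (closed_segment 0 u))"
proof -
  let ?Y = "(\<lambda>x. t *\<^sub>R u + x) ` X"
  have cY: "compact ?Y" by (intro compact_translation X_compact_convex)
  have sub: "X \<union> ?Y \<subseteq> X + closed_segment 0 (t *\<^sub>R u)"
  proof
    fix x assume "x \<in> X \<union> ?Y"
    thus "x \<in> X + closed_segment 0 (t *\<^sub>R u)"
    proof
      assume "x \<in> X"
      hence "x + 0 \<in> X + closed_segment 0 (t *\<^sub>R u)" by (intro set_plus_intro) auto
      thus ?thesis by simp
    next
      assume "x \<in> ?Y"
      then obtain y where "y \<in> X" "x = y + t *\<^sub>R u" by (auto simp: add.commute)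
      thus ?thesis by (auto intro!: set_plus_intro)
    qed
  qed
  have "(\<lambda>x. t *\<^sub>R u + x) ` (X \<inter> (\<lambda>y. y - t *\<^sub>R u) ` X) = X \<inter> ?Y"
    by (simp add: image_Int image_image Int_commute)
  moreover have "compact (X \<inter> (\<lambda>y. y - t *\<^sub>R u) ` X)"
    using compact_translation[OF X_compact_convex(1), of "- t *\<^sub>R u"] X_compact_convex by (intro compact_Int) (auto simp: add.commute)
  ultimately have int: "measure lborel (X \<inter> ?Y) = measure lborel (X \<inter> (\<lambda>y. y - t *\<^sub>R u) ` X)"
    using measure_translate by metis
  have "measure lebesgue (X \<union> ?Y) = measure lebesgue X + measure lebesgue ?Y - measure lebesgue (X \<inter> ?Y)"
    using lmeasurable_compact[OF X_compact_convex(1)] lmeasurable_compact[OF cY] by (rule measure_Un3)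
  hence "measure lborel (X \<union> ?Y) = measure lborel X + measure lborel ?Y - measure lborel (X \<inter> ?Y)"
    using X_compact_convex cY compact_Un[OF X_compact_convex(1) cY] compact_Int[OF X_compact_convex(1) cY] by (simp add: borel_compact)
  also have "measure lborel ?Y = measure lborel X" by (rule measure_translate[OF X_compact_convex(1)])
  finally have "2 * measure lborel X - measure lborel (X \<inter> ?Y) = measure lborel (X \<union> ?Y)" by simp
  also have "\<dots> \<le> measure lborel (X + closed_segment 0 (t *\<^sub>R u))"
    using sub by (intro measure_mono_compact compact_Un X_compact_convex cY compact_set_plus compact_segment)
  finally show ?thesis using volume_plus_segment[OF assms] int by simp
qed

end

section \<open>Longest chords\<close>

text \<open>The (n-1)-dimensional inequality for shadows is extracted from the n-dimensional one for
  long prisms. Segments of lengths T alpha and T c beta make the prism volumes at least T alpha^n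
  and T (c beta)^n, whose n-th roots add up to T^(1/n) (alpha + c beta); then T tends to
  infinity.\<close>

lemma shadow_brunn_minkowski:
  fixes X Y :: "(real^'n) set" and u :: "real^'n"
  assumes n: "CARD('n) \<ge> 2" and X: "convex_body X" and Y: "convex_body Y"
    and \<alpha>: "\<alpha> > 0" "CARD('n) * mixed_volume1 X (closed_segment 0 u) = \<alpha> ^ (CARD('n) - 1)"
    and \<beta>: "\<beta> > 0" "CARD('n) * mixed_volume1 Y (closed_segment 0 u) = \<beta> ^ (CARD('n) - 1)"
    and c: "c > 0"
  shows "(\<alpha> + c * \<beta>) ^ (CARD('n) - 1) \<le>
    CARD('n) * mixed_volume1 (X + (\<lambda>x. c *\<^sub>R x) ` Y) (closed_segment 0 u)"
proof -
  let ?n = "CARD('n)"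
  define Z where "Z = X + (\<lambda>x. c *\<^sub>R x) ` Y"
  define R where "R = CARD('n) * mixed_volume1 Z (closed_segment 0 u)"
  define q where "q = \<alpha> + c * \<beta>"
  have q: "q > 0" using \<alpha> \<beta> c by (simp add: q_def add_pos_pos)
  have Z: "convex_body Z" unfolding Z_def by (intro convex_body_add convex_body_scaleR X Y)
  have comp: "compact X" "compact Y" using X Y by (auto simp: convex_body_def)
  have pow: "a ^ (?n - 1) * a = a ^ ?n" for a :: real
    by (rule power_minus_mult) simp
  have main: "T * q ^ ?n \<le> measure lborel Z + T * q * R" if T: "T > 0" for T
  proof -
    let ?X = "X + closed_segment 0 ((T * \<alpha>) *\<^sub>R u)"
    let ?Y' = "Y + closed_segment 0 ((T * \<beta>) *\<^sub>R u)"
    let ?Y = "(\<lambda>x. c *\<^sub>R x) ` ?Y'"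
    have bodies: "convex_body ?X" "convex_body ?Y'" "convex_body ?Y"
      by (intro convex_body_add convex_body_scaleR X Y convex_body_segment)+
    have "T * \<alpha> ^ ?n \<le> measure lborel ?X"
      using volume_plus_segment[OF X, of "T * \<alpha>" u] T \<alpha> pow[of \<alpha>] by (simp add: mult_ac)
    hence X': "T * \<alpha> ^ ?n \<le> measure lborel ?X" "measure lborel ?X > 0"
      using T \<alpha> by (auto intro: less_le_trans[of _ "T * \<alpha> ^ ?n"])
    have "T * \<beta> ^ ?n \<le> measure lborel ?Y'"
      using volume_plus_segment[OF Y, of "T * \<beta>" u] T \<beta> pow[of \<beta>] by (simp add: mult_ac)
    moreover have "measure lborel ?Y = c ^ ?n * measure lborel ?Y'"
      using measure_scaleR[of ?Y' c] bodies(2) c by (simp add: convex_body_def)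
    ultimately have "T * (c * \<beta>) ^ ?n \<le> measure lborel ?Y"
      using c by (simp add: power_mult_distrib mult_ac)
    hence Y': "T * (c * \<beta>) ^ ?n \<le> measure lborel ?Y" "measure lborel ?Y > 0"
      using T \<beta> c by (auto intro: less_le_trans[of _ "T * (c * \<beta>) ^ ?n"])
    have seg: "?Y = (\<lambda>x. c *\<^sub>R x) ` Y + closed_segment 0 ((T * (c * \<beta>)) *\<^sub>R u)"
    proof -
      have "?Y = (\<lambda>x. c *\<^sub>R x) ` Y + (\<lambda>x. c *\<^sub>R x) ` closed_segment 0 ((T * \<beta>) *\<^sub>R u)"
        by (force simp: set_plus_def image_iff scaleR_add_right)
      thus ?thesis by (simp add: scaleR_closed_segment mult_ac)
    qed
    have "closed_segment 0 ((T * \<alpha>) *\<^sub>R u) + closed_segment 0 ((T * (c * \<beta>)) *\<^sub>R u) = closed_segment 0 ((T * q) *\<^sub>R u)"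
      using scaleR_add_image[of "closed_segment 0 u" "T * \<alpha>" "T * (c * \<beta>)"] T \<alpha> \<beta> c
      by (simp add: scaleR_closed_segment q_def distrib_left)
    hence "?X + ?Y = Z + closed_segment 0 ((T * q) *\<^sub>R u)"
      unfolding seg Z_def by (metis (no_types, lifting) add.assoc add.commute)
    hence sum: "measure lborel (?X + ?Y) = measure lborel Z + T * q * R"
      using volume_plus_segment[OF Z, of "T * q" u] T q by (simp add: R_def)
    have "T powr (1 / ?n) * q = (T * \<alpha> ^ ?n) powr (1 / ?n) + (T * (c * \<beta>) ^ ?n) powr (1 / ?n)"
    proof -
      have "(T * a ^ ?n) powr (1 / ?n) = T powr (1 / ?n) * a" if "a > 0" for a
        using T that by (simp add: powr_mult powr_powr flip: powr_realpow)
      thus ?thesis using \<alpha> \<beta> c by (simp add: q_def distrib_left)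
    qed
    also have "\<dots> \<le> measure lborel ?X powr (1 / ?n) + measure lborel ?Y powr (1 / ?n)"
      using X' Y' T \<alpha> \<beta> c by (intro add_mono powr_mono2) auto
    also have "\<dots> \<le> measure lborel (?X + ?Y) powr (1 / ?n)"
      using brunn_minkowski[OF bodies(1,3)] X'(2) Y'(2) measure_pos_iff_interior[of ?X] measure_pos_iff_interior[of ?Y] bodies
      by (simp add: convex_body_def)
    finally have "(T powr (1 / ?n) * q) ^ ?n \<le> (measure lborel (?X + ?Y) powr (1 / ?n)) ^ ?n"
      using T q by (intro power_mono) auto
    moreover have "(T powr (1 / ?n) * q) ^ ?n = T * q ^ ?n"
      using T by (simp add: power_mult_distrib powr_realpow[symmetric] powr_powr)
    moreover have "(v powr (1 / ?n)) ^ ?n = v" if "v \<ge> 0" for v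
      using that by (cases "v = 0") (simp_all add: powr_realpow[symmetric] powr_powr)
    ultimately show ?thesis by (simp add: sum[symmetric])
  qed
  have "q ^ ?n \<le> q * R"
  proof (rule ccontr)
    assume "\<not> q ^ ?n \<le> q * R"
    hence d: "q ^ ?n - q * R > 0" by simp
    \<comment> \<open>Large enough for the terms linear in T to outweigh the volume of Z.\<close>
    define T where "T = (measure lborel Z + 1) / (q ^ ?n - q * R)"
    have T: "T > 0" using d by (simp add: T_def add_nonneg_pos)
    have "T * (q ^ ?n - q * R) = measure lborel Z + 1" using d by (simp add: T_def)
    thus False using main[OF T] by (simp add: algebra_simps)
  qed
  hence "q ^ (?n - 1) * q \<le> R * q" unfolding pow by (simp add: mult.commute)
  thus ?thesis using q by (simp add: R_def Z_def q_def)
qed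

text \<open>Both sides of \<open>shadow_brunn_minkowski\<close> agree at c = 0, so their slopes
  there are ordered.\<close>

lemma shadow_minkowski:
  fixes X Y :: "(real^'n) set" and u :: "real^'n"
  assumes n: "CARD('n) \<ge> 2" and X: "convex_body X" and Y: "convex_body Y"
    and \<alpha>: "\<alpha> > 0" "CARD('n) * mixed_volume1 X (closed_segment 0 u) = \<alpha> ^ (CARD('n) - 1)"
    and \<beta>: "\<beta> > 0" "CARD('n) * mixed_volume1 Y (closed_segment 0 u) = \<beta> ^ (CARD('n) - 1)"
  shows "\<alpha> ^ (CARD('n) - 2) * \<beta> \<le> CARD('n) * mixed_volume2 (closed_segment 0 u) Y X"
proof -
  let ?n = "CARD('n)"
  have "real (?n - 1) * (\<alpha> ^ (?n - 2) * \<beta>) \<le> ?n * (real (?n - 1) * mixed_volume2 (closed_segment 0 u) Y X)"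
  proof (rule right_slope_mono)
    show "right_slope (\<lambda>b. (\<alpha> + b * \<beta>) ^ (?n - 1)) (real (?n - 1) * (\<alpha> ^ (?n - 2) * \<beta>))"
      by (rule right_slope_DERIV) (auto intro!: derivative_eq_intros simp: numeral_2_eq_2)
    show "right_slope (\<lambda>b. ?n * mixed_volume1 (X + (\<lambda>x. b *\<^sub>R x) ` Y) (closed_segment 0 u))
        (?n * (real (?n - 1) * mixed_volume2 (closed_segment 0 u) Y X))"
      by (rule right_slope_scale[OF right_slope_mixed_volume1[OF X convex_body_segment Y]])
    have "(\<lambda>x. 0 *\<^sub>R x) ` Y = 0" using Y by (auto simp: convex_body_def)
    thus "(\<alpha> + 0 * \<beta>) ^ (?n - 1) = ?n * mixed_volume1 (X + (\<lambda>x. 0 *\<^sub>R x) ` Y) (closed_segment 0 u)"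
      using \<alpha> by simp
    show "(\<alpha> + t * \<beta>) ^ (?n - 1) \<le> ?n * mixed_volume1 (X + (\<lambda>x. t *\<^sub>R x) ` Y) (closed_segment 0 u)" if "t > 0" for t
      by (rule shadow_brunn_minkowski[OF assms that])
  qed
  hence "real (?n - 1) * (\<alpha> ^ (?n - 2) * \<beta>) \<le> real (?n - 1) * (?n * mixed_volume2 (closed_segment 0 u) Y X)"
    by (simp add: mult_ac)
  thus ?thesis using n by (subst (asm) mult_le_cancel_left_pos) auto
qed

section \<open>Chords and slices of a single body\<close>

lemma mem_minus_image: "x \<in> (\<lambda>y. y - v) ` S \<longleftrightarrow> x + v \<in> (S :: 'a::ab_group_add set)"
  by (auto intro!: image_eqI[where x = "x + v"])

context
  fixes K :: "(real^'n) set" and u :: "real^'n"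
  assumes K: "full_dim_convex_body K" and u: "norm u = 1"
begin

private lemma K_body: "convex_body K" "compact K" "convex K" "K \<noteq> {}" "interior K \<noteq> {}"
  using K by (auto simp: full_dim_convex_body_def convex_body_def)

private abbreviation (input) "chords \<equiv> {norm (b - a) | a b. closed_segment a b \<subseteq> K \<and> (\<exists>t. b - a = t *\<^sub>R u)}"

lemma bdd_above_chords: "bdd_above chords"
proof -
  obtain R where R: "\<And>x. x \<in> K \<Longrightarrow> norm x \<le> R" using compact_imp_bounded[OF K_body(2)] by (metis bounded_iff)
  have "norm (b - a) \<le> R + R" if "closed_segment a b \<subseteq> K" for a b
  proof -
    have "norm a \<le> R" "norm b \<le> R" using R that by auto
    thus ?thesis using norm_triangle_ineq4[of b a] by linarith
  qed
  thus ?thesis by (intro bdd_aboveI[of _ "R + R"]) auto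
qed

lemma le_longest_chord:
  assumes "p \<in> K" "p + s *\<^sub>R u \<in> K" "s \<ge> 0"
  shows "s \<le> longest_chord K u"
proof -
  have "closed_segment p (p + s *\<^sub>R u) \<subseteq> K" using assms K_body(3) by (intro closed_segment_subset) auto
  hence "s \<in> chords" using assms(3) u by (intro CollectI exI[of _ p] exI[of _ "p + s *\<^sub>R u"]) auto
  thus ?thesis unfolding longest_chord_def by (intro cSup_upper bdd_above_chords)
qed

lemma chord_below_longest:
  assumes "s < longest_chord K u" "s \<ge> 0"
  shows "\<exists>p. p \<in> K \<and> p + s *\<^sub>R u \<in> K"
proof -
  obtain p0 where "p0 \<in> K" using K_body by blast
  hence "norm (p0 - p0) \<in> chords" by (intro CollectI exI[of _ p0]) (auto intro!: exI[of _ 0])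
  hence "chords \<noteq> {}" by blast
  then obtain a b t where ab: "closed_segment a b \<subseteq> K" "b - a = t *\<^sub>R u" "s < norm (b - a)"
    using assms(1) less_cSup_iff[OF _ bdd_above_chords] unfolding longest_chord_def by auto
  have K': "a \<in> K" "b \<in> K" using ab(1) by auto
  have main: "\<exists>p. p \<in> K \<and> p + s *\<^sub>R u \<in> K" if p: "p \<in> K" "p + r *\<^sub>R u \<in> K" "s < r" for p r
  proof -
    have "p + s *\<^sub>R u = (1 - s / r) *\<^sub>R p + (s / r) *\<^sub>R (p + r *\<^sub>R u)"
      using p assms(2) by (simp add: algebra_simps)
    also have "\<dots> \<in> K" using p assms(2) by (intro convexD[OF K_body(3)]) auto
    finally show ?thesis using p(1) by blast
  qed
  have st: "s < \<bar>t\<bar>" using ab(2,3) u by simp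
  show ?thesis
  proof (cases "t \<ge> 0")
    case True
    have "b = a + t *\<^sub>R u" using ab(2) by (simp add: algebra_simps)
    thus ?thesis using main[of a t] K' st True by simp
  next
    case False
    have "a = b + (- t) *\<^sub>R u" using ab(2) by (simp add: algebra_simps)
    thus ?thesis using main[of b "- t"] K' st False by simp
  qed
qed

lemma longest_chord_pos: "longest_chord K u > 0"
proof -
  obtain c e where e: "e > 0" "cball c e \<subseteq> K" using K_body(5) mem_interior_cball by blast
  have "c + e *\<^sub>R u \<in> K" "c \<in> K" using e u by (auto simp: dist_norm)
  hence "e \<le> longest_chord K u" using e by (intro le_longest_chord[of c]) auto
  thus ?thesis using e by simp
qed

lemma longest_chord_leI:
  assumes "\<And>p s. s \<ge> 0 \<Longrightarrow> p \<in> K \<Longrightarrow> p + s *\<^sub>R u \<in> K \<Longrightarrow> s \<le> B"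
  shows "longest_chord K u \<le> B"
proof (rule ccontr)
  assume "\<not> longest_chord K u \<le> B"
  hence lt: "(max 0 B + longest_chord K u) / 2 < longest_chord K u" "B < (max 0 B + longest_chord K u) / 2"
    using longest_chord_pos by auto
  have nn: "(max 0 B + longest_chord K u) / 2 \<ge> 0" using longest_chord_pos by auto
  show False using chord_below_longest[OF lt(1) nn] assms[OF nn] lt(2) by fastforce
qed

private abbreviation (input) "V \<equiv> measure lborel K"
private abbreviation (input) "A \<equiv> mixed_volume1 K (closed_segment 0 u)"
private abbreviation (input) "L \<equiv> \<lambda>s. K \<inter> (\<lambda>y. y - s *\<^sub>R u) ` K"

private lemma V_pos: "V > 0" using measure_pos_iff_interior K_body by blast

lemma mem_chord_slice: "x \<in> L s \<longleftrightarrow> x \<in> K \<and> x + s *\<^sub>R u \<in> K"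
  by (simp add: mem_minus_image)

text \<open>A translate of K by more than the longest chord misses K, so
  \<open>volume_minus_translate_le\<close> bounds the full volume of K by a multiple of this mixed
  volume.\<close>

lemma segment_mixed_volume_pos: "A > 0"
proof -
  define t where "t = longest_chord K u + 1"
  have t: "t > 0" "t > longest_chord K u" using longest_chord_pos by (auto simp: t_def)
  have "L t = {}" using le_longest_chord[of _ t] t by (force simp: mem_chord_slice set_eq_iff)
  hence "V \<le> t * (CARD('n) * A)"
    using volume_minus_translate_le[OF K_body(1), of t u] t by simp
  hence "0 < t * (CARD('n) * A)" using V_pos by linarith
  thus ?thesis using t by (simp add: zero_less_mult_iff)
qed

text \<open>A chord of length s is a translate of s [0, u] inside K, and monotonicity compares its
  mixed volume s A with that of K itself.\<close>

lemma longest_chord_le: "longest_chord K u * A \<le> V"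
proof -
  have "longest_chord K u \<le> V / A"
  proof (rule longest_chord_leI)
    fix p s assume s: "s \<ge> (0::real)" "p \<in> K" "p + s *\<^sub>R u \<in> K"
    have "(\<lambda>x. p + s *\<^sub>R x) ` closed_segment 0 u = (\<lambda>x. p + x) ` closed_segment 0 (s *\<^sub>R u)"
      by (simp add: scaleR_closed_segment[symmetric] image_image)
    also have "\<dots> = closed_segment p (p + s *\<^sub>R u)"
      using closed_segment_translation[of p 0 "s *\<^sub>R u"] by simp
    also have "\<dots> \<subseteq> K" using s K_body(3) by (intro closed_segment_subset) auto
    finally have "mixed_volume1 K ((\<lambda>x. p + s *\<^sub>R x) ` closed_segment 0 u) \<le> mixed_volume1 K K"
      using convex_body_translate[OF convex_body_scaleR[OF convex_body_segment]]
      by (intro mixed_volume1_mono K_body) (auto simp: image_image[symmetric])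
    hence "s * A \<le> V"
      using s by (simp add: mixed_volume1_homothety[OF K_body(1) convex_body_segment] mixed_volume1_self[OF K_body(1)])
    thus "s \<le> V / A" using segment_mixed_volume_pos by (simp add: pos_le_divide_eq)
  qed
  thus ?thesis using segment_mixed_volume_pos by (simp add: pos_le_divide_eq)
qed

lemma longest_chord_eqI:
  assumes "V \<le> longest_chord K u * A"
  shows "longest_chord K u = V / A"
  using assms longest_chord_le segment_mixed_volume_pos by (simp add: eq_divide_eq)

text \<open>For M = [0, u] + eB with the unit ball B, the mixed volume is A + e b, and every
  homothet z + tM in K contains a chord of length t. So V / (A + e b) is at most the longest chord,
  and e tends to 0.\<close>

lemma longest_chord_if_relative_inradius:
  assumes "\<And>M. full_dim_convex_body M \<Longrightarrow> relative_inradius K M = V / mixed_volume1 K M"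
  shows "longest_chord K u = V / A"
proof (rule longest_chord_eqI)
  let ?l = "longest_chord K u" and ?B = "cball (0::real^'n) 1"
  define b where "b = mixed_volume1 K ?B"
  have ball: "convex_body ?B" by (simp add: convex_body_def)
  have b: "b \<ge> 0" unfolding b_def by (rule mixed_volume1_nonneg[OF K_body(1) ball])
  have le: "V \<le> ?l * (A + e * b)" if e: "e > 0" for e
  proof -
    let ?M = "closed_segment 0 u + (\<lambda>x. e *\<^sub>R x) ` ?B"
    have M: "convex_body ?M" by (intro convex_body_add convex_body_scaleR convex_body_segment ball)
    have sub: "(\<lambda>x. e *\<^sub>R x) ` ?B \<subseteq> ?M" by (intro set_zero_plus2) simp
    have "ball 0 e \<subseteq> (\<lambda>x. e *\<^sub>R x) ` ?B"
    proof
      fix x :: "real^'n" assume "x \<in> ball 0 e"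
      hence "x = e *\<^sub>R (inverse e *\<^sub>R x)" "inverse e *\<^sub>R x \<in> ?B" using e by (auto simp: dist_norm field_simps)
      thus "x \<in> (\<lambda>x. e *\<^sub>R x) ` ?B" by blast
    qed
    hence "ball 0 e \<subseteq> interior ?M" using sub by (intro interior_maximal) auto
    hence "interior ?M \<noteq> {}" using e centre_in_ball[of 0 e] by blast
    with M have "full_dim_convex_body ?M" by (simp add: full_dim_convex_body_def)
    hence r: "relative_inradius K ?M = V / (A + e * b)"
      using assms[of ?M] mixed_volume1_linear[OF K_body(1) ball convex_body_segment, of e 0 u] e by (simp add: b_def)
    have pos: "A + e * b > 0" using segment_mixed_volume_pos e b by (simp add: add_pos_nonneg)
    have "relative_inradius K ?M \<le> ?l"
      unfolding relative_inradius_def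
    proof (rule cSup_least)
      obtain z where "z \<in> K" using K_body by blast
      moreover have "?M \<noteq> {}" using M by (simp add: convex_body_def)
      ultimately have "0 \<in> {t. 0 \<le> t \<and> (\<exists>z. (\<lambda>y. z + t *\<^sub>R y) ` ?M \<subseteq> K)}" by (auto intro!: exI[of _ z])
      thus "{t. 0 \<le> t \<and> (\<exists>z. (\<lambda>y. z + t *\<^sub>R y) ` ?M \<subseteq> K)} \<noteq> {}" by blast
      fix t assume "t \<in> {t. 0 \<le> t \<and> (\<exists>z. (\<lambda>y. z + t *\<^sub>R y) ` ?M \<subseteq> K)}"
      then obtain z where t: "0 \<le> t" "(\<lambda>y. z + t *\<^sub>R y) ` ?M \<subseteq> K" by blast
      have "0 + 0 \<in> ?M" "u + 0 \<in> ?M" by (intro set_plus_intro; force)+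
      hence "z \<in> K" "z + t *\<^sub>R u \<in> K" using t(2) by (force simp: image_subset_iff)+
      thus "t \<le> ?l" by (rule le_longest_chord[OF _ _ t(1)])
    qed
    thus ?thesis unfolding r using pos by (simp add: divide_le_eq)
  qed
  show "V \<le> ?l * A"
  proof (rule field_le_epsilon)
    fix d :: real assume d: "d > 0"
    \<comment> \<open>Makes the error \<open>?l * b * e\<close> at most d; the summand 1 covers the
      case that b vanishes.\<close>
    define e where "e = d / (?l * b + 1)"
    have "?l * b \<ge> 0" using longest_chord_pos b by simp
    hence e: "e > 0" using d by (simp add: e_def add_nonneg_pos)
    have "V \<le> ?l * A + (?l * b) * e" using le[OF e] by (simp add: algebra_simps)
    also have "(?l * b) * e \<le> d" using d \<open>?l * b \<ge> 0\<close> by (simp add: e_def divide_le_eq mult.commute)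
    finally show "V \<le> ?l * A + d" by simp
  qed
qed

lemma chord_slice_body: "0 \<le> s \<Longrightarrow> s < longest_chord K u \<Longrightarrow> convex_body (L s)"
proof -
  assume s: "0 \<le> s" "s < longest_chord K u"
  have "compact ((\<lambda>y. y - s *\<^sub>R u) ` K)" "convex ((\<lambda>y. y - s *\<^sub>R u) ` K)"
    using compact_translation[OF K_body(2), of "- s *\<^sub>R u"] convex_translation[OF K_body(3), of "- s *\<^sub>R u"]
    by (auto simp: add.commute)
  moreover have "L s \<noteq> {}" using chord_below_longest[OF s(2,1)] mem_chord_slice by blast
  ultimately show ?thesis using K_body by (auto simp: convex_body_def compact_Int convex_Int)
qed

text \<open>By convexity the points between x and x + (s + t)u belong to K as soon as these two do.
  So slicing a slice yields a slice, and \<open>volume_minus_translate_le\<close> can be applied at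
  every s.\<close>

lemma chord_slice_translate: "0 \<le> s \<Longrightarrow> 0 \<le> t \<Longrightarrow> L s \<inter> (\<lambda>y. y - t *\<^sub>R u) ` L s = L (s + t)"
proof -
  assume st: "0 \<le> s" "0 \<le> t"
  have *: "x \<in> L s \<inter> (\<lambda>y. y - t *\<^sub>R u) ` L s \<longleftrightarrow> x \<in> K \<and> x + s *\<^sub>R u \<in> K \<and> x + t *\<^sub>R u \<in> K \<and> x + (t + s) *\<^sub>R u \<in> K" for x
    unfolding Int_iff mem_minus_image by (auto simp: algebra_simps)
  have between: "x + a *\<^sub>R u \<in> K" if x: "x \<in> K" "x + b *\<^sub>R u \<in> K" "0 \<le> a" "a \<le> b" for x a b
  proof (cases "b = 0")
    case False
    have "x + a *\<^sub>R u = (1 - a / b) *\<^sub>R x + (a / b) *\<^sub>R (x + b *\<^sub>R u)"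
      using False by (simp add: algebra_simps)
    also have "\<dots> \<in> K" using x False by (intro convexD[OF K_body(3)]) auto
    finally show ?thesis .
  qed (use x in auto)
  have "x \<in> L s \<inter> (\<lambda>y. y - t *\<^sub>R u) ` L s \<longleftrightarrow> x \<in> L (s + t)" for x
    unfolding * mem_chord_slice using between[of x "t + s" s] between[of x "t + s" t] st by (auto simp: add.commute)
  thus ?thesis by blast
qed

text \<open>Makes (iii) available for x = su. A chord longer than s puts a larger multiple of u into
  the difference body, and shrinking that multiple towards the interior point 0 gives an interior
  point.\<close>

lemma mem_interior_difference_body:
  assumes "0 < s" "s < longest_chord K u"
  shows "s *\<^sub>R u \<in> interior (K + uminus ` K)"
proof -
  let ?D = "K + uminus ` K"
  define r where "r = (s + longest_chord K u) / 2"
  have r: "s < r" "r < longest_chord K u" "0 < r" using assms by (auto simp: r_def)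
  obtain p where p: "p \<in> K" "p + r *\<^sub>R u \<in> K" using chord_below_longest[OF r(2)] r by auto
  have "(p + r *\<^sub>R u) + (- p) \<in> ?D" using p by (intro set_plus_intro) auto
  hence ru: "r *\<^sub>R u \<in> ?D" by simp
  have conv: "convex ?D" using K_body by (intro convex_set_plus convex_negations)
  obtain c e where e: "e > 0" "cball c e \<subseteq> K" using K_body(5) mem_interior_cball by blast
  have "ball 0 e \<subseteq> ?D"
  proof
    fix v :: "real^'n" assume "v \<in> ball 0 e"
    hence "c + v \<in> K" "c \<in> K" using e by (auto simp: dist_norm)
    hence "(c + v) + (- c) \<in> ?D" by (intro set_plus_intro) auto
    thus "v \<in> ?D" by simp
  qed
  hence "0 \<in> interior ?D" using e(1) by (meson centre_in_ball interior_maximal open_ball subsetD)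
  hence "r *\<^sub>R u - (1 - s / r) *\<^sub>R (r *\<^sub>R u - 0) \<in> interior ?D"
    using r assms by (intro mem_interior_convex_shrink conv ru) auto
  thus ?thesis using r by (simp add: algebra_simps)
qed

lemma shadow_decay:
  assumes n: "CARD('n) \<ge> 2" and s: "0 \<le> s" "s < longest_chord K u"
    and ineq: "\<And>x. x \<noteq> 0 \<Longrightarrow> x \<in> interior (K + uminus ` K) \<Longrightarrow>
      mixed_volume_ineq K (closed_segment 0 x) (K \<inter> (\<lambda>y. y - x) ` K)"
  shows "mixed_volume1 (L s) (closed_segment 0 u) \<le> A * (1 - s * (A / V)) ^ (CARD('n) - 1)"
proof (cases "s = 0 \<or> mixed_volume1 (L s) (closed_segment 0 u) = 0")
  case True
  have "s * A \<le> longest_chord K u * A" using s segment_mixed_volume_pos by (intro mult_right_mono) auto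
  hence "s * A \<le> V" using longest_chord_le by linarith
  hence "0 \<le> 1 - s * (A / V)" using V_pos by (simp add: divide_le_eq)
  thus ?thesis using True segment_mixed_volume_pos by (auto intro!: mult_nonneg_nonneg)
next
  case False
  hence s0: "s > 0" using s by simp
  let ?n = "CARD('n)"
  have Lb: "convex_body (L s)" by (rule chord_slice_body[OF s])
  define Q where "Q = ?n * mixed_volume1 (L s) (closed_segment 0 u)"
  have Q: "Q > 0"
    using False mixed_volume1_nonneg[OF Lb convex_body_segment, of 0 u] by (simp add: Q_def less_le)
  have P: "?n * A > 0" using segment_mixed_volume_pos by simp
  \<comment> \<open>With the (n-1)-th roots of the two shadow volumes, Minkowski's inequality
    becomes linear in \<open>\<beta>\<close>.\<close>
  define \<alpha> \<beta> where "\<alpha> = (?n * A) powr (1 / real (?n - 1))" and "\<beta> = Q powr (1 / real (?n - 1))"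
  have root: "(x powr (1 / real (?n - 1))) ^ (?n - 1) = x" if "x > 0" for x
    using that n by (simp add: powr_realpow[symmetric] powr_powr del: of_nat_diff)
  have ab: "\<alpha> > 0" "?n * A = \<alpha> ^ (?n - 1)" "\<beta> > 0" "Q = \<beta> ^ (?n - 1)"
    using P Q root by (auto simp: \<alpha>_def \<beta>_def)
  define U where "U = mixed_volume2 (closed_segment 0 u) (L s) K"
  have mink: "\<alpha> ^ (?n - 2) * \<beta> \<le> ?n * U"
    unfolding U_def by (rule shadow_minkowski[OF n K_body(1) Lb ab(1,2,3)]) (use ab(4) Q_def in simp)
  have seg: "closed_segment 0 (s *\<^sub>R u) = (\<lambda>x. 0 + s *\<^sub>R x) ` closed_segment 0 u"
    by (simp add: scaleR_closed_segment)
  have "mixed_volume_ineq K (closed_segment 0 (s *\<^sub>R u)) (L s)"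
    using s0 u by (intro ineq mem_interior_difference_body s) auto
  hence "V * mixed_volume2 (closed_segment 0 (s *\<^sub>R u)) (L s) K \<le>
      mixed_volume1 K (closed_segment 0 (s *\<^sub>R u)) * mixed_volume1 K (L s)"
    unfolding mixed_volume_ineq_def mixed_volume1_def mixed_volume2_def by simp
  hence "V * (s * U) \<le> s * A * mixed_volume1 K (L s)"
    unfolding seg using mixed_volume2_homothety[OF n K_body(1) convex_body_segment Lb s(1), where z = 0]
      mixed_volume1_homothety[OF K_body(1) convex_body_segment s(1), where z = 0] by (simp add: U_def)
  hence "V * U \<le> A * mixed_volume1 K (L s)" using s0 by (simp add: mult.left_commute)
  also have "mixed_volume1 K (L s) \<le> V - s * A"
  proof -
    have "L s + (\<lambda>x. s *\<^sub>R x) ` closed_segment 0 u \<subseteq> K"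
    proof
      fix x assume "x \<in> L s + (\<lambda>x. s *\<^sub>R x) ` closed_segment 0 u"
      then obtain y v where y: "y \<in> L s" "v \<in> closed_segment 0 (s *\<^sub>R u)" "x = y + v"
        unfolding scaleR_closed_segment by (rule set_plus_elim)
      have "closed_segment y (y + s *\<^sub>R u) \<subseteq> K" using y(1) mem_chord_slice K_body(3) by (intro closed_segment_subset) auto
      moreover have "x \<in> closed_segment y (y + s *\<^sub>R u)"
        using y closed_segment_translation[of y 0 "s *\<^sub>R u"] by auto
      ultimately show "x \<in> K" by blast
    qed
    hence "mixed_volume1 K (L s + (\<lambda>x. s *\<^sub>R x) ` closed_segment 0 u) \<le> mixed_volume1 K K"
      using Lb by (intro mixed_volume1_mono K_body convex_body_add convex_body_scaleR convex_body_segment)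
    thus ?thesis
      using mixed_volume1_linear[OF K_body(1) convex_body_segment Lb s(1), of 0 u] mixed_volume1_self[OF K_body(1)] by simp
  qed
  hence "A * mixed_volume1 K (L s) \<le> A * (V - s * A)" using segment_mixed_volume_pos by (intro mult_left_mono) auto
  finally have "V * U \<le> A * (V - s * A)" .
  hence "?n * (V * U) \<le> ?n * (A * (V - s * A))" by (intro mult_left_mono) auto
  moreover have "V * (\<alpha> ^ (?n - 2) * \<beta>) \<le> V * (?n * U)" using mink V_pos by (intro mult_left_mono) auto
  moreover have "V * (?n * U) = ?n * (V * U)" by simp
  ultimately have "V * (\<alpha> ^ (?n - 2) * \<beta>) \<le> ?n * (A * (V - s * A))" by linarith
  also have "\<dots> = \<alpha> ^ (?n - 1) * (V - s * A)" using ab(2) by (simp add: mult.assoc[symmetric])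
  also have "\<alpha> ^ (?n - 1) = \<alpha> ^ (?n - 2) * \<alpha>"
    using n by (metis Suc_1 Suc_diff_Suc Suc_le_lessD power_Suc2)
  finally have "\<alpha> ^ (?n - 2) * (V * \<beta>) \<le> \<alpha> ^ (?n - 2) * (\<alpha> * (V - s * A))" by (simp add: mult_ac)
  hence "V * \<beta> \<le> \<alpha> * (V - s * A)" using ab(1) by simp
  hence "\<beta> \<le> \<alpha> * (1 - s * (A / V))" using V_pos by (simp add: field_simps)
  hence "\<beta> ^ (?n - 1) \<le> (\<alpha> * (1 - s * (A / V))) ^ (?n - 1)" using ab(3) by (intro power_mono) auto
  hence "?n * mixed_volume1 (L s) (closed_segment 0 u) \<le> ?n * (A * (1 - s * (A / V)) ^ (?n - 1))"
    unfolding power_mult_distrib ab(2)[symmetric] ab(4)[symmetric] by (simp only: Q_def mult.assoc)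
  thus ?thesis by simp
qed

end

section \<open>From (iii) to the longest chord\<close>

lemma power_diff_ge:
  fixes a b :: real
  assumes "0 \<le> b" "b \<le> a"
  shows "real n * (a - b) * b ^ (n - 1) \<le> a ^ n - b ^ n"
proof (induction n)
  case (Suc n)
  have "real (Suc n) * (a - b) * b ^ (Suc n - 1) = b * (real n * (a - b) * b ^ (n - 1)) + (a - b) * b ^ n"
    by (cases n) (auto simp: algebra_simps)
  also have "\<dots> \<le> a * (a ^ n - b ^ n) + (a - b) * b ^ n"
    using Suc assms by (intro add_right_mono mult_mono) (auto intro!: power_mono)
  also have "\<dots> = a ^ Suc n - b ^ Suc n" by (simp add: algebra_simps)
  finally show ?case .
qed simp

text \<open>Comparison with the solution $G(s) = V (1 - s \tau)^n$ of the limiting differential equation.\<close>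

lemma euler_comparison:
  fixes g :: "real \<Rightarrow> real"
  assumes g0: "g 0 = V" and V: "V \<ge> 0" and \<tau>: "\<tau> \<ge> 0" and s: "s \<ge> 0" "s * \<tau> \<le> 1"
    and step: "\<And>r t. 0 \<le> r \<Longrightarrow> 0 \<le> t \<Longrightarrow> r + t \<le> s \<Longrightarrow> g r - g (r + t) \<le> t * (real n * V * \<tau> * (1 - r * \<tau>) ^ (n - 1))"
  shows "g s \<ge> V * (1 - s * \<tau>) ^ n"
proof -
  define D where "D r = real n * V * \<tau> * (1 - r * \<tau>) ^ (n - 1)" for r
  have disc: "g s \<ge> V * (1 - s * \<tau>) ^ n - s * D 0 / real N" if N: "N > 0" for N
  proof -
    define t where "t = s / real N"
    have t: "t \<ge> 0" "real N * t = s" using s N by (auto simp: t_def)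
    \<comment> \<open>In one step g loses at most t times D at the left end, and the comparison
      function loses at least t times D at the right end. The resulting errors telescope.\<close>
    have "g (real k * t) - V * (1 - (real k * t) * \<tau>) ^ n \<ge> t * (D (real k * t) - D 0)" if "k \<le> N" for k
      using that
    proof (induction k)
      case (Suc k)
      let ?r = "real k * t"
      have r: "?r + t = real (Suc k) * t" by (simp add: algebra_simps)
      have "real (Suc k) * t \<le> real N * t" using Suc.prems t by (intro mult_right_mono) auto
      hence rs: "?r + t \<le> s" using t(2) r by simp
      hence "(?r + t) * \<tau> \<le> s * \<tau>" using \<tau> by (intro mult_right_mono)
      hence le1: "(?r + t) * \<tau> \<le> 1" using s by linarith
      have "g ?r - g (?r + t) \<le> t * D ?r"
        unfolding D_def by (rule step) (use t rs in auto)
      moreover have "t * D (?r + t) \<le> V * (1 - ?r * \<tau>) ^ n - V * (1 - (?r + t) * \<tau>) ^ n"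
      proof -
        have "real n * ((1 - ?r * \<tau>) - (1 - (?r + t) * \<tau>)) * (1 - (?r + t) * \<tau>) ^ (n - 1) \<le>
            (1 - ?r * \<tau>) ^ n - (1 - (?r + t) * \<tau>) ^ n"
          using le1 t \<tau> by (intro power_diff_ge) (auto simp: algebra_simps)
        hence "V * (real n * ((1 - ?r * \<tau>) - (1 - (?r + t) * \<tau>)) * (1 - (?r + t) * \<tau>) ^ (n - 1)) \<le>
            V * ((1 - ?r * \<tau>) ^ n - (1 - (?r + t) * \<tau>) ^ n)" using V by (rule mult_left_mono)
        thus ?thesis by (simp add: D_def algebra_simps)
      qed
      moreover have "t * (D ?r - D 0) \<le> g ?r - V * (1 - ?r * \<tau>) ^ n" using Suc by simp
      ultimately have "t * (D (?r + t) - D 0) \<le> g (?r + t) - V * (1 - (?r + t) * \<tau>) ^ n"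
        by (simp add: right_diff_distrib)
      thus ?case by (simp only: r)
    qed (simp add: g0)
    from this[of N] have "g s - V * (1 - s * \<tau>) ^ n \<ge> t * (D s - D 0)" using t by simp
    moreover have "t * D s \<ge> 0" using t V \<tau> s by (auto simp: D_def intro!: mult_nonneg_nonneg)
    ultimately show ?thesis by (simp add: t_def right_diff_distrib)
  qed
  have "(\<lambda>N. V * (1 - s * \<tau>) ^ n - (s * D 0) * inverse (real (Suc N))) \<longlonglongrightarrow> V * (1 - s * \<tau>) ^ n - (s * D 0) * 0"
    by (intro tendsto_intros LIMSEQ_inverse_real_of_nat)
  hence "V * (1 - s * \<tau>) ^ n - (s * D 0) * 0 \<le> g s"
    by (rule LIMSEQ_le_const2) (use disc[OF zero_less_Suc] in \<open>auto simp: divide_inverse\<close>)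
  thus ?thesis by simp
qed

text \<open>If the longest chord were shorter than 1 / tau, all slices up to it would have volume at
  least a fixed positive \<open>\<eta>\<close>. As the volume is lost at a bounded rate, some slice
  beyond the longest chord would still have positive volume.\<close>

lemma longest_chord_if_ineq:
  fixes K :: "(real^'n) set" and u :: "real^'n"
  assumes n: "CARD('n) \<ge> 2" and K: "full_dim_convex_body K" and u: "norm u = 1"
    and ineq: "\<And>x. x \<noteq> 0 \<Longrightarrow> x \<in> interior (K + uminus ` K) \<Longrightarrow>
      mixed_volume_ineq K (closed_segment 0 x) (K \<inter> (\<lambda>y. y - x) ` K)"
  shows "longest_chord K u = measure lborel K / mixed_volume1 K (closed_segment 0 u)"
proof (rule longest_chord_eqI[OF K u], rule ccontr)
  let ?V = "measure lborel K" and ?A = "mixed_volume1 K (closed_segment 0 u)" and ?l = "longest_chord K u"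
  let ?n = "CARD('n)"
  define L where "L s = K \<inter> (\<lambda>y. y - s *\<^sub>R u) ` K" for s
  define \<tau> where "\<tau> = ?A / ?V"
  assume "\<not> ?V \<le> ?l * ?A"
  hence lt: "?l * ?A < ?V" by simp
  have A: "?A > 0" by (rule segment_mixed_volume_pos[OF K u])
  have l: "?l > 0" by (rule longest_chord_pos[OF K u])
  have V: "?V > 0" using lt A l mult_pos_pos[OF l A] by linarith
  have \<tau>: "\<tau> > 0" "?l * \<tau> < 1" using A V lt by (auto simp: \<tau>_def divide_less_eq)
  have step: "measure lborel (L s) - measure lborel (L (s + t)) \<le> t * (real ?n * ?V * \<tau> * (1 - s * \<tau>) ^ (?n - 1))"
    if "0 \<le> s" "0 \<le> t" "s < ?l" for s t
  proof -
    have "measure lborel (L s) - measure lborel (L (s + t)) \<le> t * (?n * mixed_volume1 (L s) (closed_segment 0 u))"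
      using volume_minus_translate_le[OF chord_slice_body[OF K u that(1,3)] that(2), of u] chord_slice_translate[OF K u that(1,2)]
      by (simp add: L_def)
    also have "\<dots> \<le> t * (?n * (?A * (1 - s * (?A / ?V)) ^ (?n - 1)))"
      using shadow_decay[OF K u n that(1,3) ineq] that by (intro mult_left_mono) (auto simp: L_def)
    also have "\<dots> = t * (real ?n * ?V * \<tau> * (1 - s * \<tau>) ^ (?n - 1))"
      using V by (simp add: \<tau>_def)
    finally show ?thesis .
  qed
  define \<eta> where "\<eta> = ?V * (1 - ?l * \<tau>) ^ ?n"
  have \<eta>: "\<eta> > 0" using V \<tau> by (simp add: \<eta>_def)
  have vol: "measure lborel (L s) \<ge> \<eta>" if s: "0 \<le> s" "s < ?l" for s
  proof -
    have st: "s * \<tau> \<le> ?l * \<tau>" using s \<tau> by (intro mult_right_mono) auto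
    have "measure lborel (L 0) = ?V" by (simp add: L_def)
    moreover have "s * \<tau> \<le> 1" using st \<tau> by linarith
    ultimately have "measure lborel (L s) \<ge> ?V * (1 - s * \<tau>) ^ ?n"
      using s \<tau>(1) V by (intro euler_comparison[of "\<lambda>s. measure lborel (L s)"] step) auto
    moreover have "?V * (1 - s * \<tau>) ^ ?n \<ge> \<eta>"
      unfolding \<eta>_def using st \<tau> V by (intro mult_left_mono power_mono) auto
    ultimately show ?thesis by linarith
  qed
  \<comment> \<open>A step of this length loses at most half of \<open>\<eta>\<close>.\<close>
  define t where "t = \<eta> / (2 * (real ?n * ?V * \<tau>))"
  have nV: "real ?n * ?V * \<tau> > 0" using V \<tau> by simp
  have t: "t > 0" using \<eta> nV by (simp add: t_def)
  \<comment> \<open>Below the longest chord, but by less than t.\<close>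
  define s where "s = max 0 (?l - t / 2)"
  have s: "0 \<le> s" "s < ?l" "?l < s + t" using t l by (auto simp: s_def)
  have "s * \<tau> \<le> ?l * \<tau>" using s \<tau> by (intro mult_right_mono) auto
  hence "s * \<tau> \<le> 1" using \<tau> by linarith
  hence "(1 - s * \<tau>) ^ (?n - 1) \<le> 1" using \<tau> s by (intro power_le_one) auto
  hence "t * (real ?n * ?V * \<tau> * (1 - s * \<tau>) ^ (?n - 1)) \<le> t * (real ?n * ?V * \<tau> * 1)"
    using nV t by (intro mult_left_mono) auto
  also have "\<dots> = \<eta> / 2"
  proof -
    have "\<eta> / (2 * c) * (c * 1) = \<eta> / 2" if "c > 0" for c :: real using that by simp
    from this[OF nV] show ?thesis unfolding t_def .
  qed
  finally have "measure lborel (L (s + t)) > 0" using step[OF s(1) less_imp_le[OF t] s(2)] vol[OF s(1,2)] \<eta> by linarith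
  then obtain p where "p \<in> L (s + t)" by (metis ex_in_conv less_irrefl measure_empty)
  hence "p \<in> K" "p + (s + t) *\<^sub>R u \<in> K" using mem_chord_slice[OF K u] by (auto simp: L_def)
  hence "s + t \<le> ?l" using s t by (intro le_longest_chord[OF K u]) auto
  thus False using s by simp
qed

section \<open>Equality in the monotonicity of mixed volumes\<close>

lemma supporting_normal:
  fixes K :: "'a::euclidean_space set"
  assumes "convex K" "interior K \<noteq> {}" "z \<notin> interior K"
  obtains v where "norm v = 1" "\<And>x. x \<in> K \<Longrightarrow> v \<bullet> x \<le> v \<bullet> z"
proof -
  have "\<exists>a b. a \<noteq> 0 \<and> (\<forall>x\<in>interior K. a \<bullet> x \<le> b) \<and> (\<forall>x\<in>{z}. b \<le> a \<bullet> x)"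
    using assms by (intro separating_hyperplane_sets) auto
  then obtain a b where a: "a \<noteq> 0" "\<And>x. x \<in> interior K \<Longrightarrow> a \<bullet> x \<le> b" "b \<le> a \<bullet> z" by blast
  have "interior K \<subseteq> {x. a \<bullet> x \<le> b}" using a by blast
  hence "closure (interior K) \<subseteq> {x. a \<bullet> x \<le> b}" by (intro closure_minimal closed_halfspace_le)
  hence "K \<subseteq> {x. a \<bullet> x \<le> b}" using convex_closure_interior[OF assms(1,2)] closure_subset by blast
  hence "inverse (norm a) * (a \<bullet> x) \<le> inverse (norm a) * (a \<bullet> z)" if "x \<in> K" for x
    using that a by (intro mult_left_mono) auto
  thus thesis using a(1) by (intro that[of "inverse (norm a) *\<^sub>R a"]) auto
qed

lemma supporting_normal_value:
  fixes K :: "'a::euclidean_space set"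
  assumes "cball c r \<subseteq> K" "norm v = 1" "\<And>x. x \<in> K \<Longrightarrow> v \<bullet> x \<le> h" "r \<ge> 0"
  shows "v \<bullet> c + r \<le> h"
proof -
  have "c + r *\<^sub>R v \<in> K" using assms by (auto simp: dist_norm)
  hence "v \<bullet> (c + r *\<^sub>R v) \<le> h" by (rule assms)
  moreover have "v \<bullet> v = 1" using assms(2) by (simp add: norm_eq_1)
  ultimately show ?thesis by (simp add: inner_add_right)
qed

text \<open>A supporting functional at a has a value h >= r there. It is at most gamma h at gamma b
  and at most rho <= (rho / r) h on the difference. Used in both directions, this shows that two
  frontier points on nearby rays have nearly the same size.\<close>

lemma frontier_shrink:
  fixes K :: "'a::euclidean_space set"
  assumes K: "convex K" "cball 0 r \<subseteq> K" "r > 0"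
    and "a \<in> frontier K" "b \<in> K" "\<gamma> \<ge> 0" "norm (a - \<gamma> *\<^sub>R b) \<le> \<rho>"
  shows "\<gamma> + \<rho> / r \<ge> 1"
proof (rule ccontr)
  assume "\<not> \<gamma> + \<rho> / r \<ge> 1"
  hence lt: "\<gamma> + \<rho> / r < 1" by simp
  have a: "a \<notin> interior K" using assms by (auto simp: frontier_def)
  obtain v where v: "norm v = 1" "\<And>x. x \<in> K \<Longrightarrow> v \<bullet> x \<le> v \<bullet> a"
  proof (rule supporting_normal[OF K(1) _ a])
    have "ball 0 r \<subseteq> interior K" using K by (intro interior_maximal) auto
    thus "interior K \<noteq> {}" using K(3) by force
  qed blast
  have h: "r \<le> v \<bullet> a" using supporting_normal_value[OF K(2) v] K(3) by simp
  have "v \<bullet> a = \<gamma> * (v \<bullet> b) + v \<bullet> (a - \<gamma> *\<^sub>R b)" by (simp add: inner_diff_right)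
  also have "\<dots> \<le> \<gamma> * (v \<bullet> a) + \<rho>"
  proof -
    have "v \<bullet> (a - \<gamma> *\<^sub>R b) \<le> \<rho>" using Cauchy_Schwarz_ineq2[of v "a - \<gamma> *\<^sub>R b"] v(1) assms(7) by simp
    thus ?thesis using v(2)[OF assms(5)] assms(6) by (intro add_mono mult_left_mono)
  qed
  also have "\<rho> \<le> (\<rho> / r) * (v \<bullet> a)"
  proof -
    have "\<rho> \<ge> 0" using assms(7) norm_ge_zero order_trans by blast
    hence "(\<rho> / r) * r \<le> (\<rho> / r) * (v \<bullet> a)" using h K(3) by (intro mult_left_mono) auto
    thus ?thesis using K(3) by simp
  qed
  finally have "v \<bullet> a \<le> (\<gamma> + \<rho> / r) * (v \<bullet> a)" by (simp add: algebra_simps)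
  moreover have "(\<gamma> + \<rho> / r) * (v \<bullet> a) < 1 * (v \<bullet> a)" using lt h K(3) by (intro mult_strict_right_mono) auto
  ultimately show False by simp
qed

lemma mixed_volume1_translate_left:
  fixes K M :: "(real^'n) set"
  assumes "convex_body K" "convex_body M"
  shows "mixed_volume1 ((\<lambda>x. z + x) ` K) M = mixed_volume1 K M"
proof -
  have K': "convex_body ((\<lambda>x. z + x) ` K)" by (rule convex_body_translate[OF assms(1)])
  have "right_slope (\<lambda>t. measure lborel ((\<lambda>x. z + x) ` K + (\<lambda>x. t *\<^sub>R x) ` M)) (CARD('n) * mixed_volume1 K M)"
  proof (rule right_slope_cong[OF right_slope_volume[OF assms assms(1)]])
    fix t :: real
    have "(\<lambda>x. z + x) ` K + (\<lambda>x. t *\<^sub>R x) ` M = (\<lambda>x. z + x) ` (K + (\<lambda>x. t *\<^sub>R x) ` M)"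
      unfolding translate_eq_plus by (simp add: add.assoc)
    moreover have "compact (K + (\<lambda>x. t *\<^sub>R x) ` M)"
      using assms by (intro compact_set_plus compact_scaling) (auto simp: convex_body_def)
    ultimately show "measure lborel (K + (\<lambda>x. t *\<^sub>R x) ` M) = measure lborel ((\<lambda>x. z + x) ` K + (\<lambda>x. t *\<^sub>R x) ` M)"
      by (simp add: measure_translate)
  qed
  from right_slope_unique[OF right_slope_volume[OF K' assms(2) assms(2)] this] show ?thesis by simp
qed

text \<open>If no face of $K$ through $y$ meets $M$, then near $y$ the support function of $M$ stays below
  that of $K$, so that $K + tM$ misses a part of $(1+t)K$ whose volume is of first order in $t$.\<close>

lemma mixed_volume1_less_centered:
  fixes K M :: "(real^'n) set"
  assumes K: "convex_body K" and M: "convex_body M" and "M \<subseteq> K" and int: "0 \<in> interior K"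
    and y: "y \<in> frontier K" and mid: "\<And>m. m \<in> M \<Longrightarrow> midpoint y m \<in> interior K"
  shows "mixed_volume1 K M < measure lborel K"
proof -
  let ?n = "CARD('n)" and ?\<mu> = "measure lebesgue :: (real^'n) set \<Rightarrow> real"
  have K': "compact K" "convex K" "K \<noteq> {}" and M': "compact M" "convex M" "M \<noteq> {}"
    using K M by (auto simp: convex_body_def)
  obtain r where r: "r > 0" "cball 0 r \<subseteq> K" using int mem_interior_cball by blast
  obtain R where R: "R > 0" "\<And>x. x \<in> K \<Longrightarrow> norm x \<le> R" using compact_imp_bounded[OF K'(1)] by (metis bounded_pos)
  have yK: "y \<in> K" using y compact_imp_closed[OF K'(1)] by (simp add: frontier_def)
  have "compact ((\<lambda>m. midpoint y m) ` M)"
    unfolding midpoint_def using M' by (intro compact_continuous_image continuous_intros)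
  then obtain e where e: "e > 0" "(\<Union>x\<in>(\<lambda>m. midpoint y m) ` M. ball x e) \<subseteq> interior K"
    using compact_subset_open_imp_ball_epsilon_subset[of "(\<lambda>m. midpoint y m) ` M" "interior K"] mid by auto
  define \<eta> where "\<eta> = e / 2"
  have \<eta>: "\<eta> > 0" "\<And>m. m \<in> M \<Longrightarrow> cball (midpoint y m) \<eta> \<subseteq> K"
    using e interior_subset[of K] by (force simp: \<eta>_def)+
  \<comment> \<open>The ball of radius eta/2 about \<open>midpoint y' m\<close> lies in K, so v at
    this midpoint stays eta/2 below its maximum; doubling gives the gap eta at m.\<close>
  have support: "v \<bullet> m \<le> v \<bullet> y' - \<eta>"
    if "norm v = 1" "\<And>x. x \<in> K \<Longrightarrow> v \<bullet> x \<le> v \<bullet> y'" "norm (y' - y) \<le> \<eta>" "m \<in> M" for v y' m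
  proof -
    have "cball (midpoint y' m) (\<eta> / 2) \<subseteq> cball (midpoint y m) \<eta>"
    proof
      fix x assume "x \<in> cball (midpoint y' m) (\<eta> / 2)"
      moreover have "dist (midpoint y m) (midpoint y' m) \<le> \<eta> / 2"
        using that(3) by (simp add: midpoint_def dist_norm scaleR_diff_right[symmetric] norm_minus_commute)
      ultimately show "x \<in> cball (midpoint y m) \<eta>"
        using dist_triangle[of "midpoint y m" x "midpoint y' m"] by simp
    qed
    hence "cball (midpoint y' m) (\<eta> / 2) \<subseteq> K" using \<eta>(2)[OF that(4)] by blast
    from supporting_normal_value[OF this that(1,2)] \<eta>(1)
    have "v \<bullet> midpoint y' m + \<eta> / 2 \<le> v \<bullet> y'" by simp
    thus ?thesis unfolding midpoint_def inner_scaleR_right inner_add_right by (simp add: field_simps)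
  qed
  \<comment> \<open>The first bound gives \<open>\<sigma> \<le> 2\<close> below, the second puts the
    frontier point on any ray of the cone within eta of y.\<close>
  define \<rho> where "\<rho> = min (r / 2) (\<eta> / (2 * (1 + R / r)))"
  have Rr: "1 + R / r > 0" using R r by (simp add: add_pos_pos)
  have \<rho>: "\<rho> > 0" "\<rho> / r \<le> 1 / 2" "2 * \<rho> * (1 + R / r) \<le> \<eta>"
  proof -
    show "\<rho> > 0" using r \<eta> Rr by (simp add: \<rho>_def)
    have "\<rho> \<le> r / 2" unfolding \<rho>_def by (rule min.cobounded1)
    thus "\<rho> / r \<le> 1 / 2" using r by (simp add: divide_le_eq)
    have "\<rho> \<le> \<eta> / (2 * (1 + R / r))" unfolding \<rho>_def by (rule min.cobounded2)
    hence "\<rho> * (2 * (1 + R / r)) \<le> \<eta>" using Rr by (simp add: pos_le_divide_eq)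
    thus "2 * \<rho> * (1 + R / r) \<le> \<eta>" by (simp add: mult_ac)
  qed
  \<comment> \<open>A cone with apex 0, so that membership is kept under the dilations of K;
    \<open>E\<close> is the part of K around the ray through y.\<close>
  define C where "C = cone hull (cball y \<rho>)"
  define E where "E = K \<inter> C"
  have C: "C = {c *\<^sub>R x | c x. c \<ge> 0 \<and> x \<in> cball y \<rho>}" unfolding C_def by (rule cone_hull_expl)
  have Ccone: "c *\<^sub>R x \<in> C" if "x \<in> C" "c \<ge> 0" for c x
    using that unfolding C by (force intro!: mult_nonneg_nonneg)
  have convE: "convex E" unfolding E_def C_def by (intro convex_Int K' convex_cone_hull convex_cball)
  have bE: "bounded E" unfolding E_def using compact_imp_bounded[OF K'(1)] by (rule bounded_subset) auto
  have lmE: "E \<in> lmeasurable" using convE bE by (rule measurable_convex)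
  have E0: "0 \<in> E" using r int interior_subset[of K] \<rho>(1) unfolding E_def C by (auto intro!: exI[of _ 0] exI[of _ y])
  have "cball y \<rho> \<subseteq> C" unfolding C_def by (rule hull_subset)
  have mE: "?\<mu> E > 0"
  proof -
    have "y \<in> closure (interior K)"
      using convex_closure_interior[OF K'(2)] int y closure_closed[OF compact_imp_closed[OF K'(1)]] yK by auto
    then obtain x where x: "x \<in> interior K" "dist x y < \<rho>" using closure_approachable \<rho>(1) by blast
    have "interior K \<inter> ball y \<rho> \<subseteq> E"
      using interior_subset[of K] \<open>cball y \<rho> \<subseteq> C\<close> unfolding E_def by force
    moreover have "\<not> negligible (interior K \<inter> ball y \<rho>)"
      using x by (intro open_not_negligible) (auto simp: dist_commute)
    ultimately have "\<not> negligible E" using negligible_subset by blast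
    hence "?\<mu> E \<noteq> 0" using lmE by (auto simp: negligible_iff_measure)
    thus ?thesis using measure_nonneg[of lebesgue E] by linarith
  qed
  \<comment> \<open>The relative gain: every support value h of K is at most R, so kappa h is at
    most the gap eta, while kappa stays below 1.\<close>
  define \<kappa> where "\<kappa> = \<eta> / (R + \<eta>)"
  have \<kappa>: "\<kappa> > 0" "\<kappa> < 1" "\<kappa> * R \<le> \<eta>"
    using R \<eta> by (auto simp: \<kappa>_def divide_less_eq divide_le_eq add_pos_pos mult_left_mono)
  \<comment> \<open>Inside the cone, K + tM does not reach beyond the dilate of K by 1 + t (1 -
    kappa).\<close>
  have avoid: "x \<notin> K + (\<lambda>x. t *\<^sub>R x) ` M"
    if t: "t > 0" and x: "x \<in> C" "x \<notin> (\<lambda>x. (1 + t * (1 - \<kappa>)) *\<^sub>R x) ` K" for t x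
  proof
    define t' where "t' = t * (1 - \<kappa>)"
    have t': "t' > 0" using t \<kappa> by (simp add: t'_def)
    assume "x \<in> K + (\<lambda>x. t *\<^sub>R x) ` M"
    then obtain k m where km: "k \<in> K" "m \<in> M" "x = k + t *\<^sub>R m" by (auto elim!: set_plus_elim)
    have "x \<noteq> 0"
    proof
      assume "x = 0"
      hence "x = (1 + t * (1 - \<kappa>)) *\<^sub>R 0" by simp
      thus False using x(2) E0 unfolding E_def by blast
    qed
    obtain d where d: "d > 0" "0 + d *\<^sub>R x \<in> frontier K" "\<And>e. 0 \<le> e \<Longrightarrow> e < d \<Longrightarrow> 0 + e *\<^sub>R x \<in> interior K"
      using ray_to_frontier[OF compact_imp_bounded[OF K'(1)] int \<open>x \<noteq> 0\<close>] by blast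
    define y' where "y' = d *\<^sub>R x"
    have y': "y' \<in> frontier K" using d by (simp add: y'_def)
    hence y'K: "y' \<in> K" using compact_imp_closed[OF K'(1)] by (simp add: frontier_def)
    have dt: "d * (1 + t') < 1"
    proof (rule ccontr)
      assume "\<not> d * (1 + t') < 1"
      hence le: "1 / (1 + t') \<le> d" using t' by (simp add: divide_le_eq)
      have "(1 / (1 + t')) *\<^sub>R x \<in> K"
      proof (cases "1 / (1 + t') = d")
        case True
        thus ?thesis using y'K by (simp add: y'_def)
      next
        case False
        hence "0 + (1 / (1 + t')) *\<^sub>R x \<in> interior K" using le t' by (intro d(3)) auto
        thus ?thesis using interior_subset by auto
      qed
      moreover have "x = (1 + t') *\<^sub>R ((1 / (1 + t')) *\<^sub>R x)" using t' by simp
      ultimately show False using x(2) unfolding t'_def by blast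
    qed
    obtain \<tau> w where w: "\<tau> \<ge> 0" "dist y w \<le> \<rho>" "x = \<tau> *\<^sub>R w" using x(1) unfolding C by auto
    have "\<tau> > 0" using w \<open>x \<noteq> 0\<close> by (cases "\<tau> = 0") auto
    \<comment> \<open>The frontier point y' is sigma w with w within rho of y; applying
      \<open>frontier_shrink\<close> to y' and y in both orders forces sigma to be close to
      1.\<close>
    define \<sigma> where "\<sigma> = d * \<tau>"
    have \<sigma>: "\<sigma> > 0" "y' = \<sigma> *\<^sub>R w" using d \<open>\<tau> > 0\<close> w by (auto simp: \<sigma>_def y'_def)
    have s1: "\<sigma> + \<sigma> * \<rho> / r \<ge> 1"
    proof (rule frontier_shrink[OF K'(2) r(2,1) y' yK])
      have "norm (y' - \<sigma> *\<^sub>R y) = \<sigma> * norm (w - y)" using \<sigma> by (simp add: scaleR_diff_right[symmetric])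
      thus "norm (y' - \<sigma> *\<^sub>R y) \<le> \<sigma> * \<rho>" using \<sigma> w by (simp add: dist_norm norm_minus_commute)
    qed (use \<sigma> in simp)
    have s2: "1 / \<sigma> + \<rho> / r \<ge> 1"
    proof (rule frontier_shrink[OF K'(2) r(2,1) y y'K])
      have "(1 / \<sigma>) *\<^sub>R y' = w" using \<sigma> by simp
      thus "norm (y - (1 / \<sigma>) *\<^sub>R y') \<le> \<rho>" using w by (simp add: dist_norm)
    qed (use \<sigma> in simp)
    have "1 / \<sigma> \<ge> 1 / 2" using s2 \<rho>(2) by linarith
    hence \<sigma>2: "\<sigma> \<le> 2" using \<sigma>(1) by (simp add: divide_simps)
    have "\<sigma> * (1 + \<rho> / r) \<ge> 1" using s1 by (simp add: distrib_left)
    hence "1 / \<sigma> \<le> 1 + \<rho> / r" using \<sigma>(1) by (simp add: divide_le_eq mult.commute)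
    hence sd: "\<bar>1 - 1 / \<sigma>\<bar> \<le> \<rho> / r" using s2 by linarith
    have "norm (w - (1 / \<sigma>) *\<^sub>R y) \<le> \<rho> + (\<rho> / r) * R"
    proof -
      have "w - (1 / \<sigma>) *\<^sub>R y = (w - y) + (1 - 1 / \<sigma>) *\<^sub>R y" by (simp add: algebra_simps)
      hence "norm (w - (1 / \<sigma>) *\<^sub>R y) \<le> norm (w - y) + \<bar>1 - 1 / \<sigma>\<bar> * norm y"
        by (metis norm_scaleR norm_triangle_ineq)
      also have "\<dots> \<le> \<rho> + (\<rho> / r) * R"
        using w(2) sd R(2)[OF yK] by (intro add_mono mult_mono) (auto simp: dist_norm norm_minus_commute)
      finally show ?thesis .
    qed
    hence "\<sigma> * norm (w - (1 / \<sigma>) *\<^sub>R y) \<le> 2 * (\<rho> + (\<rho> / r) * R)"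
      using \<sigma> \<sigma>2 by (intro mult_mono) auto
    also have "\<dots> = 2 * \<rho> * (1 + R / r)" by (simp add: algebra_simps)
    also have "\<sigma> * norm (w - (1 / \<sigma>) *\<^sub>R y) = norm (y' - y)"
    proof -
      have "y' - y = \<sigma> *\<^sub>R (w - (1 / \<sigma>) *\<^sub>R y)" using \<sigma> by (simp add: scaleR_diff_right)
      thus ?thesis using \<sigma>(1) by simp
    qed
    finally have near: "norm (y' - y) \<le> \<eta>" using \<rho>(3) by linarith
    obtain v where v: "norm v = 1" "\<And>x. x \<in> K \<Longrightarrow> v \<bullet> x \<le> v \<bullet> y'"
      using supporting_normal[OF K'(2), of y'] int y' by (auto simp: frontier_def)
    define h where "h = v \<bullet> y'"
    have h: "h > 0" "h \<le> R"
      using supporting_normal_value[OF r(2) v] r Cauchy_Schwarz_ineq2[of v y'] R(2)[OF y'K] v(1)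
      by (auto simp: h_def)
    have "v \<bullet> x \<le> h + t * (h - \<eta>)"
      unfolding km(3) inner_add_right inner_scaleR_right using v(2)[OF km(1)] support[OF v near km(2)] t
      by (intro add_mono mult_left_mono) (auto simp: h_def)
    moreover have "v \<bullet> x = h / d" using d(1) by (simp add: h_def y'_def)
    moreover have "h * (1 + t') < h / d" using dt d(1) h(1) by (simp add: pos_less_divide_eq mult.assoc) (metis mult.commute mult_less_cancel_left_pos mult_1_right)
    ultimately have "h * t' < t * (h - \<eta>)" by (simp add: algebra_simps)
    hence "t * (h - h * \<kappa>) < t * (h - \<eta>)" by (simp add: t'_def algebra_simps)
    hence "\<eta> < h * \<kappa>" using t by simp
    also have "h * \<kappa> \<le> \<kappa> * R" using h \<kappa> by (simp add: mult.commute mult_left_mono)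
    finally show False using \<kappa>(3) by simp
  qed
  have bound: "measure lborel (K + (\<lambda>x. t *\<^sub>R x) ` M) \<le> (1 + t) ^ ?n * measure lborel K - ?n * t * \<kappa> * ?\<mu> E"
    if t: "t > 0" for t :: real
  proof -
    define t' where "t' = t * (1 - \<kappa>)"
    have t': "0 < t'" "t' \<le> t" using t \<kappa> by (auto simp: t'_def mult_left_le)
    let ?S = "\<lambda>c S. (\<lambda>x. c *\<^sub>R x) ` S :: (real^'n) set"
    have scal: "?\<mu> (?S c E) = c ^ ?n * ?\<mu> E" if "c > 0" for c
      using measure_lebesgue_affine[of c 0 E] that by simp
    have lmS: "?S c E \<in> lmeasurable" for c
      by (intro measurable_convex convex_scaling bounded_scaling convE bE)
    \<comment> \<open>A shell of the cone that lies in (1 + t)K and misses K + tM. Its volume is of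
      first order in t and is lost by K + tM.\<close>
    let ?Y = "?S (1 + t) E - ?S (1 + t') E"
    have subE: "?S (1 + t') E \<subseteq> ?S (1 + t) E"
    proof
      fix x assume "x \<in> ?S (1 + t') E"
      then obtain z where z: "z \<in> E" "x = (1 + t') *\<^sub>R z" by blast
      define q where "q = (1 + t') / (1 + t)"
      have q: "0 \<le> q" "q \<le> 1" using t t' by (auto simp: q_def)
      have "q *\<^sub>R z + (1 - q) *\<^sub>R 0 \<in> E" using q z E0 by (intro convexD[OF convE]) auto
      hence "q *\<^sub>R z \<in> E" by simp
      moreover have "x = (1 + t) *\<^sub>R (q *\<^sub>R z)" using t z by (simp add: q_def)
      ultimately show "x \<in> ?S (1 + t) E" by blast
    qed
    have "?\<mu> ?Y = (1 + t) ^ ?n * ?\<mu> E - (1 + t') ^ ?n * ?\<mu> E"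
      using measurable_measure_Diff[OF lmS fmeasurableD[OF lmS] subE] scal t t' by simp
    also have "\<dots> \<ge> ?n * t * \<kappa> * ?\<mu> E"
    proof -
      have "real ?n * (t * \<kappa>) * 1 \<le> real ?n * ((1 + t) - (1 + t')) * (1 + t') ^ (?n - 1)"
        using t t' \<kappa> by (intro mult_mono one_le_power) (auto simp: t'_def algebra_simps)
      also have "\<dots> \<le> (1 + t) ^ ?n - (1 + t') ^ ?n"
        using t' by (intro power_diff_ge) auto
      finally have "(real ?n * (t * \<kappa>) * 1) * ?\<mu> E \<le> ((1 + t) ^ ?n - (1 + t') ^ ?n) * ?\<mu> E"
        using mE by (intro mult_right_mono) auto
      thus ?thesis by (simp add: algebra_simps)
    qed
    finally have Y: "?n * t * \<kappa> * ?\<mu> E \<le> ?\<mu> ?Y" .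
    let ?KM = "K + ?S t M"
    have cKM: "compact ?KM" by (intro compact_set_plus compact_scaling K' M')
    have cK: "compact (?S (1 + t) K)" by (intro compact_scaling K')
    have "?KM \<subseteq> K + ?S t K" using \<open>M \<subseteq> K\<close> by (intro set_plus_mono2 image_mono) auto
    also have "\<dots> = ?S (1 + t) K" using scaleR_add_image[OF K'(2), of 1 t] t by simp
    finally have sub1: "?KM \<subseteq> ?S (1 + t) K" .
    have sub2: "?Y \<subseteq> ?S (1 + t) K" by (auto simp: E_def)
    have "?Y \<inter> ?KM = {}"
    proof -
      have "x \<notin> ?KM" if xY: "x \<in> ?Y" for x
      proof (rule avoid[OF t])
        obtain z where z: "z \<in> E" "x = (1 + t) *\<^sub>R z" using xY by blast
        show xC: "x \<in> C" using z t Ccone unfolding E_def by auto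
        show "x \<notin> (\<lambda>x. (1 + t * (1 - \<kappa>)) *\<^sub>R x) ` K"
        proof
          assume "x \<in> (\<lambda>x. (1 + t * (1 - \<kappa>)) *\<^sub>R x) ` K"
          then obtain q where q: "q \<in> K" "x = (1 + t') *\<^sub>R q" by (auto simp: t'_def)
          hence "q = (1 / (1 + t')) *\<^sub>R x" using t' by simp
          hence "q \<in> C" using xC t' Ccone by auto
          hence "q \<in> E" using q by (simp add: E_def)
          thus False using q xY by blast
        qed
      qed
      thus ?thesis by blast
    qed
    have "?\<mu> (?Y \<union> ?KM) = ?\<mu> ?Y + ?\<mu> ?KM - ?\<mu> (?Y \<inter> ?KM)"
      by (intro measure_Un3 lmeasurable_compact cKM fmeasurable_Diff lmS fmeasurableD)
    hence "?\<mu> ?Y + ?\<mu> ?KM = ?\<mu> (?Y \<union> ?KM)" using \<open>?Y \<inter> ?KM = {}\<close> by simp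
    also have "\<dots> \<le> ?\<mu> (?S (1 + t) K)"
      using sub1 sub2 by (intro measure_mono_fmeasurable lmeasurable_compact cK sets.Un sets.Diff fmeasurableD lmS cKM) auto
    also have "\<dots> = (1 + t) ^ ?n * measure lborel K"
      using measure_scaleR[OF K'(1), of "1 + t"] t cK by (simp add: borel_compact)
    finally show ?thesis using Y cKM by (simp add: borel_compact)
  qed
  have "?n * mixed_volume1 K M \<le> ?n * measure lborel K - ?n * \<kappa> * ?\<mu> E"
  proof (rule right_slope_mono[OF right_slope_volume[OF K M K]])
    show "right_slope (\<lambda>t. (1 + t) ^ ?n * measure lborel K - real ?n * t * \<kappa> * ?\<mu> E) (?n * measure lborel K - ?n * \<kappa> * ?\<mu> E)"
      by (rule right_slope_DERIV) (auto intro!: derivative_eq_intros)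
    have "(\<lambda>x. 0 *\<^sub>R x) ` M = 0" using M' by auto
    thus "measure lborel (K + (\<lambda>x. 0 *\<^sub>R x) ` M) = (1 + 0) ^ ?n * measure lborel K - real ?n * 0 * \<kappa> * ?\<mu> E" by simp
  qed (rule bound)
  hence "?n * mixed_volume1 K M \<le> ?n * (measure lborel K - \<kappa> * ?\<mu> E)" by (simp add: algebra_simps)
  hence "mixed_volume1 K M \<le> measure lborel K - \<kappa> * ?\<mu> E" by simp
  moreover have "\<kappa> * ?\<mu> E > 0" using \<kappa> mE by simp
  ultimately show ?thesis by linarith
qed

lemma mixed_volume1_less:
  fixes K M :: "(real^'n) set"
  assumes K: "convex_body K" "interior K \<noteq> {}" and M: "convex_body M" and "M \<subseteq> K"
    and y: "y \<in> frontier K" and mid: "\<And>m. m \<in> M \<Longrightarrow> midpoint y m \<in> interior K"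
  shows "mixed_volume1 K M < measure lborel K"
proof -
  obtain c where c: "c \<in> interior K" using K(2) by blast
  let ?T = "\<lambda>X. (\<lambda>x. - c + x) ` X"
  have "mixed_volume1 (?T K) (?T M) < measure lborel (?T K)"
  proof (rule mixed_volume1_less_centered)
    show "convex_body (?T K)" "convex_body (?T M)" by (rule convex_body_translate, fact)+
    show "?T M \<subseteq> ?T K" using \<open>M \<subseteq> K\<close> by blast
    show "0 \<in> interior (?T K)" unfolding interior_translation using c by (auto simp: image_iff)
    show "- c + y \<in> frontier (?T K)" unfolding frontier_translation using y by blast
    fix m assume "m \<in> ?T M"
    then obtain m' where m': "m' \<in> M" "m = - c + m'" by blast
    have "midpoint (- c + y) m = - c + midpoint y m'" 
    proof -
      have "(- c + y) + (- c + m') = 2 *\<^sub>R (- c) + (y + m')" by (simp add: scaleR_2)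
      thus ?thesis unfolding m'(2) midpoint_def by (simp only: scaleR_add_right) simp
    qed
    thus "midpoint (- c + y) m \<in> interior (?T K)" unfolding interior_translation using mid[OF m'(1)] by blast
  qed
  moreover have "mixed_volume1 (?T K) (?T M) = mixed_volume1 K M"
  proof -
    have "mixed_volume1 (?T K) (?T M) = mixed_volume1 K (?T M)"
      by (rule mixed_volume1_translate_left[OF K(1) convex_body_translate[OF M]])
    also have "\<dots> = mixed_volume1 K M" using mixed_volume1_homothety[OF K(1) M, of 1 "- c"] by simp
    finally show ?thesis .
  qed
  moreover have "measure lborel (?T K) = measure lborel K"
    using K by (intro measure_translate) (auto simp: convex_body_def)
  ultimately show ?thesis by simp
qed

text \<open>By \<open>mixed_volume1_less\<close> some midpoint of y and a point m of M is not
  interior. A functional supporting K at this midpoint attains its maximum at both ends, that is, at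
  y and at m.\<close>

lemma common_normal:
  fixes K M :: "(real^'n) set"
  assumes K: "convex_body K" "interior K \<noteq> {}" and M: "convex_body M" and "M \<subseteq> K"
    and eq: "mixed_volume1 K M = measure lborel K" and y: "y \<in> frontier K"
  obtains m v where "m \<in> M" "norm v = 1" "\<And>x. x \<in> K \<Longrightarrow> v \<bullet> x \<le> v \<bullet> y" "v \<bullet> m = v \<bullet> y"
proof -
  obtain m where m: "m \<in> M" "midpoint y m \<notin> interior K"
    using mixed_volume1_less[OF K M \<open>M \<subseteq> K\<close> y] eq by fastforce
  have K': "convex K" "compact K" using K by (auto simp: convex_body_def)
  have yK: "y \<in> K" using y compact_imp_closed[OF K'(2)] by (simp add: frontier_def)
  obtain v where v: "norm v = 1" "\<And>x. x \<in> K \<Longrightarrow> v \<bullet> x \<le> v \<bullet> midpoint y m"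
    using supporting_normal[OF K'(1) K(2) m(2)] by blast
  have mp: "v \<bullet> midpoint y m = (v \<bullet> y + v \<bullet> m) / 2" by (simp add: midpoint_def inner_add_right)
  have "v \<bullet> y \<le> v \<bullet> midpoint y m" "v \<bullet> m \<le> v \<bullet> midpoint y m" using v(2) yK m(1) \<open>M \<subseteq> K\<close> by auto
  hence eqs: "v \<bullet> m = v \<bullet> y" "v \<bullet> midpoint y m = v \<bullet> y" unfolding mp by (simp_all add: field_simps)
  show thesis by (rule that[OF m(1) v(1) _ eqs(1)]) (use v(2) eqs(2) in auto)
qed

text \<open>Take c at maximal distance from the complement of the interior. If c were outside the
  hull of the contact points, a small move away from all of them would increase this
  distance.\<close>

lemma inscribed_ball:
  fixes K :: "'a::euclidean_space set"
  assumes "compact K" "interior K \<noteq> {}"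
  obtains c r where "r > 0" "cball c r \<subseteq> K" "c \<in> convex hull {q \<in> frontier K. dist c q = r}"
proof -
  define S where "S = - interior K"
  have S: "closed S" "S \<noteq> {}"
  proof -
    show "closed S" unfolding S_def by (intro closed_Compl open_interior)
    have "bounded (interior K)" using compact_imp_bounded[OF assms(1)] interior_subset bounded_subset by blast
    hence "interior K \<noteq> UNIV" using not_bounded_UNIV by auto
    thus "S \<noteq> {}" by (auto simp: S_def)
  qed
  have "K \<noteq> {}" using assms(2) interior_subset by blast
  then obtain c where c: "c \<in> K" "\<And>x. x \<in> K \<Longrightarrow> infdist x S \<le> infdist c S"
    using continuous_attains_sup[OF assms(1) _ continuous_on_infdist[OF continuous_on_id, of K S]] by auto
  define r where "r = infdist c S"
  obtain x0 where x0: "x0 \<in> interior K" using assms(2) by blast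
  hence "0 < infdist x0 S" using S by (intro infdist_pos_not_in_closed) (auto simp: S_def)
  hence r: "r > 0" using c(2)[of x0] x0 interior_subset[of K] by (auto simp: r_def)
  have max: "infdist x S \<le> r" for x
  proof (cases "x \<in> K")
    case False
    hence "x \<in> S" using interior_subset[of K] by (auto simp: S_def)
    thus ?thesis using r by simp
  qed (use c r_def in auto)
  have dS: "r \<le> dist c z" if "z \<in> S" for z unfolding r_def by (rule infdist_le[OF that])
  have "ball c r \<subseteq> interior K" using dS by (force simp: S_def)
  hence "closure (ball c r) \<subseteq> K"
    using interior_subset compact_imp_closed[OF assms(1)] by (intro closure_minimal) auto
  hence cb: "cball c r \<subseteq> K" using r by simp
  define Q where "Q = S \<inter> cball c r"
  have Qeq: "Q = {q \<in> frontier K. dist c q = r}"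
    using cb dS compact_imp_closed[OF assms(1)] by (force simp: Q_def S_def frontier_def)
  have cQ: "compact Q" unfolding Q_def using S by (simp add: closed_Int_compact)
  have "c \<in> convex hull Q"
  proof (rule ccontr)
    assume "c \<notin> convex hull Q"
    then obtain a b where ab: "a \<bullet> c < b" "\<forall>x\<in>convex hull Q. a \<bullet> x > b"
      using separating_hyperplane_closed_point[OF convex_convex_hull, of Q c]
        compact_imp_closed[OF compact_convex_hull[OF cQ]] by blast
    define e where "e k = inverse (real (Suc k))" for k
    have e: "e k > 0" "e k \<le> 1" for k by (auto simp: e_def field_simps)
    define cc where "cc k = c - e k *\<^sub>R a" for k
    have "\<exists>z. z \<in> S \<and> dist (cc k) z \<le> r" for k
      using infdist_attains_inf[OF S, of "cc k"] max[of "cc k"] by metis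
    then obtain z where z: "\<And>k. z k \<in> S" "\<And>k. dist (cc k) (z k) \<le> r" by metis
    have zb: "z k \<in> cball c (r + norm a)" for k
    proof -
      have "dist c (cc k) = e k * norm a" using e(1)[of k] by (simp add: cc_def dist_norm)
      also have "\<dots> \<le> norm a" using e[of k] by (simp add: mult_left_le_one_le)
      finally show ?thesis using dist_triangle[of c "z k" "cc k"] z(2)[of k] by simp
    qed
    \<comment> \<open>The point z k is within r of the moved centre and at least r away from c;
      comparing the squared distances gives the sign.\<close>
    have neg: "a \<bullet> (z k - c) \<le> 0" for k
    proof -
      have "norm (z k - cc k) ^ 2 = norm (z k - c) ^ 2 + 2 * e k * (a \<bullet> (z k - c)) + (e k * norm a) ^ 2"
      proof -
        have "z k - cc k = (z k - c) + e k *\<^sub>R a" by (simp add: cc_def)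
        thus ?thesis by (simp only: power2_norm_eq_inner power_mult_distrib)
          (simp add: inner_add_left inner_add_right inner_commute algebra_simps power2_eq_square)
      qed
      moreover have "norm (z k - cc k) ^ 2 \<le> r ^ 2"
        using z(2)[of k] by (intro power_mono) (auto simp: dist_norm norm_minus_commute)
      moreover have "r ^ 2 \<le> norm (z k - c) ^ 2"
        using dS[OF z(1)[of k]] r by (intro power_mono) (auto simp: dist_norm norm_minus_commute)
      moreover have "(e k * norm a) ^ 2 \<ge> 0" by simp
      ultimately have "2 * e k * (a \<bullet> (z k - c)) \<le> 0" by linarith
      thus ?thesis using e(1)[of k] by (simp add: mult_le_0_iff)
    qed
    \<comment> \<open>The moved centres tend to c, so a limit of the points z k is a contact point
      of c. Separation puts it strictly on the positive side of c along a, whereas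
      \<open>neg\<close> passes to the limit.\<close>
    have "compact (cball c (r + norm a))" by simp
    then obtain l s where l: "l \<in> cball c (r + norm a)" "strict_mono (s :: nat \<Rightarrow> nat)" "(z \<circ> s) \<longlonglongrightarrow> l"
      using zb unfolding compact_def by metis
    have "l \<in> S" by (rule closed_sequentially[OF S(1) _ l(3)]) (simp add: z(1))
    have "(\<lambda>k. e (s k)) \<longlonglongrightarrow> 0"
      using LIMSEQ_subseq_LIMSEQ[OF LIMSEQ_inverse_real_of_nat l(2)] by (simp add: e_def o_def)
    hence "(\<lambda>k. cc (s k)) \<longlonglongrightarrow> c - 0 *\<^sub>R a" unfolding cc_def by (intro tendsto_intros)
    hence "(\<lambda>k. dist (cc (s k)) (z (s k))) \<longlonglongrightarrow> dist c l"
      using l(3) by (intro tendsto_dist) (auto simp: o_def)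
    hence "dist c l \<le> r" using z(2) by (intro LIMSEQ_le_const2) auto
    hence "l \<in> convex hull Q" using \<open>l \<in> S\<close> by (intro hull_inc) (simp add: Q_def)
    hence "a \<bullet> l > b" using ab by blast
    moreover have "(\<lambda>k. a \<bullet> (z (s k) - c)) \<longlonglongrightarrow> a \<bullet> (l - c)"
      using l(3) by (intro tendsto_intros) (simp add: o_def)
    hence "a \<bullet> (l - c) \<le> 0" using neg by (intro LIMSEQ_le_const2) auto
    ultimately show False using ab(1) by (simp add: inner_diff_right)
  qed
  thus thesis using that[OF r cb] by (simp add: Qeq)
qed

text \<open>The ball forces the inner product of v and q - c to be at least r, the norm of q - c,
  which is the equality case of Cauchy-Schwarz.\<close>

lemma normal_at_contact_point:
  fixes K :: "'a::euclidean_space set"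
  assumes "cball c r \<subseteq> K" "r > 0" "dist c q = r" "norm v = 1" "\<And>x. x \<in> K \<Longrightarrow> v \<bullet> x \<le> v \<bullet> q"
  shows "q - c = r *\<^sub>R v"
proof -
  have "v \<bullet> c + r \<le> v \<bullet> q" using supporting_normal_value[OF assms(1,4,5)] assms(2) by simp
  hence ge: "v \<bullet> (q - c) \<ge> r" by (simp add: inner_diff_right)
  have nq: "norm (q - c) = r" using assms(3) by (simp add: dist_norm norm_minus_commute)
  have "norm (q - c - r *\<^sub>R v) ^ 2 = norm (q - c) ^ 2 - 2 * r * (v \<bullet> (q - c)) + r ^ 2 * norm v ^ 2"
    by (simp only: power2_norm_eq_inner) (simp add: inner_diff_left inner_diff_right inner_commute algebra_simps power2_eq_square)
  also have "\<dots> = 2 * r * (r - v \<bullet> (q - c))" using nq assms(4) by (simp add: power2_eq_square algebra_simps)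
  also have "\<dots> \<le> 0" using ge assms(2) by (simp add: mult_le_0_iff)
  finally show ?thesis by simp
qed

text \<open>For a contact point $q$ of an inscribed ball with centre $c$, the normal $q - c$ is unique, and
  a segment from $q$ to a minimizer $p_q$ of $\langle q - c, \cdot\rangle$ is a longest chord. Equality in (iv)
  makes every boundary point share a supporting hyperplane with $p_q$ or $q$. So $K$ is a pyramid with apex
  $p_q$ over its face at $q$, and the faces at the other contact points contain $p_q$.\<close>

lemma simplex_if_longest_chord:
  fixes K :: "(real^'n) set"
  assumes K: "full_dim_convex_body K"
    and chord: "\<And>u. norm u = 1 \<Longrightarrow> longest_chord K u = measure lborel K / mixed_volume1 K (closed_segment 0 u)"
  shows "int CARD('n) simplex K"
proof -
  have body: "convex_body K" "compact K" "convex K" "K \<noteq> {}" "interior K \<noteq> {}"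
    using K by (auto simp: full_dim_convex_body_def convex_body_def)
  have frK: "frontier K \<subseteq> K" using compact_imp_closed[OF body(2)] by (simp add: frontier_subset_closed)
  obtain c r where r: "r > 0" "cball c r \<subseteq> K" and chull: "c \<in> convex hull {q \<in> frontier K. dist c q = r}"
    by (rule inscribed_ball[OF body(2,5)])
  define Q where "Q = {q \<in> frontier K. dist c q = r}"
  have cK: "c \<in> K" using r by auto
  have QK: "q \<in> K" if "q \<in> Q" for q using that frK by (auto simp: Q_def)
  have contact: "q - c = r *\<^sub>R v" if "q \<in> Q" "norm v = 1" "\<And>x. x \<in> K \<Longrightarrow> v \<bullet> x \<le> v \<bullet> q" for q v
    using normal_at_contact_point[OF r(2,1) _ that(2,3)] that(1) by (auto simp: Q_def)
  have qmax: "(q - c) \<bullet> x \<le> (q - c) \<bullet> q" if q: "q \<in> Q" and "x \<in> K" for q x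
  proof -
    have "q \<notin> interior K" using q by (auto simp: Q_def frontier_def)
    then obtain v where v: "norm v = 1" "\<And>x. x \<in> K \<Longrightarrow> v \<bullet> x \<le> v \<bullet> q"
      using supporting_normal[OF body(3,5)] by blast
    show ?thesis using contact[OF q v] v(2)[OF \<open>x \<in> K\<close>] r(1) by simp
  qed
  have qc: "(q - c) \<bullet> q - (q - c) \<bullet> c = r ^ 2" if "q \<in> Q" for q
    using that by (simp add: Q_def dist_norm norm_minus_commute inner_diff_right[symmetric] power2_norm_eq_inner[symmetric])
  have "\<exists>p. p \<in> K \<and> (\<forall>x\<in>K. (q - c) \<bullet> p \<le> (q - c) \<bullet> x)" for q
    using continuous_attains_inf[OF body(2,4), of "\<lambda>x. (q - c) \<bullet> x"]
      continuous_on_inner[OF continuous_on_const continuous_on_id, of K "q - c"] by auto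
  then obtain p where p: "\<And>q. p q \<in> K" "\<And>q x. x \<in> K \<Longrightarrow> (q - c) \<bullet> p q \<le> (q - c) \<bullet> x" by metis
  have plt: "(q - c) \<bullet> p q < (q - c) \<bullet> q" if "q \<in> Q" for q
    using p(2)[OF cK, of q] qc[OF that] r(1) zero_less_power[of r 2] by linarith
  \<comment> \<open>Equality in (iv) makes the mixed volume of K with the chord from p q to q equal
    to the volume of K. So some supporting hyperplane at y touches the chord, hence contains an end
    of it. If that end is q, the hyperplane is the unique one at q.\<close>
  have share: "(q - c) \<bullet> y = (q - c) \<bullet> q \<or> (\<exists>v. norm v = 1 \<and> (\<forall>x\<in>K. v \<bullet> x \<le> v \<bullet> y) \<and> v \<bullet> p q = v \<bullet> y)"
    if q: "q \<in> Q" and y: "y \<in> frontier K" for q y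
  proof -
    define l where "l = norm (q - p q)"
    have ne: "q \<noteq> p q" using plt[OF q] by auto
    hence l: "l > 0" by (simp add: l_def)
    define u where "u = (1 / l) *\<^sub>R (q - p q)"
    have u: "norm u = 1" "p q + l *\<^sub>R u = q" using l by (auto simp: u_def l_def)
    have Nu: "(q - c) \<bullet> q - (q - c) \<bullet> p q = l * ((q - c) \<bullet> u)" using l by (simp add: u_def inner_diff_right)
    have "l * ((q - c) \<bullet> u) > 0" using Nu plt[OF q] by linarith
    hence Nu_pos: "(q - c) \<bullet> u > 0" using l by (rule zero_less_mult_pos)
    \<comment> \<open>The extent of a chord in the direction q - c cannot exceed the width of K
      between p q and q, and along u this width corresponds to the length l.\<close>
    have "longest_chord K u \<le> l"
    proof (rule longest_chord_leI[OF K u(1)])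
      fix a s assume as: "s \<ge> (0::real)" "a \<in> K" "a + s *\<^sub>R u \<in> K"
      have "s * ((q - c) \<bullet> u) = (q - c) \<bullet> (a + s *\<^sub>R u) - (q - c) \<bullet> a" by (simp add: inner_add_right)
      also have "\<dots> \<le> (q - c) \<bullet> q - (q - c) \<bullet> p q" using qmax[OF q as(3)] p(2)[OF as(2), of q] by linarith
      finally show "s \<le> l" using Nu Nu_pos by simp
    qed
    moreover have "l \<le> longest_chord K u" using p(1) QK[OF q] u l by (intro le_longest_chord[OF K u(1), of "p q"]) auto
    ultimately have "l = measure lborel K / mixed_volume1 K (closed_segment 0 u)" using chord[OF u(1)] by simp
    hence vol: "l * mixed_volume1 K (closed_segment 0 u) = measure lborel K"
      using segment_mixed_volume_pos[OF K u(1)] by simp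
    have seg: "(\<lambda>x. p q + l *\<^sub>R x) ` closed_segment 0 u = closed_segment (p q) q"
    proof -
      have "(\<lambda>x. p q + l *\<^sub>R x) ` closed_segment 0 u = (\<lambda>x. p q + x) ` closed_segment 0 (l *\<^sub>R u)"
        by (simp add: scaleR_closed_segment[symmetric] image_image)
      also have "\<dots> = closed_segment (p q) q"
        using closed_segment_translation[of "p q" 0 "l *\<^sub>R u"] u by simp
      finally show ?thesis .
    qed
    have "mixed_volume1 K (closed_segment (p q) q) = measure lborel K"
      using mixed_volume1_homothety[OF body(1) convex_body_segment, of l "p q" 0 u] l vol seg by simp
    moreover have "closed_segment (p q) q \<subseteq> K" using p(1) QK[OF q] body(3) by (intro closed_segment_subset) auto
    ultimately obtain m v where mv: "m \<in> closed_segment (p q) q" "norm v = 1" "\<And>x. x \<in> K \<Longrightarrow> v \<bullet> x \<le> v \<bullet> y" "v \<bullet> m = v \<bullet> y"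
      using common_normal[OF body(1,5) convex_body_segment _ _ y] by metis
    obtain t where t: "0 \<le> t" "t \<le> 1" "m = (1 - t) *\<^sub>R p q + t *\<^sub>R q" using mv(1) by (auto simp: in_segment)
    have vm: "(1 - t) * (v \<bullet> y - v \<bullet> p q) + t * (v \<bullet> y - v \<bullet> q) = 0"
      using mv(4) t(3) by (simp add: inner_add_right algebra_simps)
    have nn: "0 \<le> v \<bullet> y - v \<bullet> p q" "0 \<le> v \<bullet> y - v \<bullet> q" using mv(3) p(1) QK[OF q] by auto
    have "v \<bullet> p q = v \<bullet> y \<or> v \<bullet> q = v \<bullet> y"
      using vm nn t by (smt (verit) mult_nonneg_nonneg mult_eq_0_iff)
    thus ?thesis
    proof
      assume "v \<bullet> q = v \<bullet> y"
      hence "q - c = r *\<^sub>R v" using mv by (intro contact[OF q]) auto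
      thus ?thesis using \<open>v \<bullet> q = v \<bullet> y\<close> by simp
    qed (use mv in blast)
  qed
  \<comment> \<open>The point q' is off the hyperplane at q, since otherwise the unique normals at q
    and q' would coincide. So \<open>share\<close> puts p q on the supporting hyperplane at
    q'.\<close>
  have other: "(q' - c) \<bullet> p q = (q' - c) \<bullet> q'" if q: "q \<in> Q" and q': "q' \<in> Q" and ne: "q \<noteq> q'" for q q'
  proof -
    have yq': "q' \<in> frontier K" using q' by (simp add: Q_def)
    have "(q - c) \<bullet> q' \<noteq> (q - c) \<bullet> q"
    proof
      assume eq: "(q - c) \<bullet> q' = (q - c) \<bullet> q"
      let ?v = "(1 / r) *\<^sub>R (q - c)"
      have "norm ?v = 1" using q r(1) by (simp add: Q_def dist_norm norm_minus_commute)
      moreover have "?v \<bullet> x \<le> ?v \<bullet> q'" if "x \<in> K" for x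
        using qmax[OF q that] eq r(1) by (simp add: divide_right_mono)
      ultimately have "q' - c = r *\<^sub>R ?v" by (rule contact[OF q'])
      thus False using ne r(1) by simp
    qed
    then obtain v where v: "norm v = 1" "\<forall>x\<in>K. v \<bullet> x \<le> v \<bullet> q'" "v \<bullet> p q = v \<bullet> q'"
      using share[OF q yq'] by blast
    have "q' - c = r *\<^sub>R v" using v by (intro contact[OF q']) auto
    thus ?thesis using v(3) by simp
  qed
  \<comment> \<open>The ray from p q through an interior point z leaves K at a point y of the face
    at q: otherwise, by \<open>share\<close>, a supporting hyperplane would contain p q and y, and
    with them z.\<close>
  have pyramid: "e = p q \<or> (q - c) \<bullet> e = (q - c) \<bullet> q" if q: "q \<in> Q" and e: "e extreme_point_of K" for q e
  proof -
    define F where "F = K \<inter> {x. (q - c) \<bullet> x = (q - c) \<bullet> q}"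
    have cF: "compact F" unfolding F_def by (intro compact_Int_closed body closed_hyperplane)
    let ?H = "convex hull (insert (p q) F)"
    have "z \<in> ?H" if z: "z \<in> interior K" for z
    proof (cases "z = p q")
      case False
      hence l: "z - p q \<noteq> 0" by simp
      obtain d where d: "d > 0" "z + d *\<^sub>R (z - p q) \<in> frontier K"
        using ray_to_frontier[OF compact_imp_bounded[OF body(2)] z l] by blast
      define y where "y = z + d *\<^sub>R (z - p q)"
      have yK: "y \<in> frontier K" using d by (simp add: y_def)
      have zy: "(1 + d) *\<^sub>R z = y + d *\<^sub>R p q" by (simp add: y_def algebra_simps)
      have "(q - c) \<bullet> y = (q - c) \<bullet> q"
      proof (rule ccontr)
        assume "(q - c) \<bullet> y \<noteq> (q - c) \<bullet> q"
        then obtain v where v: "norm v = 1" "\<forall>x\<in>K. v \<bullet> x \<le> v \<bullet> y" "v \<bullet> p q = v \<bullet> y" using share[OF q yK] by blast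
        have "(1 + d) * (v \<bullet> z) = (1 + d) * (v \<bullet> y)"
          using arg_cong[OF zy, of "\<lambda>x. v \<bullet> x"] v(3) by (simp add: inner_add_right algebra_simps)
        hence vz: "v \<bullet> z = v \<bullet> y" using d(1) by simp
        obtain e where e: "e > 0" "cball z e \<subseteq> K" using z mem_interior_cball by blast
        have "v \<bullet> z + e \<le> v \<bullet> y" using supporting_normal_value[OF e(2) v(1)] v(2) e(1) by auto
        thus False using vz e(1) by simp
      qed
      hence yF: "y \<in> F" using yK frK by (auto simp: F_def)
      have "z = (1 / (1 + d)) *\<^sub>R y + (d / (1 + d)) *\<^sub>R p q"
      proof -
        have "z = (1 / (1 + d)) *\<^sub>R ((1 + d) *\<^sub>R z)" using d(1) by simp
        thus ?thesis unfolding zy by (simp add: scaleR_add_right)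
      qed
      also have "\<dots> \<in> ?H"
        using d(1) yF by (intro convexD[OF convex_convex_hull]) (auto simp: hull_inc add_divide_distrib[symmetric])
      finally show ?thesis .
    qed (simp add: hull_inc)
    hence "interior K \<subseteq> ?H" by blast
    moreover have "closed ?H" using cF by (intro compact_imp_closed compact_convex_hull compact_insert)
    ultimately have "closure (interior K) \<subseteq> ?H" by (rule closure_minimal)
    hence "K \<subseteq> ?H" using convex_closure_interior[OF body(3,5)] closure_subset by blast
    moreover have "?H \<subseteq> K" using p(1) body(3) by (intro hull_minimal) (auto simp: F_def)
    ultimately have "K = ?H" by blast
    hence "e \<in> insert (p q) F" using e extreme_point_of_convex_hull by metis
    thus ?thesis by (auto simp: F_def)
  qed
  obtain Q0 \<mu> where Q0: "finite Q0" "Q0 \<subseteq> Q" "\<forall>x\<in>Q0. 0 \<le> \<mu> x" "sum \<mu> Q0 = 1" "(\<Sum>q\<in>Q0. \<mu> q *\<^sub>R q) = c"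
    using chull unfolding Q_def[symmetric] convex_hull_explicit by auto
  \<comment> \<open>An extreme point e that is no p q has inner product r^2 with every q - c.
    Averaging with the weights that express c through the contact points would turn this into 0 =
    r^2.\<close>
  have ext: "{x. x extreme_point_of K} \<subseteq> p ` Q0"
  proof
    fix e assume "e \<in> {x. x extreme_point_of K}"
    hence e: "e extreme_point_of K" by simp
    show "e \<in> p ` Q0"
    proof (rule ccontr)
      assume "e \<notin> p ` Q0"
      hence "(q - c) \<bullet> (e - c) = r ^ 2" if "q \<in> Q0" for q
      proof -
        have "q \<in> Q" "e \<noteq> p q" using that Q0(2) \<open>e \<notin> p ` Q0\<close> by auto
        thus ?thesis using pyramid[OF _ e, of q] qc[of q] by (simp add: inner_diff_right)
      qed
      hence "(\<Sum>q\<in>Q0. \<mu> q * ((q - c) \<bullet> (e - c))) = (\<Sum>q\<in>Q0. \<mu> q * r ^ 2)" by (intro sum.cong) auto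
      also have "\<dots> = r ^ 2" by (simp add: sum_distrib_right[symmetric] Q0(4))
      also have "(\<Sum>q\<in>Q0. \<mu> q * ((q - c) \<bullet> (e - c))) = ((\<Sum>q\<in>Q0. \<mu> q *\<^sub>R q) - (\<Sum>q\<in>Q0. \<mu> q) *\<^sub>R c) \<bullet> (e - c)"
        by (simp add: inner_diff_left inner_sum_left scaleR_sum_left right_diff_distrib sum_subtractf)
      also have "\<dots> = 0" by (simp add: Q0)
      finally show False using r(1) by simp
    qed
  qed
  define C where "C = p ` Q0"
  have "K = convex hull {x. x extreme_point_of K}" by (rule Krein_Milman_Minkowski[OF body(2,3)])
  also have "\<dots> \<subseteq> convex hull C" unfolding C_def by (rule hull_mono[OF ext])
  finally have "K \<subseteq> convex hull C" .
  moreover have "convex hull C \<subseteq> K" using p(1) body(3) by (intro hull_minimal) (auto simp: C_def)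
  ultimately have KC: "K = convex hull C" by blast
  \<comment> \<open>The supporting hyperplane at q contains all the other vertices, by
    \<open>other\<close>, but not p q.\<close>
  have indep: "\<not> affine_dependent C"
  proof
    assume "affine_dependent C"
    then obtain q where q: "q \<in> Q0" "p q \<in> affine hull (C - {p q})" by (auto simp: affine_dependent_def C_def)
    have "C - {p q} \<subseteq> {x. (q - c) \<bullet> x = (q - c) \<bullet> q}"
    proof
      fix x assume "x \<in> C - {p q}"
      then obtain q'' where "q'' \<in> Q0" "x = p q''" "q'' \<noteq> q" by (auto simp: C_def)
      thus "x \<in> {x. (q - c) \<bullet> x = (q - c) \<bullet> q}" using other[of q'' q] q(1) Q0(2) by auto
    qed
    hence "affine hull (C - {p q}) \<subseteq> {x. (q - c) \<bullet> x = (q - c) \<bullet> q}" by (intro hull_minimal affine_hyperplane)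
    hence "(q - c) \<bullet> p q = (q - c) \<bullet> q" using q(2) by blast
    moreover have "q \<in> Q" using q(1) Q0(2) by blast
    ultimately show False using plt[of q] by linarith
  qed
  have "aff_dim K = int CARD('n)" using aff_dim_nonempty_interior[OF body(5)] by simp
  hence "int (card C) = int CARD('n) + 1"
    using aff_dim_affine_independent[OF indep] by (simp add: KC aff_dim_convex_hull)
  thus ?thesis unfolding simplex_def using indep KC by blast
qed

section \<open>Simplices\<close>

text \<open>Barycentric coordinates as affine functions on the whole space: the one for c vanishes
  on the hyperplane spanned by the other vertices and is scaled to 1 at c. Points outside the
  simplex have some negative coordinate.\<close>

lemma simplex_barycentric:
  fixes K :: "'a::euclidean_space set"
  assumes "int DIM('a) simplex K"
  obtains C and w :: "'a \<Rightarrow> 'a" and d :: "'a \<Rightarrow> real"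
  where "finite C" "card C = DIM('a) + 1"
    and "\<And>c. c \<in> C \<Longrightarrow> w c \<bullet> c + d c = 1" "\<And>c c'. c \<in> C \<Longrightarrow> c' \<in> C \<Longrightarrow> c \<noteq> c' \<Longrightarrow> w c \<bullet> c' + d c = 0"
    and "\<And>x. (\<Sum>c\<in>C. w c \<bullet> x + d c) = 1" "\<And>x. (\<Sum>c\<in>C. (w c \<bullet> x + d c) *\<^sub>R c) = x"
    and "K = {x. \<forall>c\<in>C. w c \<bullet> x + d c \<ge> 0}"
proof -
  obtain C where C: "\<not> affine_dependent C" "int (card C) = int DIM('a) + 1" "K = convex hull C"
    using assms unfolding simplex_def by blast
  have fin: "finite C" by (rule aff_independent_finite[OF C(1)])
  have "\<exists>w d. w \<bullet> c + d = 1 \<and> (\<forall>c'\<in>C - {c}. w \<bullet> c' + d = 0)" if c: "c \<in> C" for c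
  proof -
    have ind: "\<not> affine_dependent (C - {c})" by (rule affine_independent_Diff[OF C(1)])
    have "card (C - {c}) = DIM('a)" using fin c C(2) by simp
    hence "aff_dim (C - {c}) = int (DIM('a) - 1)"
      using aff_dim_affine_independent[OF ind] by (simp add: of_nat_diff Suc_leI)
    hence "\<exists>a b. a \<noteq> 0 \<and> affine hull (C - {c}) = {x. a \<bullet> x = b}"
      by (simp only: aff_dim_eq_hyperplane)
    then obtain a b where ab: "a \<noteq> 0" "affine hull (C - {c}) = {x. a \<bullet> x = b}" by blast
    have "c \<notin> affine hull (C - {c})" using C(1) c by (auto simp: affine_dependent_def)
    hence ne: "a \<bullet> c - b \<noteq> 0" using ab by simp
    have 0: "a \<bullet> c' = b" if "c' \<in> C - {c}" for c' using hull_inc[OF that, of affine] ab by simp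
    show ?thesis
      using ne 0 by (intro exI[of _ "(1 / (a \<bullet> c - b)) *\<^sub>R a"] exI[of _ "- b / (a \<bullet> c - b)"])
        (auto simp: diff_divide_distrib[symmetric])
  qed
  then obtain w d where wd: "\<And>c. c \<in> C \<Longrightarrow> w c \<bullet> c + d c = 1" "\<And>c c'. c \<in> C \<Longrightarrow> c' \<in> C - {c} \<Longrightarrow> w c \<bullet> c' + d c = 0"
    by metis
  have eval: "w c \<bullet> (\<Sum>c\<in>C. u c *\<^sub>R c) + d c = u c" if c: "c \<in> C" and u: "sum u C = 1" for c u
  proof -
    have "w c \<bullet> (\<Sum>c\<in>C. u c *\<^sub>R c) + d c = (\<Sum>c'\<in>C. u c' * (w c \<bullet> c')) + (\<Sum>c'\<in>C. u c' * d c)"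
      by (simp add: inner_sum_right sum_distrib_right[symmetric] u)
    also have "\<dots> = (\<Sum>c'\<in>C. u c' * (w c \<bullet> c' + d c))" by (simp add: sum.distrib[symmetric] distrib_left)
    also have "\<dots> = (\<Sum>c'\<in>C. if c' = c then u c else 0)"
      using wd c by (intro sum.cong) auto
    also have "\<dots> = u c" using fin c by simp
    finally show ?thesis .
  qed
  have "aff_dim C = int DIM('a)" using aff_dim_affine_independent[OF C(1)] C(2) by simp
  hence "affine hull C = UNIV" by (simp add: aff_dim_eq_full)
  hence rep: "\<exists>u. sum u C = 1 \<and> (\<Sum>c\<in>C. u c *\<^sub>R c) = x" for x
    using affine_hull_finite[OF fin] by auto
  have sum1: "(\<Sum>c\<in>C. w c \<bullet> x + d c) = 1" for x
  proof -
    obtain u where u: "sum u C = 1" "(\<Sum>c\<in>C. u c *\<^sub>R c) = x" using rep by blast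
    have "(\<Sum>c\<in>C. w c \<bullet> x + d c) = sum u C" using eval[OF _ u(1)] u(2) by (intro sum.cong) auto
    thus ?thesis using u by simp
  qed
  have sumx: "(\<Sum>c\<in>C. (w c \<bullet> x + d c) *\<^sub>R c) = x" for x
  proof -
    obtain u where u: "sum u C = 1" "(\<Sum>c\<in>C. u c *\<^sub>R c) = x" using rep by blast
    have "(\<Sum>c\<in>C. (w c \<bullet> x + d c) *\<^sub>R c) = (\<Sum>c\<in>C. u c *\<^sub>R c)" using eval[OF _ u(1)] u(2) by (intro sum.cong) auto
    thus ?thesis using u by simp
  qed
  have "K = {x. \<forall>c\<in>C. w c \<bullet> x + d c \<ge> 0}"
  proof (intro set_eqI iffI)
    fix x assume "x \<in> K"
    then obtain u where u: "\<forall>c\<in>C. 0 \<le> u c" "sum u C = 1" "(\<Sum>c\<in>C. u c *\<^sub>R c) = x"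
      unfolding C(3) convex_hull_finite[OF fin] by auto
    thus "x \<in> {x. \<forall>c\<in>C. w c \<bullet> x + d c \<ge> 0}" using eval[OF _ u(2)] by auto
  next
    fix x assume "x \<in> {x. \<forall>c\<in>C. w c \<bullet> x + d c \<ge> 0}"
    thus "x \<in> K"
      unfolding C(3) convex_hull_finite[OF fin] using sum1 sumx by (auto intro!: exI[of _ "\<lambda>c. w c \<bullet> x + d c"])
  qed
  thus thesis using that[OF fin _ wd(1) _ sum1 sumx] wd(2) C(2) by auto
qed

context
  fixes K C :: "(real^'n) set" and w :: "real^'n \<Rightarrow> real^'n" and d :: "real^'n \<Rightarrow> real"
  assumes fin: "finite C" and card: "card C = CARD('n) + 1"
    and diag: "\<And>c. c \<in> C \<Longrightarrow> w c \<bullet> c + d c = 1"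
    and off: "\<And>c c'. c \<in> C \<Longrightarrow> c' \<in> C \<Longrightarrow> c \<noteq> c' \<Longrightarrow> w c \<bullet> c' + d c = 0"
    and sum1: "\<And>x. (\<Sum>c\<in>C. w c \<bullet> x + d c) = 1"
    and sumx: "\<And>x. (\<Sum>c\<in>C. (w c \<bullet> x + d c) *\<^sub>R c) = x"
    and K: "K = {x. \<forall>c\<in>C. w c \<bullet> x + d c \<ge> 0}"
    and body: "convex_body K" and int: "interior K \<noteq> {}"
begin

private abbreviation (input) "\<beta> \<equiv> \<lambda>c x. w c \<bullet> x + d c"

private lemma K_compact_convex: "compact K" "convex K" using body by (auto simp: convex_body_def)

private lemma beta_sum:
  assumes "c \<in> C"
  shows "\<beta> c ((1 - sum e C) *\<^sub>R x + (\<Sum>c\<in>C. e c *\<^sub>R c)) = (1 - sum e C) * \<beta> c x + e c"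
proof -
  have "w c \<bullet> (\<Sum>c\<in>C. e c *\<^sub>R c) + sum e C * d c = (\<Sum>c'\<in>C. e c' * \<beta> c c')"
    by (simp add: inner_sum_right sum_distrib_right sum.distrib[symmetric] distrib_left)
  also have "\<dots> = (\<Sum>c'\<in>C. if c' = c then e c else 0)"
    using diag off assms by (intro sum.cong) auto
  also have "\<dots> = e c" using fin assms by simp
  finally show ?thesis by (simp add: inner_add_right algebra_simps)
qed

text \<open>The homothety on the right turns each coordinate into (1 - sum e) times itself plus e c,
  so lower bounds 0 become lower bounds e c. Positivity of the ratio allows the way back.\<close>

lemma truncated_simplex:
  assumes "sum e C < 1"
  shows "{x. \<forall>c\<in>C. \<beta> c x \<ge> e c} = (\<lambda>x. (\<Sum>c\<in>C. e c *\<^sub>R c) + (1 - sum e C) *\<^sub>R x) ` K"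
proof (intro set_eqI iffI)
  fix x assume x: "x \<in> {x. \<forall>c\<in>C. \<beta> c x \<ge> e c}"
  define y where "y = (1 / (1 - sum e C)) *\<^sub>R (x - (\<Sum>c\<in>C. e c *\<^sub>R c))"
  have xy: "x = (1 - sum e C) *\<^sub>R y + (\<Sum>c\<in>C. e c *\<^sub>R c)" using assms by (simp add: y_def)
  have "\<beta> c y \<ge> 0" if c: "c \<in> C" for c
  proof -
    have "(1 - sum e C) * \<beta> c y \<ge> 0" using beta_sum[OF c, of e y] x c xy by force
    thus ?thesis using assms by (simp add: zero_le_mult_iff)
  qed
  hence "y \<in> K" using K by simp
  thus "x \<in> (\<lambda>x. (\<Sum>c\<in>C. e c *\<^sub>R c) + (1 - sum e C) *\<^sub>R x) ` K" using xy by (auto simp: add.commute)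
next
  fix x assume "x \<in> (\<lambda>x. (\<Sum>c\<in>C. e c *\<^sub>R c) + (1 - sum e C) *\<^sub>R x) ` K"
  then obtain y where y: "y \<in> K" "x = (1 - sum e C) *\<^sub>R y + (\<Sum>c\<in>C. e c *\<^sub>R c)" by (auto simp: add.commute)
  show "x \<in> {x. \<forall>c\<in>C. \<beta> c x \<ge> e c}"
  proof (intro CollectI ballI)
    fix c assume c: "c \<in> C"
    have "(1 - sum e C) * \<beta> c y \<ge> 0" using y K c assms by (intro mult_nonneg_nonneg) auto
    thus "\<beta> c x \<ge> e c" using beta_sum[OF c, of e y] y(2) by simp
  qed
qed

private lemma measure_truncated:
  assumes "sum e C < 1"
  shows "compact {x. \<forall>c\<in>C. \<beta> c x \<ge> e c}"
    "measure lborel {x. \<forall>c\<in>C. \<beta> c x \<ge> e c} = (1 - sum e C) ^ CARD('n) * measure lborel K"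
  unfolding truncated_simplex[OF assms] using measure_homothety[OF K_compact_convex(1)] K_compact_convex(1) assms
  by (auto intro!: compact_continuous_image continuous_intros)

text \<open>If $A$ meets all facets of the simplex $K$, then $K + t(A - p)$ contains, for each vertex $c$,
  a translate of the layer $Y_c$ of thickness of order $t$ along the facet opposite to $c$. Keeping
  the distance $t$ from the other facets makes these translates disjoint.\<close>

lemma volume_sum_touching:
  fixes A :: "(real^'n) set" and a :: "real^'n \<Rightarrow> real^'n" and t :: real
  assumes A: "convex_body A" and touch: "\<And>c. c \<in> C \<Longrightarrow> a c \<in> A \<and> \<beta> c (a c) = 0" and AK: "A \<subseteq> K"
    and t: "0 < t" "(real CARD('n) + 1) * t < 1"
  shows "measure lborel K + CARD('n) * t * (1 - (real CARD('n) + 1) * t) ^ (CARD('n) - 1) * measure lborel K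
    \<le> measure lborel (K + (\<lambda>x. t *\<^sub>R x) ` A)"
proof -
  let ?n = "CARD('n)" and ?\<mu> = "measure lebesgue :: (real^'n) set \<Rightarrow> real"
  obtain p where p: "p \<in> A" using A by (auto simp: convex_body_def)
  \<comment> \<open>The layer at the facet opposite to c gets the thickness t b c; these coordinates
    of p sum to 1 and distribute the gained volume.\<close>
  define b where "b c = \<beta> c p" for c
  have sumb: "sum b C = 1" unfolding b_def by (rule sum1)
  have b0: "b c \<ge> 0" if "c \<in> C" for c using p AK K that by (auto simp: b_def)
  have b1: "b c \<le> 1" if "c \<in> C" for c
    unfolding sumb[symmetric] using fin b0 that by (intro member_le_sum) auto
  \<comment> \<open>The layer \<open>Y c\<close> has its coordinate for c in [0, t b c) and all
    others at least t. The translation by t (a c - p) lowers the former by t b c, hence below 0, and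
    the latter by at most t, so they stay nonnegative. This separates the translates from K and from
    each other.\<close>
  define lo hi where "lo c c' = (if c' = c then 0 else t)" and "hi c c' = (if c' = c then t * b c else t)" for c c' :: "real^'n"
  have slo: "sum (lo c) C = ?n * t" and shi: "sum (hi c) C = ?n * t + t * b c" if c: "c \<in> C" for c
  proof -
    have "sum (lo c) C = (\<Sum>c'\<in>C - {c}. t)"
      unfolding lo_def sum.remove[OF fin c] by (auto intro!: sum.cong)
    thus "sum (lo c) C = ?n * t" using fin c card by simp
    have "sum (hi c) C = t * b c + (\<Sum>c'\<in>C - {c}. t)"
      unfolding hi_def sum.remove[OF fin c] by (auto intro!: sum.cong)
    thus "sum (hi c) C = ?n * t + t * b c" using fin c card by simp
  qed
  have tb: "0 \<le> t * b c" "t * b c \<le> t" if "c \<in> C" for c using t b0[OF that] b1[OF that] by (simp_all add: mult_left_le)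
  have lt1: "sum (lo c) C < 1" "sum (hi c) C < 1" if "c \<in> C" for c
  proof -
    have "real ?n * t + t < 1" using t(2) by (simp add: algebra_simps)
    thus "sum (lo c) C < 1" "sum (hi c) C < 1" using slo[OF that] shi[OF that] t(1) tb[OF that] by linarith+
  qed
  define T where "T e = {x. \<forall>c\<in>C. \<beta> c x \<ge> e c}" for e
  define Y where "Y c = T (lo c) - T (hi c)" for c
  define Z where "Z c = (\<lambda>x. t *\<^sub>R (a c - p) + x) ` Y c" for c
  have cT: "compact (T (lo c))" "compact (T (hi c))" if "c \<in> C" for c
    unfolding T_def by (rule measure_truncated(1), rule lt1, fact)+
  have lmT: "T (lo c) \<in> lmeasurable" "T (hi c) \<in> lmeasurable" if "c \<in> C" for c
    using cT[OF that] by (auto intro: lmeasurable_compact)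
  have YK: "x \<in> K" "\<beta> c x < t * b c" "c' \<in> C \<Longrightarrow> c' \<noteq> c \<Longrightarrow> \<beta> c' x \<ge> t" if c: "c \<in> C" and x: "x \<in> Y c" for c c' x
  proof -
    have lo: "\<beta> c' x \<ge> lo c c'" if "c' \<in> C" for c' using x that by (auto simp: Y_def T_def)
    have "\<beta> c' x \<ge> 0" if "c' \<in> C" for c' using lo[OF that] t by (auto simp: lo_def split: if_splits)
    thus "x \<in> K" by (simp add: K)
    show "\<beta> c' x \<ge> t" if "c' \<in> C" "c' \<noteq> c" using lo[OF that(1)] that(2) by (simp add: lo_def)
    obtain c' where c': "c' \<in> C" "\<beta> c' x < hi c c'" using x by (auto simp: Y_def T_def not_le)
    have "c' = c" using lo[OF c'(1)] c'(2) by (auto simp: lo_def hi_def split: if_splits)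
    thus "\<beta> c x < t * b c" using c' by (simp add: hi_def)
  qed
  \<comment> \<open>The two truncations are homothets of K with ratios 1 - nt and 1 - nt - t b c, so
    the volume of the layer is a difference of n-th powers.\<close>
  have muY: "?\<mu> (Y c) \<ge> ?n * t * b c * (1 - (real ?n + 1) * t) ^ (?n - 1) * measure lborel K" if c: "c \<in> C" for c
  proof -
    have sub: "T (hi c) \<subseteq> T (lo c)"
    proof
      fix x assume "x \<in> T (hi c)"
      moreover have "lo c c' \<le> hi c c'" for c' using t tb[OF c] by (simp add: lo_def hi_def)
      ultimately show "x \<in> T (lo c)" unfolding T_def by (auto intro: order_trans)
    qed
    have "?\<mu> (Y c) = ?\<mu> (T (lo c)) - ?\<mu> (T (hi c))"
      unfolding Y_def by (rule measurable_measure_Diff[OF lmT(1)[OF c] fmeasurableD[OF lmT(2)[OF c]] sub])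
    also have "\<dots> = measure lborel (T (lo c)) - measure lborel (T (hi c))"
      using cT[OF c] by (simp add: borel_compact)
    also have "\<dots> = ((1 - ?n * t) ^ ?n - (1 - (?n * t + t * b c)) ^ ?n) * measure lborel K"
      unfolding T_def measure_truncated(2)[OF lt1(1)[OF c]] measure_truncated(2)[OF lt1(2)[OF c]] slo[OF c] shi[OF c]
      by (simp add: left_diff_distrib)
    also have "\<dots> \<ge> (?n * (t * b c) * (1 - (real ?n + 1) * t) ^ (?n - 1)) * measure lborel K"
    proof (rule mult_right_mono)
      have bern: "real ?n * t + t < 1" using t(2) by (simp add: algebra_simps)
      hence "(1 - (real ?n + 1) * t) ^ (?n - 1) \<le> (1 - (?n * t + t * b c)) ^ (?n - 1)"
        using tb[OF c] t(2) by (intro power_mono) (simp_all add: distrib_right)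
      hence "real ?n * (t * b c) * (1 - (real ?n + 1) * t) ^ (?n - 1) \<le>
          real ?n * (t * b c) * (1 - (?n * t + t * b c)) ^ (?n - 1)"
        using t(1) b0[OF c] by (intro mult_left_mono mult_nonneg_nonneg) auto
      also have "\<dots> = real ?n * ((1 - ?n * t) - (1 - (?n * t + t * b c))) * (1 - (?n * t + t * b c)) ^ (?n - 1)"
        by simp
      also have "\<dots> \<le> (1 - ?n * t) ^ ?n - (1 - (?n * t + t * b c)) ^ ?n"
      proof (rule power_diff_ge)
        show "0 \<le> 1 - (real ?n * t + t * b c)" "1 - (real ?n * t + t * b c) \<le> 1 - real ?n * t"
          using bern tb[OF c] by linarith+
      qed
      finally show "real ?n * (t * b c) * (1 - (real ?n + 1) * t) ^ (?n - 1) \<le> (1 - ?n * t) ^ ?n - (1 - (?n * t + t * b c)) ^ ?n" .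
    qed simp
    finally show ?thesis by (simp add: mult_ac)
  qed
  have lmY: "Y c \<in> lmeasurable" if "c \<in> C" for c
    unfolding Y_def using lmT[OF that] by (intro fmeasurable_Diff fmeasurableD)
  have lmZ: "Z c \<in> lmeasurable" "?\<mu> (Z c) = ?\<mu> (Y c)" if "c \<in> C" for c
    unfolding Z_def using lmY[OF that] by (auto simp: measure_translation intro: measurable_translation)
  define shift where "shift X = (\<lambda>x. - (t *\<^sub>R p) + x) ` X" for X
  define S where "S = shift (K + (\<lambda>x. t *\<^sub>R x) ` A)"
  have cKA: "compact (K + (\<lambda>x. t *\<^sub>R x) ` A)"
    using A by (intro compact_set_plus compact_scaling K_compact_convex) (auto simp: convex_body_def)
  have cS: "compact S" unfolding S_def shift_def by (rule compact_translation[OF cKA])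
  have memS: "k + t *\<^sub>R (x - p) \<in> S" if "k \<in> K" "x \<in> A" for k x
  proof -
    have "k + t *\<^sub>R x \<in> K + (\<lambda>x. t *\<^sub>R x) ` A" using that by (intro set_plus_intro) auto
    moreover have "k + t *\<^sub>R (x - p) = - (t *\<^sub>R p) + (k + t *\<^sub>R x)" by (simp add: algebra_simps)
    ultimately show ?thesis unfolding S_def shift_def by blast
  qed
  have \<beta>Z: "\<beta> c z < 0" "c' \<in> C \<Longrightarrow> c' \<noteq> c \<Longrightarrow> \<beta> c' z \<ge> 0" if c: "c \<in> C" and z: "z \<in> Z c" for c c' z
  proof -
    obtain x where x: "x \<in> Y c" "z = t *\<^sub>R (a c - p) + x" using z by (auto simp: Z_def)
    have shiftb: "\<beta> c' z = \<beta> c' x + t * (\<beta> c' (a c) - \<beta> c' p)" for c'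
      by (simp add: x(2) inner_add_right inner_diff_right algebra_simps)
    have "t * (\<beta> c (a c) - \<beta> c p) = - (t * b c)"
      unfolding b_def touch[OF c, THEN conjunct2] by (simp add: algebra_simps)
    thus "\<beta> c z < 0" using shiftb[of c] YK(2)[OF c x(1)] by linarith
    show "\<beta> c' z \<ge> 0" if c': "c' \<in> C" "c' \<noteq> c"
    proof -
      have "\<beta> c' (a c) \<ge> 0" using touch[OF c] AK c' K by blast
      hence "\<beta> c' (a c) - \<beta> c' p \<ge> - 1" using b1[OF c'(1)] unfolding b_def by linarith
      hence "t * (\<beta> c' (a c) - \<beta> c' p) \<ge> t * (- 1)" using t by (intro mult_left_mono) auto
      thus ?thesis using shiftb[of c'] YK(3)[OF c x(1) c'] by linarith
    qed
  qed
  have sub: "K \<union> (\<Union>c\<in>C. Z c) \<subseteq> S"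
  proof -
    have KS: "K \<subseteq> S" using memS[OF _ p] by auto
    have ZS: "Z c \<subseteq> S" if "c \<in> C" for c
    proof
      fix z assume "z \<in> Z c"
      then obtain x where "x \<in> Y c" "z = x + t *\<^sub>R (a c - p)" by (auto simp: Z_def add.commute)
      thus "z \<in> S" using memS YK(1)[OF that] touch[OF that] by simp
    qed
    show ?thesis using KS ZS by blast
  qed
  have disjZ: "Z c \<inter> Z c' = {}" if "c \<in> C" "c' \<in> C" "c \<noteq> c'" for c c'
    using \<beta>Z(1)[OF that(1)] \<beta>Z(2)[OF that(2) _ that(1)] that(3) by fastforce
  have disjK: "K \<inter> (\<Union>c\<in>C. Z c) = {}"
    using \<beta>Z(1) K by fastforce
  have lmU: "(\<Union>c\<in>C. Z c) \<in> lmeasurable" using fin lmZ by (intro fmeasurable.finite_UN) auto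
  have muU: "?\<mu> (\<Union>c\<in>C. Z c) = (\<Sum>c\<in>C. ?\<mu> (Z c))"
    using fin lmZ(1) disjZ by (intro measure_UNION') (auto simp: pairwise_def disjnt_def)
  \<comment> \<open>The total gain; the layer opposite to c provides at least the share b c of
    it.\<close>
  define q where "q = ?n * t * (1 - (real ?n + 1) * t) ^ (?n - 1) * measure lborel K"
  have "q = (\<Sum>c\<in>C. b c * q)" by (simp add: sum_distrib_right[symmetric] sumb)
  also have "\<dots> \<le> (\<Sum>c\<in>C. ?\<mu> (Z c))"
    using muY lmZ(2) by (intro sum_mono) (simp add: q_def mult_ac)
  finally have "measure lborel K + q \<le> ?\<mu> K + ?\<mu> (\<Union>c\<in>C. Z c)"
    using K_compact_convex by (simp add: muU borel_compact)
  also have "\<dots> = ?\<mu> (K \<union> (\<Union>c\<in>C. Z c))"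
    using measure_Un3[OF lmeasurable_compact[OF K_compact_convex(1)] lmU] disjK by simp
  also have "\<dots> \<le> ?\<mu> S"
    by (rule measure_mono_fmeasurable[OF sub sets.Un[OF fmeasurableD[OF lmeasurable_compact[OF K_compact_convex(1)]]
      fmeasurableD[OF lmU]] lmeasurable_compact[OF cS]])
  also have "\<dots> = measure lborel (K + (\<lambda>x. t *\<^sub>R x) ` A)"
  proof -
    have "?\<mu> S = measure lborel S" using cS by (simp add: borel_compact)
    thus ?thesis unfolding S_def shift_def measure_translate[OF cKA] .
  qed
  finally show ?thesis by (simp add: q_def)
qed

text \<open>Monotonicity gives one inequality. The other is the first-order part of the gain in
  \<open>volume_sum_touching\<close>, whose correction factor tends to 1.\<close>

lemma mixed_volume1_touching:
  assumes A: "convex_body A" and touch: "\<And>c. c \<in> C \<Longrightarrow> \<exists>x\<in>A. \<beta> c x = 0" and AK: "A \<subseteq> K"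
  shows "mixed_volume1 K A = measure lborel K"
proof (rule antisym)
  let ?n = "CARD('n)"
  show "mixed_volume1 K A \<le> measure lborel K"
    using mixed_volume1_mono[OF body A body AK] by (simp add: mixed_volume1_self[OF body])
  obtain a where a: "\<And>c. c \<in> C \<Longrightarrow> a c \<in> A \<and> \<beta> c (a c) = 0" using touch by metis
  have "?n * measure lborel K \<le> ?n * mixed_volume1 K A"
  proof (rule tendsto_le)
    let ?f = "\<lambda>t. (measure lborel (K + (\<lambda>x. t *\<^sub>R x) ` A) - measure lborel (K + (\<lambda>x. 0 *\<^sub>R x) ` A)) / t"
    show "(?f \<longlongrightarrow> ?n * mixed_volume1 K A) (at_right 0)"
      using right_slope_volume[OF body A A] unfolding right_slope_def .
    have "((\<lambda>t. ?n * (1 - (real ?n + 1) * t) ^ (?n - 1) * measure lborel K) \<longlongrightarrow>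
        ?n * (1 - (real ?n + 1) * 0) ^ (?n - 1) * measure lborel K) (at_right (0::real))"
      by (intro tendsto_intros)
    thus "((\<lambda>t. ?n * (1 - (real ?n + 1) * t) ^ (?n - 1) * measure lborel K) \<longlongrightarrow> ?n * measure lborel K) (at_right (0::real))"
      by simp
    have K0: "K + (\<lambda>x. 0 *\<^sub>R x) ` A = K"
    proof -
      have "(\<lambda>x. 0 *\<^sub>R x) ` A = 0" using A by (auto simp: convex_body_def)
      thus ?thesis by simp
    qed
    have "eventually (\<lambda>t. t \<in> {0<..<1 / (real ?n + 1)}) (at_right 0)"
      by (rule eventually_at_right_real) simp
    thus "\<forall>\<^sub>F t in at_right 0. ?n * (1 - (real ?n + 1) * t) ^ (?n - 1) * measure lborel K \<le> ?f t"
    proof eventually_elim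
      case (elim t)
      hence t: "0 < t" "(real ?n + 1) * t < 1" by (auto simp: field_simps)
      have "measure lborel K + ?n * t * (1 - (real ?n + 1) * t) ^ (?n - 1) * measure lborel K
          \<le> measure lborel (K + (\<lambda>x. t *\<^sub>R x) ` A)"
        by (rule volume_sum_touching[OF A a AK t])
      hence "(?n * (1 - (real ?n + 1) * t) ^ (?n - 1) * measure lborel K) * t \<le>
          measure lborel (K + (\<lambda>x. t *\<^sub>R x) ` A) - measure lborel K" by (simp add: mult_ac)
      thus ?case unfolding K0 using t(1) by (subst pos_le_divide_eq) auto
    qed
  qed simp
  thus "measure lborel K \<le> mixed_volume1 K A" by simp
qed

text \<open>Let e c be the minimum over A of the coordinate for c. The simplex with these lower
  bounds is a homothet of K around A all of whose facets meet A, so the pullback of A into K falls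
  under \<open>mixed_volume1_touching\<close>.\<close>

lemma simplex_circumscribed:
  assumes A: "convex_body A"
  shows "\<exists>s z. s \<ge> 0 \<and> A \<subseteq> (\<lambda>x. z + s *\<^sub>R x) ` K \<and> mixed_volume1 K A = s * measure lborel K"
proof -
  have cA: "compact A" "A \<noteq> {}" using A by (auto simp: convex_body_def)
  have "\<exists>x\<in>A. \<forall>y\<in>A. \<beta> c x \<le> \<beta> c y" for c
    using cA by (intro continuous_attains_inf continuous_intros)
  then obtain a where a: "\<And>c. a c \<in> A" "\<And>c y. y \<in> A \<Longrightarrow> \<beta> c (a c) \<le> \<beta> c y" by metis
  define e where "e c = \<beta> c (a c)" for c
  have le: "e c \<le> \<beta> c x" if "x \<in> A" for c x using a(2)[OF that] by (simp add: e_def)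
  have se: "sum e C \<le> 1"
  proof -
    obtain x where "x \<in> A" using cA by blast
    hence "sum e C \<le> (\<Sum>c\<in>C. \<beta> c x)" using le by (intro sum_mono)
    thus ?thesis by (simp add: sum1)
  qed
  show ?thesis
  proof (cases "sum e C = 1")
    \<comment> \<open>Coordinates sum to 1, so every point of A has the coordinates e c; A is a
      single point and the homothet degenerates to ratio 0.\<close>
    case True
    have "x = (\<Sum>c\<in>C. e c *\<^sub>R c)" if x: "x \<in> A" for x
    proof -
      have "(\<Sum>c\<in>C. \<beta> c x - e c) = 0" by (simp add: sum_subtractf sum1 True)
      hence "\<forall>c\<in>C. \<beta> c x - e c = 0" using fin le[OF x] by (subst (asm) sum_nonneg_eq_0_iff) auto
      hence "(\<Sum>c\<in>C. e c *\<^sub>R c) = (\<Sum>c\<in>C. \<beta> c x *\<^sub>R c)" by (intro sum.cong) auto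
      thus ?thesis by (simp add: sumx)
    qed
    hence Az: "A = {\<Sum>c\<in>C. e c *\<^sub>R c}" using cA by blast
    have "K \<noteq> {}" using int interior_subset by blast
    thus ?thesis unfolding Az using mixed_volume1_point[OF body]
      by (intro exI[of _ 0] exI[of _ "\<Sum>c\<in>C. e c *\<^sub>R c"]) auto
  next
    case False
    define s where "s = 1 - sum e C"
    have s: "s > 0" using se False by (simp add: s_def)
    define z where "z = (\<Sum>c\<in>C. e c *\<^sub>R c)"
    have trunc: "{x. \<forall>c\<in>C. \<beta> c x \<ge> e c} = (\<lambda>x. z + s *\<^sub>R x) ` K"
      unfolding s_def z_def using s by (intro truncated_simplex) (simp add: s_def)
    have AsK: "A \<subseteq> (\<lambda>x. z + s *\<^sub>R x) ` K" unfolding trunc[symmetric] using le by blast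
    \<comment> \<open>The image of A under the inverse of the homothety, so that it touches the
      facets of K itself.\<close>
    define A' where "A' = (\<lambda>x. - (1 / s) *\<^sub>R z + (1 / s) *\<^sub>R x) ` A"
    have undo: "z + s *\<^sub>R (- (1 / s) *\<^sub>R z + (1 / s) *\<^sub>R x) = x" for x using s by (simp add: scaleR_add_right scaleR_diff_right)
    have redo: "- (1 / s) *\<^sub>R z + (1 / s) *\<^sub>R (z + s *\<^sub>R x) = x" for x using s by (simp add: scaleR_add_right scaleR_diff_right)
    have A'b: "convex_body A'"
      unfolding A'_def using convex_body_translate[OF convex_body_scaleR[OF A, of "1 / s"], of "- (1 / s) *\<^sub>R z"]
      by (simp only: image_image)
    have A'K: "A' \<subseteq> K"
    proof
      fix y assume "y \<in> A'"
      then obtain x where x: "x \<in> A" "y = - (1 / s) *\<^sub>R z + (1 / s) *\<^sub>R x" by (auto simp: A'_def)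
      then obtain k where "k \<in> K" "x = z + s *\<^sub>R k" using AsK by blast
      thus "y \<in> K" using x(2) redo by simp
    qed
    have "\<exists>x\<in>A'. \<beta> c x = 0" if c: "c \<in> C" for c
    proof
      let ?y = "- (1 / s) *\<^sub>R z + (1 / s) *\<^sub>R a c"
      show "?y \<in> A'" unfolding A'_def using a(1) by blast
      have "s * \<beta> c ?y + e c = \<beta> c (a c)"
        using beta_sum[OF c, of e ?y] undo[of "a c"] by (simp add: s_def[symmetric] z_def[symmetric] add.commute)
      thus "\<beta> c ?y = 0" using s by (simp add: e_def)
    qed
    hence v: "mixed_volume1 K A' = measure lborel K" by (rule mixed_volume1_touching[OF A'b _ A'K])
    have "A = (\<lambda>x. z + s *\<^sub>R x) ` A'" unfolding A'_def image_image undo by simp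
    hence "mixed_volume1 K A = s * measure lborel K"
      using mixed_volume1_homothety[OF body A'b, of s z] s v by simp
    thus ?thesis using s AsK by (intro exI[of _ s] exI[of _ z]) auto
  qed
qed

end

section \<open>Consequences for simplices and the equivalence\<close>

lemma simplex_circumscribed_homothet:
  fixes K A :: "(real^'n) set"
  assumes "full_dim_convex_body K" "int CARD('n) simplex K" "convex_body A"
  obtains s z where "s \<ge> 0" "A \<subseteq> (\<lambda>x. z + s *\<^sub>R x) ` K" "mixed_volume1 K A = s * measure lborel K"
proof -
  have K: "convex_body K" "interior K \<noteq> {}" using assms(1) by (auto simp: full_dim_convex_body_def)
  have "\<exists>s z. s \<ge> 0 \<and> A \<subseteq> (\<lambda>x. z + s *\<^sub>R x) ` K \<and> mixed_volume1 K A = s * measure lborel K"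
  proof (rule simplex_barycentric[of K])
    show "int DIM(real^'n) simplex K" using assms(2) by simp
    fix C and w :: "real^'n \<Rightarrow> real^'n" and d :: "real^'n \<Rightarrow> real"
    assume "finite C" "card C = DIM(real^'n) + 1"
      "\<And>c. c \<in> C \<Longrightarrow> w c \<bullet> c + d c = 1" "\<And>c c'. c \<in> C \<Longrightarrow> c' \<in> C \<Longrightarrow> c \<noteq> c' \<Longrightarrow> w c \<bullet> c' + d c = 0"
      "\<And>x. (\<Sum>c\<in>C. w c \<bullet> x + d c) = 1" "\<And>x. (\<Sum>c\<in>C. (w c \<bullet> x + d c) *\<^sub>R c) = x"
      "K = {x. \<forall>c\<in>C. w c \<bullet> x + d c \<ge> 0}"
    thus ?thesis using K assms(3) by (intro simplex_circumscribed[of C w d K A]) auto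
  qed
  thus thesis using that by blast
qed

lemma mixed_volume_ineq_iff:
  fixes K :: "(real^'n) set"
  shows "mixed_volume_ineq K A B \<longleftrightarrow>
    measure lborel K * mixed_volume2 A B K \<le> mixed_volume1 K A * mixed_volume1 K B"
  by (simp add: mixed_volume_ineq_def mixed_volume1_def mixed_volume2_def)

lemma mixed_volume_ineq_if_simplex:
  fixes K A B :: "(real^'n) set"
  assumes n: "CARD('n) \<ge> 2" and K: "full_dim_convex_body K" "int CARD('n) simplex K"
    and A: "convex_body A" and B: "convex_body B"
  shows "mixed_volume_ineq K A B"
proof -
  have body: "convex_body K" using K by (simp add: full_dim_convex_body_def)
  obtain s z where s: "s \<ge> 0" "A \<subseteq> (\<lambda>x. z + s *\<^sub>R x) ` K" "mixed_volume1 K A = s * measure lborel K"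
    using simplex_circumscribed_homothet[OF K A] by blast
  have h: "convex_body ((\<lambda>x. z + s *\<^sub>R x) ` K)"
    using convex_body_translate[OF convex_body_scaleR[OF body, of s], of z] by (simp only: image_image)
  have "mixed_volume1 K ((\<lambda>x. z + s *\<^sub>R x) ` K) = s * measure lborel K"
    by (simp add: mixed_volume1_homothety[OF body body s(1)] mixed_volume1_self[OF body])
  hence "mixed_volume2 A B K \<le> mixed_volume2 ((\<lambda>x. z + s *\<^sub>R x) ` K) B K"
    by (intro mixed_volume2_le n body A B h s(2)) (simp add: s(3))
  also have "\<dots> = s * mixed_volume1 K B"
    by (simp add: mixed_volume2_homothety[OF n body body B s(1)] mixed_volume2_self[OF n body B])
  finally have "measure lborel K * mixed_volume2 A B K \<le> measure lborel K * (s * mixed_volume1 K B)"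
    by (intro mult_left_mono) auto
  thus ?thesis by (simp add: mixed_volume_ineq_iff s(3) mult_ac)
qed

text \<open>The circumscribed homothet with ratio s, read backwards, places a copy of M with ratio 1
  / s in K. Monotonicity of the mixed volume excludes larger copies.\<close>

lemma relative_inradius_if_simplex:
  fixes K M :: "(real^'n) set"
  assumes K: "full_dim_convex_body K" "int CARD('n) simplex K" and M: "full_dim_convex_body M"
  shows "relative_inradius K M = measure lborel K / mixed_volume1 K M"
proof -
  have body: "convex_body K" "interior K \<noteq> {}" and Mb: "convex_body M" "interior M \<noteq> {}"
    using K M by (auto simp: full_dim_convex_body_def)
  have V: "measure lborel K > 0" using body measure_pos_iff_interior[of K] by (simp add: convex_body_def)
  have W: "mixed_volume1 K M > 0" by (rule mixed_volume1_pos[OF body Mb])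
  obtain s z where s: "s \<ge> 0" "M \<subseteq> (\<lambda>x. z + s *\<^sub>R x) ` K" "mixed_volume1 K M = s * measure lborel K"
    using simplex_circumscribed_homothet[OF K Mb(1)] by blast
  have s0: "s > 0" using s W by (cases "s = 0") auto
  have q: "measure lborel K / mixed_volume1 K M = 1 / s" using V by (simp add: s(3))
  show ?thesis
    unfolding relative_inradius_def q
  proof (rule cSup_eq_maximum)
    have "(\<lambda>y. - (1 / s) *\<^sub>R z + (1 / s) *\<^sub>R y) ` M \<subseteq> K"
    proof
      fix y assume "y \<in> (\<lambda>y. - (1 / s) *\<^sub>R z + (1 / s) *\<^sub>R y) ` M"
      then obtain m where m: "m \<in> M" "y = - (1 / s) *\<^sub>R z + (1 / s) *\<^sub>R m" by blast
      then obtain k where k: "k \<in> K" "m = z + s *\<^sub>R k" using s(2) by blast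
      have "y = k" using s0 by (simp add: m(2) k(2) scaleR_add_right)
      thus "y \<in> K" using k by simp
    qed
    thus "1 / s \<in> {t. 0 \<le> t \<and> (\<exists>z. (\<lambda>y. z + t *\<^sub>R y) ` M \<subseteq> K)}"
      using s0 by (intro CollectI conjI exI[of _ "- (1 / s) *\<^sub>R z"]) auto
    fix t assume "t \<in> {t. 0 \<le> t \<and> (\<exists>z. (\<lambda>y. z + t *\<^sub>R y) ` M \<subseteq> K)}"
    then obtain z' where t: "0 \<le> t" "(\<lambda>y. z' + t *\<^sub>R y) ` M \<subseteq> K" by blast
    have "convex_body ((\<lambda>y. z' + t *\<^sub>R y) ` M)"
      using convex_body_translate[OF convex_body_scaleR[OF Mb(1), of t], of z'] by (simp only: image_image)
    from mixed_volume1_mono[OF body(1) this body(1) t(2)]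
    have "t * mixed_volume1 K M \<le> measure lborel K"
      by (simp add: mixed_volume1_homothety[OF body(1) Mb(1) t(1)] mixed_volume1_self[OF body(1)])
    hence "t * s \<le> 1" using V by (simp add: s(3) mult.assoc[symmetric])
    thus "t \<le> 1 / s" using s0 by (simp add: pos_le_divide_eq)
  qed
qed

text \<open>A representation of x as a difference of points of K provides a common point of K and K
  - x. This makes (iii) an instance of (ii).\<close>

lemma convex_body_slice:
  fixes K :: "'a::euclidean_space set"
  assumes K: "convex_body K" and x: "x \<in> K + uminus ` K"
  shows "convex_body (K \<inter> (\<lambda>y. y - x) ` K)"
proof -
  obtain a b where ab: "a \<in> K" "b \<in> K" "x = a + - b" using x by (auto elim!: set_plus_elim)
  hence "b \<in> K \<inter> (\<lambda>y. y - x) ` K" by (auto simp: mem_minus_image)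
  moreover have "convex_body ((\<lambda>y. y - x) ` K)" using convex_body_translate[OF K, of "- x"] by (simp add: add.commute)
  ultimately show ?thesis using K by (auto simp: convex_body_def compact_Int convex_Int)
qed

theorem theorem1p2:
  fixes K :: "(real ^ 'n) set"
  assumes "CARD('n) \<ge> 2"
    and "full_dim_convex_body K"
  shows
    "(int CARD('n) simplex K \<longleftrightarrow>
        (\<forall>A B. convex_body A \<and> convex_body B \<longrightarrow> mixed_volume_ineq K A B)) \<and>
     (int CARD('n) simplex K \<longleftrightarrow>
        (\<forall>x. x \<noteq> 0 \<and> x \<in> interior (K + uminus ` K) \<longrightarrow>
             mixed_volume_ineq K (closed_segment 0 x) (K \<inter> (\<lambda>y. y - x) ` K))) \<and>
     (int CARD('n) simplex K \<longleftrightarrow>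
        (\<forall>u\<in>sphere 0 1.
           longest_chord K u =
             measure lborel K / mixed_volume (replicate (CARD('n) - 1) K @ [closed_segment 0 u]))) \<and>
     (int CARD('n) simplex K \<longleftrightarrow>
        (\<forall>M. full_dim_convex_body M \<longrightarrow>
           relative_inradius K M =
             measure lborel K / mixed_volume (replicate (CARD('n) - 1) K @ [M])))"
    (is "(?i \<longleftrightarrow> ?ii) \<and> (_ \<longleftrightarrow> ?iii) \<and> (_ \<longleftrightarrow> ?iv) \<and> (_ \<longleftrightarrow> ?v)")
proof -
  have body: "convex_body K" using assms(2) by (simp add: full_dim_convex_body_def)
  \<comment> \<open>The cycle (i), (ii), (iii), (iv), (i) and the detour (i), (v), (iv) link all
    five statements.\<close>
  have "?i \<Longrightarrow> ?ii" using mixed_volume_ineq_if_simplex[OF assms] by blast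
  moreover have "?ii \<Longrightarrow> ?iii"
    using convex_body_slice[OF body] convex_body_segment interior_subset by blast
  moreover have "?iii \<Longrightarrow> ?iv"
    using longest_chord_if_ineq[OF assms] by (simp add: mixed_volume1_def)
  moreover have "?iv \<Longrightarrow> ?i"
    by (rule simplex_if_longest_chord[OF assms(2)]) (simp add: mixed_volume1_def)
  moreover have "?i \<Longrightarrow> ?v"
    using relative_inradius_if_simplex[OF assms(2)] by (simp add: mixed_volume1_def)
  moreover have "?v \<Longrightarrow> ?iv"
    using longest_chord_if_relative_inradius[OF assms(2)] by (simp add: mixed_volume1_def)
  ultimately show ?thesis by blast
qed

end
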